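(* Let $(E_1,\nabla^1)$ and $(E_2,\nabla^2)$ be a pair of Courant algebroids equipped with torsion-free Courant algebroid connections (that is, $T_{\nabla^1}=0$ and $T_{\nabla^2}=0$). Let $R:E_1\dashrightarrow E_2$ be a Courant algebroid relation supported on $S$. If $\nabla^1\sim_R\nabla^2$, then also $R_{\nabla^1}\sim_R R_{\nabla^2}$, where $R_{\nabla^i}$ denotes the generalized Riemann tensor of $\nabla^i$.
   Context: A Courant algebroid over a smooth manifold $M$ is a tuple $(E,\rho,\langle\cdot,\cdot\rangle,[\cdot,\cdot])$, where $E\to M$ is a real vector bundle of finite rank, $\rho:E\to TM$ is a vector bundle map over the identity (the anchor), $\langle\cdot,\cdot\rangle$ is a fiber-wise metric on $E$ (symmetric and non-degenerate, of arbitrary but constant signature), and $[\cdot,\cdot]$ is an $\mathbb{R}$-bilinear bracket on $\Gamma(E)$ such that: C1) $[\psi,f\psi']=f[\psi,\psi']+(\mathcal{L}_{\rho(\psi)}f)\psi'$; C2) $[\psi,[\psi',\psi'']]=[[\psi,\psi'],\psi'']+[\psi',[\psi,\psi'']]$; C3) $\mathcal{L}_{\rho(\psi)}\langle\psi',\psi''\rangle=\langle[\psi,\psi'],\psi''\rangle+\langle\psi',[\psi,\psi'']\rangle$; C4) $\langle[\psi,\psi],\psi'\rangle=\frac12\mathcal{L}_{\rho(\psi')}\langle\psi,\psi\rangle$. A subbundle of $E$ supported on an embedded submanifold $S\subseteq M$ is a vector subbundle $L$ of $E_S$; $\Gamma(E;L)=\{\psi\in\Gamma(E)\mid\psi|_S\in\Gamma(L)\}$.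 An involutive structure supported on $S$ is such an $L$ with $L\subseteq L^\perp$, $\rho(L^\perp)\subseteq TS$ and $[\psi,\psi']\in\Gamma(E;L)$ for all $\psi,\psi'\in\Gamma(E;L)$. $\overline{E}$ is $E$ with $\langle\cdot,\cdot\rangle$ replaced by its negative; the product Courant algebroid has componentwise anchor and bracket on pairs of pulled-back sections and the sum of the pulled-back metrics (extended by $C^\infty$-linearity and C1), C4)). A Courant algebroid relation $R:E_1\dashrightarrow E_2$ supported on $S\subseteq M_1\times M_2$ is an involutive structure in $E_1\times\overline{E}_2$ supported on $S$. A Courant algebroid connection on $E$ is an $\mathbb{R}$-bilinear map $\nabla:\Gamma(E)\times\Gamma(E)\to\Gamma(E)$, $\nabla_\psi\psi'=\nabla(\psi,\psi')$, with $\nabla_{f\psi}\psi'=f\nabla_\psi\psi'$, $\nabla_\psi(f\psi')=f\nabla_\psi\psi'+(\mathcal{L}_{\rho(\psi)}f)\psi'$ and $\mathcal{L}_{\rho(\psi)}\langle\psi',\psi''\rangle=\langle\nabla_\psi\psi',\psi''\rangle+\langle\psi',\nabla_\psi\psi''\rangle$. Its torsion 3-form is $T_\nabla(\psi,\psi',\psi'')=\langle\nabla_\psi\psi'-\nabla_{\psi'}\psi-[\psi,\psi'],\psi''\rangle+\langle\nabla_{\psi''}\psi,\psi'\rangle$. Its generalized Riemann tensor is the covariant 4-tensor $$R_\nabla(\phi',\phi,\psi,\psi')=\tfrac12\big(R^{(0)}_\nabla(\phi',\phi,\psi,\psi')+R^{(0)}_\nabla(\psi',\psi,\phi,\phi')+\langle\mathbf{K}(\phi,\phi'),\mathbf{K}(\psi,\psi')\rangle\big),$$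 where $R^{(0)}_\nabla(\phi',\phi,\psi,\psi')=\langle\nabla_\psi\nabla_{\psi'}\phi-\nabla_{\psi'}\nabla_\psi\phi-\nabla_{[\psi,\psi']}\phi,\phi'\rangle$ and $\mathbf{K}$ is defined by $\langle\mathbf{K}(\psi,\psi'),\phi\rangle=\langle\nabla_\phi\psi,\psi'\rangle$. The connections $\nabla^1,\nabla^2$ define a connection $\nabla$ on $E_1\times\overline{E}_2$ by $\nabla_{(\psi_1,\psi_2)}(\phi_1,\phi_2)=(\nabla^1_{\psi_1}\phi_1,\nabla^2_{\psi_2}\phi_2)$ on pairs of pulled-back sections, extended by the Leibniz rules. $\nabla^1\sim_R\nabla^2$ means $\nabla_\psi\psi'\in\Gamma(E_1\times\overline{E}_2;R)$ for all $\psi,\psi'\in\Gamma(E_1\times\overline{E}_2;R)$. Covariant $k$-tensors $t_1$ on $E_1$ and $t_2$ on $E_2$ are $R$-related, $t_1\sim_Rt_2$, if $(t_1)_{s_1}(e_1^{(1)},\dots,e_1^{(k)})=(t_2)_{s_2}(e_2^{(1)},\dots,e_2^{(k)})$ for all $(s_1,s_2)\in S$ and all $(e_1^{(i)},e_2^{(i)})\in R_{(s_1,s_2)}$, $i=1,\dots,k$. *)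

theory Defs
  imports "HOL-Analysis.Analysis"
begin

section \<open>Smooth manifolds\<close>

primrec cont_diff_on :: "nat \<Rightarrow> 'a::real_normed_vector set \<Rightarrow> ('a \<Rightarrow> 'b::real_normed_vector) \<Rightarrow> bool" where
  "cont_diff_on 0 W f \<longleftrightarrow> continuous_on W f"
| "cont_diff_on (Suc n) W f \<longleftrightarrow> (\<forall>x\<in>W. f differentiable (at x)) \<and>
     (\<forall>v. cont_diff_on n W (\<lambda>x. frechet_derivative f (at x) v))"

text \<open>Used only for open sets in finite-dimensional spaces.\<close>

definition smooth_on :: "'a::real_normed_vector set \<Rightarrow> ('a \<Rightarrow> 'b::real_normed_vector) \<Rightarrow> bool" where
  "smooth_on W f \<longleftrightarrow> (\<forall>n. cont_diff_on n W f)"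

text \<open>
  The model space of a manifold, and the typical fibre of a vector bundle, is a type of class
  \<open>real_inner\<close> that is required to be finite-dimensional. The class \<open>euclidean_space\<close> would
  exclude dimension 0, and with it for instance the Courant algebroids over a point.
\<close>

definition finite_dimensional :: "'a::real_vector itself \<Rightarrow> bool" where
  "finite_dimensional _ \<longleftrightarrow> (\<exists>B::'a set. finite B \<and> span B = UNIV)"

type_synonym ('m, 'e) chart = "'m set \<times> ('m \<Rightarrow> 'e)"

record ('m, 'e) manifold =
  mtop :: "'m topology"
  atlas :: "('m, 'e) chart set"

abbreviation points :: "('m, 'e) manifold \<Rightarrow> 'm set" where
  "points M \<equiv> topspace (mtop M)"

definition is_chart :: "'m topology \<Rightarrow> ('m, 'e::real_inner) chart \<Rightarrow> bool" where
  "is_chart X c \<longleftrightarrow> (case c of (U, \<phi>) \<Rightarrow> openin X U \<and> open (\<phi> ` U) \<and>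
     homeomorphic_map (subtopology X U) (top_of_set (\<phi> ` U)) \<phi>)"

definition compatible :: "('m, 'e::real_inner) chart \<Rightarrow> ('m, 'e) chart \<Rightarrow> bool" where
  "compatible c d \<longleftrightarrow> (case (c, d) of ((U, \<phi>), (V, \<eta>)) \<Rightarrow>
     smooth_on (\<phi> ` (U \<inter> V)) (\<eta> \<circ> inv_into U \<phi>) \<and>
     smooth_on (\<eta> ` (U \<inter> V)) (\<phi> \<circ> inv_into V \<eta>))"

definition smooth_manifold :: "('m, 'e::real_inner) manifold \<Rightarrow> bool" where
  "smooth_manifold M \<longleftrightarrow> finite_dimensional TYPE('e) \<and>
     Hausdorff_space (mtop M) \<and> second_countable (mtop M) \<and>
     (\<forall>c\<in>atlas M. is_chart (mtop M) c) \<and> (\<Union>c\<in>atlas M. fst c) = points M \<and>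
     (\<forall>c\<in>atlas M. \<forall>d\<in>atlas M. compatible c d)"

text \<open>Smoothness of a function on an open subset \<open>A\<close> of the manifold.\<close>

definition smooth_map_on ::
  "('m, 'e::real_inner) manifold \<Rightarrow> 'm set \<Rightarrow> ('m \<Rightarrow> 'b::real_normed_vector) \<Rightarrow> bool" where
  "smooth_map_on M A f \<longleftrightarrow> (\<forall>(U, \<phi>)\<in>atlas M. smooth_on (\<phi> ` (U \<inter> A)) (f \<circ> inv_into U \<phi>))"

text \<open>Values outside \<open>points M\<close> are irrelevant.\<close>

definition smooth_functions :: "('m, 'e::real_inner) manifold \<Rightarrow> ('m \<Rightarrow> real) set" where
  "smooth_functions M = {f. smooth_map_on M (points M) f}"

text \<open>Tangent vectors at \<open>x\<close> are derivations of the algebra of smooth functions at \<open>x\<close>.\<close>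

definition tangent_vector ::
  "('m, 'e::real_inner) manifold \<Rightarrow> 'm \<Rightarrow> (('m \<Rightarrow> real) \<Rightarrow> real) \<Rightarrow> bool" where
  "tangent_vector M x D \<longleftrightarrow>
     (\<forall>f\<in>smooth_functions M. \<forall>h\<in>smooth_functions M. \<forall>a b.
        D (\<lambda>y. a * f y + b * h y) = a * D f + b * D h) \<and>
     (\<forall>f\<in>smooth_functions M. \<forall>h\<in>smooth_functions M.
        D (\<lambda>y. f y * h y) = D f * h x + f x * D h)"

text \<open>
  A slice chart for \<open>S\<close> is a chart of the maximal atlas in which \<open>S\<close> is cut out by the linear
  subspace \<open>V\<close> of the model space.
\<close>

definition slice_chart ::
  "('m, 'e::real_inner) manifold \<Rightarrow> 'm set \<Rightarrow> ('m, 'e) chart \<Rightarrow> 'e set \<Rightarrow> bool" where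
  "slice_chart M S c V \<longleftrightarrow> is_chart (mtop M) c \<and> (\<forall>d\<in>atlas M. compatible c d) \<and> subspace V \<and>
     (case c of (U, \<phi>) \<Rightarrow> \<phi> ` (U \<inter> S) = \<phi> ` U \<inter> V)"

definition embedded_submanifold :: "('m, 'e::real_inner) manifold \<Rightarrow> 'm set \<Rightarrow> bool" where
  "embedded_submanifold M S \<longleftrightarrow> S \<subseteq> points M \<and>
     (\<exists>k. \<forall>s\<in>S. \<exists>c V. slice_chart M S c V \<and> s \<in> fst c \<and> dim V = k)"

text \<open>The derivation \<open>D\<close> at \<open>s\<close> lies in (the image in \<open>TM\<close> of) the tangent space of \<open>S\<close> at \<open>s\<close>.\<close>

definition tangent_to ::
  "('m, 'e::real_inner) manifold \<Rightarrow> 'm set \<Rightarrow> 'm \<Rightarrow> (('m \<Rightarrow> real) \<Rightarrow> real) \<Rightarrow> bool" where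
  "tangent_to M S s D \<longleftrightarrow> (\<exists>U \<phi> V. slice_chart M S (U, \<phi>) V \<and> s \<in> U \<and>
     (\<exists>v\<in>V. \<forall>f\<in>smooth_functions M.
        D f = frechet_derivative (f \<circ> inv_into U \<phi>) (at (\<phi> s)) v))"

definition prod_manifold ::
  "('m1, 'e1::real_inner) manifold \<Rightarrow> ('m2, 'e2::real_inner) manifold \<Rightarrow> ('m1 \<times> 'm2, 'e1 \<times> 'e2) manifold" where
  "prod_manifold M1 M2 = \<lparr>mtop = prod_topology (mtop M1) (mtop M2),
     atlas = {(U \<times> V, map_prod \<phi> \<eta>) | U \<phi> V \<eta>. (U, \<phi>) \<in> atlas M1 \<and> (V, \<eta>) \<in> atlas M2}\<rparr>"

section \<open>Vector bundles with an anchor and a fibre-wise metric\<close>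

text \<open>
  The fibres are linear subspaces of one real vector space \<open>'v\<close> (this is no restriction: the direct
  sum of all the fibres is such a space). The smooth structure is given by local
  trivializations, i.e. linear isomorphisms from the fibres to the typical fibre \<open>'f\<close>, with
  smooth transition functions. The anchor sends a vector of the fibre at \<open>x\<close> to a
  derivation at \<open>x\<close>.
\<close>

record ('m, 'e, 'v, 'f) anchored_bundle =
  base :: "('m, 'e) manifold"
  fibre :: "'m \<Rightarrow> 'v set"
  trivs :: "('m set \<times> ('m \<Rightarrow> 'v \<Rightarrow> 'f)) set"
  anchor :: "'m \<Rightarrow> 'v \<Rightarrow> ('m \<Rightarrow> real) \<Rightarrow> real"
  metric :: "'m \<Rightarrow> 'v \<Rightarrow> 'v \<Rightarrow> real"

abbreviation bpoints :: "('m, 'e, 'v, 'f) anchored_bundle \<Rightarrow> 'm set" where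
  "bpoints E \<equiv> points (base E)"

definition linear_iso_on :: "'v::real_vector set \<Rightarrow> ('v \<Rightarrow> 'f::real_vector) \<Rightarrow> bool" where
  "linear_iso_on F A \<longleftrightarrow> bij_betw A F UNIV \<and>
     (\<forall>u\<in>F. \<forall>v\<in>F. \<forall>a b. A (a *\<^sub>R u + b *\<^sub>R v) = a *\<^sub>R A u + b *\<^sub>R A v)"

definition vector_bundle ::
  "('m, 'e::real_inner, 'v::real_vector, 'f::real_inner) anchored_bundle \<Rightarrow> bool" where
  "vector_bundle E \<longleftrightarrow> smooth_manifold (base E) \<and> finite_dimensional TYPE('f) \<and>
     (\<forall>x\<in>bpoints E. subspace (fibre E x)) \<and>
     (\<forall>(U, \<Phi>)\<in>trivs E. openin (mtop (base E)) U \<and> (\<forall>x\<in>U. linear_iso_on (fibre E x) (\<Phi> x))) \<and>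
     (\<Union>t\<in>trivs E. fst t) = bpoints E \<and>
     (\<forall>(U, \<Phi>)\<in>trivs E. \<forall>(V, \<Psi>)\<in>trivs E. \<forall>w.
        smooth_map_on (base E) (U \<inter> V) (\<lambda>x. \<Psi> x (inv_into (fibre E x) (\<Phi> x) w)))"

definition smooth_section_on ::
  "('m, 'e::real_inner, 'v::real_vector, 'f::real_inner) anchored_bundle \<Rightarrow> 'm set \<Rightarrow> ('m \<Rightarrow> 'v) \<Rightarrow> bool" where
  "smooth_section_on E A \<psi> \<longleftrightarrow> (\<forall>x\<in>A. \<psi> x \<in> fibre E x) \<and>
     (\<forall>(U, \<Phi>)\<in>trivs E. smooth_map_on (base E) (A \<inter> U) (\<lambda>x. \<Phi> x (\<psi> x)))"

text \<open>
  Global smooth sections. As HOL functions they are normalized to vanish outside the base, so that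
  equality of sections is equality of functions.
\<close>

definition sections ::
  "('m, 'e::real_inner, 'v::real_vector, 'f::real_inner) anchored_bundle \<Rightarrow> ('m \<Rightarrow> 'v) set" where
  "sections E = {\<psi>. smooth_section_on E (bpoints E) \<psi> \<and> (\<forall>x. x \<notin> bpoints E \<longrightarrow> \<psi> x = 0)}"

text \<open>The Lie derivative of \<open>f\<close> along the anchor of \<open>\<psi>\<close>.\<close>

definition lie ::
  "('m, 'e, 'v, 'f) anchored_bundle \<Rightarrow> ('m \<Rightarrow> 'v) \<Rightarrow> ('m \<Rightarrow> real) \<Rightarrow> 'm \<Rightarrow> real" where
  "lie E \<psi> f = (\<lambda>x. anchor E x (\<psi> x) f)"

text \<open>The function given by the pairing of two sections.\<close>

definition pairing ::
  "('m, 'e, 'v, 'f) anchored_bundle \<Rightarrow> ('m \<Rightarrow> 'v) \<Rightarrow> ('m \<Rightarrow> 'v) \<Rightarrow> 'm \<Rightarrow> real" where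
  "pairing E \<psi> \<psi>' = (\<lambda>x. metric E x (\<psi> x) (\<psi>' x))"

definition is_anchor ::
  "('m, 'e::real_inner, 'v::real_vector, 'f::real_inner) anchored_bundle \<Rightarrow> bool" where
  "is_anchor E \<longleftrightarrow>
     (\<forall>x\<in>bpoints E. \<forall>u\<in>fibre E x. tangent_vector (base E) x (anchor E x u)) \<and>
     (\<forall>x\<in>bpoints E. \<forall>u\<in>fibre E x. \<forall>v\<in>fibre E x. \<forall>a b. \<forall>f\<in>smooth_functions (base E).
        anchor E x (a *\<^sub>R u + b *\<^sub>R v) f = a * anchor E x u f + b * anchor E x v f) \<and>
     (\<forall>\<psi>\<in>sections E. \<forall>f\<in>smooth_functions (base E). lie E \<psi> f \<in> smooth_functions (base E))"

text \<open>The form \<open>g\<close> on \<open>F\<close> has a basis \<open>P \<union> N\<close> in which it is diagonal with \<open>p\<close> entries 1 and \<open>q\<close> entries -1.\<close>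

definition has_signature ::
  "('v::real_vector \<Rightarrow> 'v \<Rightarrow> real) \<Rightarrow> 'v set \<Rightarrow> nat \<Rightarrow> nat \<Rightarrow> bool" where
  "has_signature g F p q \<longleftrightarrow> (\<exists>P N. finite P \<and> finite N \<and> P \<inter> N = {} \<and> card P = p \<and> card N = q \<and>
     independent (P \<union> N) \<and> span (P \<union> N) = F \<and>
     (\<forall>u\<in>P \<union> N. \<forall>v\<in>P \<union> N. g u v = (if u \<noteq> v then 0 else if u \<in> P then 1 else -1)))"

definition is_metric ::
  "('m, 'e::real_inner, 'v::real_vector, 'f::real_inner) anchored_bundle \<Rightarrow> bool" where
  "is_metric E \<longleftrightarrow>
     (\<forall>x\<in>bpoints E. \<forall>u\<in>fibre E x. \<forall>v\<in>fibre E x. metric E x u v = metric E x v u) \<and>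
     (\<forall>x\<in>bpoints E. \<forall>u\<in>fibre E x. \<forall>v\<in>fibre E x. \<forall>w\<in>fibre E x. \<forall>a b.
        metric E x (a *\<^sub>R u + b *\<^sub>R v) w = a * metric E x u w + b * metric E x v w) \<and>
     (\<forall>x\<in>bpoints E. \<forall>u\<in>fibre E x. (\<forall>v\<in>fibre E x. metric E x u v = 0) \<longrightarrow> u = 0) \<and>
     (\<exists>p q. \<forall>x\<in>bpoints E. has_signature (metric E x) (fibre E x) p q) \<and>
     (\<forall>\<psi>\<in>sections E. \<forall>\<psi>'\<in>sections E. pairing E \<psi> \<psi>' \<in> smooth_functions (base E))"

definition opposite ::
  "('m, 'e, 'v, 'f) anchored_bundle \<Rightarrow> ('m, 'e, 'v, 'f) anchored_bundle" where
  "opposite E = E\<lparr>metric := \<lambda>x u v. - metric E x u v\<rparr>"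

text \<open>
  Product over the product manifold. For the anchor, the tangent space at \<open>(x, y)\<close> is the direct sum
  of the tangent spaces at \<open>x\<close> and \<open>y\<close>: a pair of derivations acts through the partial functions.
\<close>

definition prod_bundle ::
  "('m1, 'e1::real_inner, 'v1, 'f1) anchored_bundle \<Rightarrow> ('m2, 'e2::real_inner, 'v2, 'f2) anchored_bundle \<Rightarrow>
   ('m1 \<times> 'm2, 'e1 \<times> 'e2, 'v1 \<times> 'v2, 'f1 \<times> 'f2) anchored_bundle" where
  "prod_bundle E1 E2 = \<lparr>base = prod_manifold (base E1) (base E2),
     fibre = (\<lambda>(x, y). fibre E1 x \<times> fibre E2 y),
     trivs = {(U \<times> V, \<lambda>(x, y). map_prod (\<Phi> x) (\<Psi> y)) | U \<Phi> V \<Psi>. (U, \<Phi>) \<in> trivs E1 \<and> (V, \<Psi>) \<in> trivs E2},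
     anchor = (\<lambda>(x, y) (u, v) f. anchor E1 x u (\<lambda>x'. f (x', y)) + anchor E2 y v (\<lambda>y'. f (x, y'))),
     metric = (\<lambda>(x, y) (u, v) (u', v'). metric E1 x u u' + metric E2 y v v')\<rparr>"

text \<open>The section of the product bundle given by a pair of pulled-back sections.\<close>

definition pair_section ::
  "('m1, 'e1, 'v1::real_vector, 'f1) anchored_bundle \<Rightarrow> ('m2, 'e2, 'v2::real_vector, 'f2) anchored_bundle \<Rightarrow>
   ('m1 \<Rightarrow> 'v1) \<Rightarrow> ('m2 \<Rightarrow> 'v2) \<Rightarrow> 'm1 \<times> 'm2 \<Rightarrow> 'v1 \<times> 'v2" where
  "pair_section E1 E2 \<psi>1 \<psi>2 =
     (\<lambda>(x, y). if x \<in> bpoints E1 \<and> y \<in> bpoints E2 then (\<psi>1 x, \<psi>2 y) else 0)"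

section \<open>Courant algebroids, relations and connections\<close>

type_synonym ('m, 'v) section_op = "('m \<Rightarrow> 'v) \<Rightarrow> ('m \<Rightarrow> 'v) \<Rightarrow> 'm \<Rightarrow> 'v"

definition bilinear_on_sections ::
  "('m, 'e::real_inner, 'v::real_vector, 'f::real_inner) anchored_bundle \<Rightarrow> ('m, 'v) section_op \<Rightarrow> bool" where
  "bilinear_on_sections E B \<longleftrightarrow>
     (\<forall>\<psi>\<in>sections E. \<forall>\<psi>'\<in>sections E. B \<psi> \<psi>' \<in> sections E) \<and>
     (\<forall>\<psi>\<in>sections E. \<forall>\<psi>'\<in>sections E. \<forall>\<eta>\<in>sections E. \<forall>a b.
        B (\<lambda>x. a *\<^sub>R \<psi> x + b *\<^sub>R \<psi>' x) \<eta> = (\<lambda>x. a *\<^sub>R B \<psi> \<eta> x + b *\<^sub>R B \<psi>' \<eta> x) \<and>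
        B \<eta> (\<lambda>x. a *\<^sub>R \<psi> x + b *\<^sub>R \<psi>' x) = (\<lambda>x. a *\<^sub>R B \<eta> \<psi> x + b *\<^sub>R B \<eta> \<psi>' x))"

definition courant_algebroid ::
  "('m, 'e::real_inner, 'v::real_vector, 'f::real_inner) anchored_bundle \<Rightarrow> ('m, 'v) section_op \<Rightarrow> bool" where
  "courant_algebroid E br \<longleftrightarrow>
     vector_bundle E \<and> is_anchor E \<and> is_metric E \<and> bilinear_on_sections E br \<and>
     (\<forall>\<psi>\<in>sections E. \<forall>\<psi>'\<in>sections E. \<forall>f\<in>smooth_functions (base E).
        br \<psi> (\<lambda>x. f x *\<^sub>R \<psi>' x) = (\<lambda>x. f x *\<^sub>R br \<psi> \<psi>' x + lie E \<psi> f x *\<^sub>R \<psi>' x)) \<and>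
     (\<forall>\<psi>\<in>sections E. \<forall>\<psi>'\<in>sections E. \<forall>\<psi>''\<in>sections E.
        br \<psi> (br \<psi>' \<psi>'') = (\<lambda>x. br (br \<psi> \<psi>') \<psi>'' x + br \<psi>' (br \<psi> \<psi>'') x)) \<and>
     (\<forall>\<psi>\<in>sections E. \<forall>\<psi>'\<in>sections E. \<forall>\<psi>''\<in>sections E. \<forall>x\<in>bpoints E.
        lie E \<psi> (pairing E \<psi>' \<psi>'') x = pairing E (br \<psi> \<psi>') \<psi>'' x + pairing E \<psi>' (br \<psi> \<psi>'') x) \<and>
     (\<forall>\<psi>\<in>sections E. \<forall>\<psi>'\<in>sections E. \<forall>x\<in>bpoints E.
        pairing E (br \<psi> \<psi>) \<psi>' x = 1 / 2 * lie E \<psi>' (pairing E \<psi> \<psi>) x)"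

text \<open>
  A vector subbundle \<open>L\<close> of the restriction of \<open>E\<close> to an embedded submanifold \<open>S\<close>: a family of
  subspaces of constant rank \<open>r\<close> with smooth local frames over \<open>S\<close>. The frame sections are given on a
  neighbourhood in the ambient base, since smooth sections over \<open>S\<close> are locally restrictions of
  such sections. Only the values of \<open>L\<close> on \<open>S\<close> matter.
\<close>

definition subbundle_on ::
  "('m, 'e::real_inner, 'v::real_vector, 'f::real_inner) anchored_bundle \<Rightarrow> 'm set \<Rightarrow> ('m \<Rightarrow> 'v set) \<Rightarrow> bool" where
  "subbundle_on E S L \<longleftrightarrow> (\<exists>r::nat. \<forall>s\<in>S. \<exists>U e.
     openin (mtop (base E)) U \<and> s \<in> U \<and> (\<forall>i<r. smooth_section_on E U (e i)) \<and>
     (\<forall>x\<in>U \<inter> S. inj_on (\<lambda>i. e i x) {..<r} \<and> independent ((\<lambda>i. e i x) ` {..<r}) \<and>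
        span ((\<lambda>i. e i x) ` {..<r}) = L x))"

definition sections_in ::
  "('m, 'e::real_inner, 'v::real_vector, 'f::real_inner) anchored_bundle \<Rightarrow> 'm set \<Rightarrow> ('m \<Rightarrow> 'v set) \<Rightarrow> ('m \<Rightarrow> 'v) set" where
  "sections_in E S L = {\<psi>\<in>sections E. \<forall>s\<in>S. \<psi> s \<in> L s}"

definition perp ::
  "('m, 'e, 'v, 'f) anchored_bundle \<Rightarrow> ('m \<Rightarrow> 'v set) \<Rightarrow> 'm \<Rightarrow> 'v set" where
  "perp E L x = {u\<in>fibre E x. \<forall>l\<in>L x. metric E x u l = 0}"

definition involutive_structure ::
  "('m, 'e::real_inner, 'v::real_vector, 'f::real_inner) anchored_bundle \<Rightarrow> ('m, 'v) section_op \<Rightarrow>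
   'm set \<Rightarrow> ('m \<Rightarrow> 'v set) \<Rightarrow> bool" where
  "involutive_structure E br S L \<longleftrightarrow>
     embedded_submanifold (base E) S \<and> subbundle_on E S L \<and>
     (\<forall>s\<in>S. L s \<subseteq> perp E L s) \<and>
     (\<forall>s\<in>S. \<forall>u\<in>perp E L s. tangent_to (base E) S s (anchor E s u)) \<and>
     (\<forall>\<psi>\<in>sections_in E S L. \<forall>\<psi>'\<in>sections_in E S L. br \<psi> \<psi>' \<in> sections_in E S L)"

text \<open>
  The bracket of the product Courant algebroid: componentwise on pairs of pulled-back sections. Its
  values on all other sections are forced by the Courant algebroid axioms, since locally every
  section is a combination of such pairs with smooth coefficients.
\<close>

definition product_bracket ::
  "('m1, 'e1::real_inner, 'v1::real_vector, 'f1::real_inner) anchored_bundle \<Rightarrow> ('m1, 'v1) section_op \<Rightarrow>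
   ('m2, 'e2::real_inner, 'v2::real_vector, 'f2::real_inner) anchored_bundle \<Rightarrow> ('m2, 'v2) section_op \<Rightarrow>
   ('m1 \<times> 'm2, 'v1 \<times> 'v2) section_op \<Rightarrow> bool" where
  "product_bracket E1 br1 E2 br2 br \<longleftrightarrow> courant_algebroid (prod_bundle E1 E2) br \<and>
     (\<forall>\<psi>1\<in>sections E1. \<forall>\<psi>2\<in>sections E2. \<forall>\<phi>1\<in>sections E1. \<forall>\<phi>2\<in>sections E2.
        br (pair_section E1 E2 \<psi>1 \<psi>2) (pair_section E1 E2 \<phi>1 \<phi>2) =
        pair_section E1 E2 (br1 \<psi>1 \<phi>1) (br2 \<psi>2 \<phi>2))"

definition courant_relation ::
  "('m1, 'e1::real_inner, 'v1::real_vector, 'f1::real_inner) anchored_bundle \<Rightarrow> ('m1, 'v1) section_op \<Rightarrow>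
   ('m2, 'e2::real_inner, 'v2::real_vector, 'f2::real_inner) anchored_bundle \<Rightarrow> ('m2, 'v2) section_op \<Rightarrow>
   ('m1 \<times> 'm2) set \<Rightarrow> ('m1 \<times> 'm2 \<Rightarrow> ('v1 \<times> 'v2) set) \<Rightarrow> bool" where
  "courant_relation E1 br1 E2 br2 S R \<longleftrightarrow>
     (\<exists>br. product_bracket E1 br1 (opposite E2) br2 br \<and>
        involutive_structure (prod_bundle E1 (opposite E2)) br S R)"

definition courant_connection ::
  "('m, 'e::real_inner, 'v::real_vector, 'f::real_inner) anchored_bundle \<Rightarrow> ('m, 'v) section_op \<Rightarrow> bool" where
  "courant_connection E nab \<longleftrightarrow> bilinear_on_sections E nab \<and>
     (\<forall>\<psi>\<in>sections E. \<forall>\<psi>'\<in>sections E. \<forall>f\<in>smooth_functions (base E).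
        nab (\<lambda>x. f x *\<^sub>R \<psi> x) \<psi>' = (\<lambda>x. f x *\<^sub>R nab \<psi> \<psi>' x)) \<and>
     (\<forall>\<psi>\<in>sections E. \<forall>\<psi>'\<in>sections E. \<forall>f\<in>smooth_functions (base E).
        nab \<psi> (\<lambda>x. f x *\<^sub>R \<psi>' x) = (\<lambda>x. f x *\<^sub>R nab \<psi> \<psi>' x + lie E \<psi> f x *\<^sub>R \<psi>' x)) \<and>
     (\<forall>\<psi>\<in>sections E. \<forall>\<psi>'\<in>sections E. \<forall>\<psi>''\<in>sections E. \<forall>x\<in>bpoints E.
        lie E \<psi> (pairing E \<psi>' \<psi>'') x = pairing E (nab \<psi> \<psi>') \<psi>'' x + pairing E \<psi>' (nab \<psi> \<psi>'') x)"

text \<open>As for brackets, a product connection is determined on all sections by its Leibniz rules.\<close>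

definition product_connection ::
  "('m1, 'e1::real_inner, 'v1::real_vector, 'f1::real_inner) anchored_bundle \<Rightarrow> ('m1, 'v1) section_op \<Rightarrow>
   ('m2, 'e2::real_inner, 'v2::real_vector, 'f2::real_inner) anchored_bundle \<Rightarrow> ('m2, 'v2) section_op \<Rightarrow>
   ('m1 \<times> 'm2, 'v1 \<times> 'v2) section_op \<Rightarrow> bool" where
  "product_connection E1 nab1 E2 nab2 nab \<longleftrightarrow> courant_connection (prod_bundle E1 E2) nab \<and>
     (\<forall>\<psi>1\<in>sections E1. \<forall>\<psi>2\<in>sections E2. \<forall>\<phi>1\<in>sections E1. \<forall>\<phi>2\<in>sections E2.
        nab (pair_section E1 E2 \<psi>1 \<psi>2) (pair_section E1 E2 \<phi>1 \<phi>2) =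
        pair_section E1 E2 (nab1 \<psi>1 \<phi>1) (nab2 \<psi>2 \<phi>2))"

definition related_connections ::
  "('m1, 'e1::real_inner, 'v1::real_vector, 'f1::real_inner) anchored_bundle \<Rightarrow>
   ('m2, 'e2::real_inner, 'v2::real_vector, 'f2::real_inner) anchored_bundle \<Rightarrow>
   ('m1 \<times> 'm2) set \<Rightarrow> ('m1 \<times> 'm2 \<Rightarrow> ('v1 \<times> 'v2) set) \<Rightarrow>
   ('m1, 'v1) section_op \<Rightarrow> ('m2, 'v2) section_op \<Rightarrow> bool" where
  "related_connections E1 E2 S R nab1 nab2 \<longleftrightarrow>
     (\<exists>nab. product_connection E1 nab1 (opposite E2) nab2 nab \<and>
        (\<forall>\<psi>\<in>sections_in (prod_bundle E1 (opposite E2)) S R.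
         \<forall>\<psi>'\<in>sections_in (prod_bundle E1 (opposite E2)) S R.
           nab \<psi> \<psi>' \<in> sections_in (prod_bundle E1 (opposite E2)) S R))"

section \<open>Torsion and the generalized Riemann tensor\<close>

definition torsion ::
  "('m, 'e, 'v::real_vector, 'f) anchored_bundle \<Rightarrow> ('m, 'v) section_op \<Rightarrow> ('m, 'v) section_op \<Rightarrow>
   ('m \<Rightarrow> 'v) \<Rightarrow> ('m \<Rightarrow> 'v) \<Rightarrow> ('m \<Rightarrow> 'v) \<Rightarrow> 'm \<Rightarrow> real" where
  "torsion E br nab \<psi> \<psi>' \<psi>'' = (\<lambda>x.
     pairing E (\<lambda>y. nab \<psi> \<psi>' y - nab \<psi>' \<psi> y - br \<psi> \<psi>' y) \<psi>'' x + pairing E (nab \<psi>'' \<psi>) \<psi>' x)"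

definition torsion_free ::
  "('m, 'e::real_inner, 'v::real_vector, 'f::real_inner) anchored_bundle \<Rightarrow>
   ('m, 'v) section_op \<Rightarrow> ('m, 'v) section_op \<Rightarrow> bool" where
  "torsion_free E br nab \<longleftrightarrow> (\<forall>\<psi>\<in>sections E. \<forall>\<psi>'\<in>sections E. \<forall>\<psi>''\<in>sections E. \<forall>x\<in>bpoints E.
     torsion E br nab \<psi> \<psi>' \<psi>'' x = 0)"

definition riemann0 ::
  "('m, 'e, 'v::real_vector, 'f) anchored_bundle \<Rightarrow> ('m, 'v) section_op \<Rightarrow> ('m, 'v) section_op \<Rightarrow>
   ('m \<Rightarrow> 'v) \<Rightarrow> ('m \<Rightarrow> 'v) \<Rightarrow> ('m \<Rightarrow> 'v) \<Rightarrow> ('m \<Rightarrow> 'v) \<Rightarrow> 'm \<Rightarrow> real" where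
  "riemann0 E br nab \<phi>' \<phi> \<psi> \<psi>' =
     pairing E (\<lambda>y. nab \<psi> (nab \<psi>' \<phi>) y - nab \<psi>' (nab \<psi> \<phi>) y - nab (br \<psi> \<psi>') \<phi> y) \<phi>'"

definition K_section ::
  "('m, 'e::real_inner, 'v::real_vector, 'f::real_inner) anchored_bundle \<Rightarrow> ('m, 'v) section_op \<Rightarrow>
   ('m, 'v) section_op" where
  "K_section E nab \<psi> \<psi>' = (THE \<kappa>. \<kappa> \<in> sections E \<and>
     (\<forall>\<phi>\<in>sections E. \<forall>x\<in>bpoints E. pairing E \<kappa> \<phi> x = pairing E (nab \<phi> \<psi>) \<psi>' x))"

definition riemann ::
  "('m, 'e::real_inner, 'v::real_vector, 'f::real_inner) anchored_bundle \<Rightarrow>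
   ('m, 'v) section_op \<Rightarrow> ('m, 'v) section_op \<Rightarrow>
   ('m \<Rightarrow> 'v) \<Rightarrow> ('m \<Rightarrow> 'v) \<Rightarrow> ('m \<Rightarrow> 'v) \<Rightarrow> ('m \<Rightarrow> 'v) \<Rightarrow> 'm \<Rightarrow> real" where
  "riemann E br nab \<phi>' \<phi> \<psi> \<psi>' = (\<lambda>x. 1 / 2 *
     (riemann0 E br nab \<phi>' \<phi> \<psi> \<psi>' x + riemann0 E br nab \<psi>' \<psi> \<phi> \<phi>' x +
      pairing E (K_section E nab \<phi> \<phi>') (K_section E nab \<psi> \<psi>') x))"

text \<open>
  A covariant \<open>k\<close>-tensor \<open>t\<close> is given by its values on sections \<open>\<psi> 0, \<dots>, \<psi> (k - 1)\<close>. Its value at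
  the point \<open>x\<close> on vectors of the fibre is obtained by extending these to global sections; by
  tensoriality the choice of the extensions is irrelevant.
\<close>

definition tensor_at ::
  "('m, 'e::real_inner, 'v::real_vector, 'f::real_inner) anchored_bundle \<Rightarrow>
   ((nat \<Rightarrow> 'm \<Rightarrow> 'v) \<Rightarrow> 'm \<Rightarrow> real) \<Rightarrow> 'm \<Rightarrow> (nat \<Rightarrow> 'v) \<Rightarrow> real" where
  "tensor_at E t x u = t (\<lambda>i. SOME \<psi>. \<psi> \<in> sections E \<and> \<psi> x = u i) x"

definition related_tensors ::
  "nat \<Rightarrow> ('m1, 'e1::real_inner, 'v1::real_vector, 'f1::real_inner) anchored_bundle \<Rightarrow>
   ('m2, 'e2::real_inner, 'v2::real_vector, 'f2::real_inner) anchored_bundle \<Rightarrow>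
   ('m1 \<times> 'm2) set \<Rightarrow> ('m1 \<times> 'm2 \<Rightarrow> ('v1 \<times> 'v2) set) \<Rightarrow>
   ((nat \<Rightarrow> 'm1 \<Rightarrow> 'v1) \<Rightarrow> 'm1 \<Rightarrow> real) \<Rightarrow> ((nat \<Rightarrow> 'm2 \<Rightarrow> 'v2) \<Rightarrow> 'm2 \<Rightarrow> real) \<Rightarrow> bool" where
  "related_tensors k E1 E2 S R t1 t2 \<longleftrightarrow> (\<forall>(s1, s2)\<in>S. \<forall>u1 u2.
     (\<forall>i<k. (u1 i, u2 i) \<in> R (s1, s2)) \<longrightarrow> tensor_at E1 t1 s1 u1 = tensor_at E2 t2 s2 u2)"

definition riemann_tensor ::
  "('m, 'e::real_inner, 'v::real_vector, 'f::real_inner) anchored_bundle \<Rightarrow>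
   ('m, 'v) section_op \<Rightarrow> ('m, 'v) section_op \<Rightarrow> (nat \<Rightarrow> 'm \<Rightarrow> 'v) \<Rightarrow> 'm \<Rightarrow> real" where
  "riemann_tensor E br nab \<psi> = riemann E br nab (\<psi> 0) (\<psi> 1) (\<psi> 2) (\<psi> 3)"

end

(*
  Put E = E1 x (opposite E2), with product bracket and product connection. Torsion and generalized
  Riemann tensor of E are tensorial, so their values at (x, y) can be computed on pairs of pulled-back
  sections, where they are the differences of those of E1 and E2. Hence E is torsion-free,
  and it remains to see that its Riemann tensor vanishes on S on sections of the relation.
  The two curvature terms vanish because such sections are closed under bracket and connection and
  the relation is isotropic. For the third term, torsion-freeness gives
  <K(phi, phi'), K(psi, psi')> = - <X, K(psi, psi')> = - <nabla_X psi, psi'> with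
  X = nabla_phi phi' - nabla_phi' phi - [phi, phi'], again a section of the relation, so it vanishes too.
*)
theory Submission
  imports Defs
begin

section \<open>Calculus of smooth maps\<close>

text \<open>All operations act on global sections, whereas the claim concerns vectors in the fibres
  over one point of the support. Bump functions lead from one to the other; they rest on compact
  balls in the model space and on the Hausdorff property. A section of the product is in general not
  a pair of pulled-back sections, but it agrees with one at any chosen point, so pointwise
  tensoriality is enough to reach the factors. The delicate slot is the third: the bracket has its
  plain Leibniz rule on the right, and moving a function out on the left produces the gradient of
  that function. Neither curvature term absorbs this gradient; the \<open>K\<close> term does.
  \<open>K_section\<close> is a definite description, so it has a meaning only once every smooth,
  pointwise tensorial functional on sections is known to be represented by a unique section. On the
  support, \<open>R\<close> may be smaller than its orthogonal complement. Then \<open>K\<close> is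
  only known to lie in the complement, where isotropy says nothing about the pairing of two such
  sections.\<close>

lemma cont_diff_on_cong:
  assumes "open W" "\<And>x. x \<in> W \<Longrightarrow> f x = g x" "cont_diff_on n W f"
  shows "cont_diff_on n W g"
  using assms(2,3)
proof (induction n arbitrary: f g)
  case 0
  then show ?case by (simp cong: continuous_on_cong)
next
  case (Suc n)
  have d: "f differentiable (at x)" if "x \<in> W" for x
    using Suc.prems(2) that by auto
  have "g differentiable (at x)" if "x \<in> W" for x
    using d[OF that] Suc.prems(1) \<open>open W\<close> that
    by (meson differentiable_def has_derivative_transform_within_open)
  moreover have "cont_diff_on n W (\<lambda>x. frechet_derivative g (at x) v)" for v
  proof (rule Suc.IH[of "\<lambda>x. frechet_derivative f (at x) v"])
    show "frechet_derivative f (at x) v = frechet_derivative g (at x) v" if "x \<in> W" for x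
      using frechet_derivative_transform_within_open[OF d[OF that] \<open>open W\<close> that Suc.prems(1)]
      by simp
  qed (use Suc.prems(2) in auto)
  ultimately show ?case by simp
qed

lemma cont_diff_on_local:
  assumes "\<And>x. x \<in> W \<Longrightarrow> \<exists>V. open V \<and> x \<in> V \<and> cont_diff_on n V f"
  shows "cont_diff_on n W f"
  using assms
proof (induction n arbitrary: f)
  case 0
  have "isCont f x" if "x \<in> W" for x
    using 0[OF that] by (auto simp: continuous_on_eq_continuous_at)
  then show ?case by (simp add: continuous_at_imp_continuous_on)
next
  case (Suc n)
  have "f differentiable (at x)" if "x \<in> W" for x
    using Suc.prems[OF that] by auto
  moreover have "cont_diff_on n W (\<lambda>x. frechet_derivative f (at x) v)" for v
    by (rule Suc.IH) (use Suc.prems in fastforce)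
  ultimately show ?case by simp
qed

lemma cont_diff_on_subset:
  assumes "cont_diff_on n W f" "V \<subseteq> W"
  shows "cont_diff_on n V f"
  using assms by (induction n arbitrary: f) (auto intro: continuous_on_subset)

lemma cont_diff_on_SucD:
  assumes "cont_diff_on (Suc n) W f"
  shows "cont_diff_on n W f"
  using assms
proof (induction n arbitrary: f)
  case 0
  then show ?case
    by (auto intro!: continuous_at_imp_continuous_on differentiable_imp_continuous_within)
qed auto

text \<open>The closure rules below are inductions on the order, and this step lets them use an
  explicit derivative \<open>f'\<close> in place of \<open>frechet_derivative\<close>. Openness of
  \<open>W\<close> makes the two, which agree on \<open>W\<close>, differentiate alike.\<close>

lemma cont_diff_on_SucI:
  assumes "open W" "\<And>x. x \<in> W \<Longrightarrow> (f has_derivative f' x) (at x)"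
    "\<And>v. cont_diff_on n W (\<lambda>x. f' x v)"
  shows "cont_diff_on (Suc n) W f"
proof -
  have "cont_diff_on n W (\<lambda>x. frechet_derivative f (at x) v)" for v
    by (rule cont_diff_on_cong[OF \<open>open W\<close> _ assms(3)[of v]])
      (use frechet_derivative_at[OF assms(2)] in simp)
  then show ?thesis using assms(2) by (auto simp: differentiable_def)
qed

lemma cont_diff_on_has_derivative:
  assumes "cont_diff_on (Suc n) W f" "x \<in> W"
  shows "(f has_derivative frechet_derivative f (at x)) (at x)"
  using assms by (simp add: frechet_derivative_works)

lemma cont_diff_on_const: "open W \<Longrightarrow> cont_diff_on n W (\<lambda>x. c)"
proof (induction n arbitrary: c)
  case (Suc n)
  show ?case by (rule cont_diff_on_SucI[where f'="\<lambda>x v. 0"]) (use Suc in auto)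
qed simp

lemma cont_diff_on_add:
  assumes "open W" "cont_diff_on n W f" "cont_diff_on n W g"
  shows "cont_diff_on n W (\<lambda>x. f x + g x)"
  using assms(2,3)
proof (induction n arbitrary: f g)
  case (Suc n)
  show ?case
    by (rule cont_diff_on_SucI[OF \<open>open W\<close> has_derivative_add])
      (use Suc in \<open>auto intro: cont_diff_on_has_derivative\<close>)
qed (simp add: continuous_on_add)

lemma cont_diff_on_linear:
  assumes "open W" "bounded_linear L" "cont_diff_on n W f"
  shows "cont_diff_on n W (\<lambda>x. L (f x))"
  using assms(3)
proof (induction n arbitrary: f)
  case 0
  then show ?case using assms(2) by (auto intro: bounded_linear.continuous_on)
next
  case (Suc n)
  show ?case
    by (rule cont_diff_on_SucI[OF \<open>open W\<close> bounded_linear.has_derivative[OF assms(2)]])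
      (use Suc in \<open>auto intro: cont_diff_on_has_derivative\<close>)
qed

lemma cont_diff_on_precompose_linear:
  assumes "open V" "bounded_linear L" "\<And>x. x \<in> V \<Longrightarrow> L x \<in> W" "cont_diff_on n W f"
  shows "cont_diff_on n V (\<lambda>x. f (L x))"
  using assms(4)
proof (induction n arbitrary: f)
  case 0
  show ?case
    using continuous_on_compose2[of W f V L] linear_continuous_on[OF assms(2)] assms(3) 0
    by (auto simp: image_subset_iff)
next
  case (Suc n)
  have "((\<lambda>x. f (L x)) has_derivative (\<lambda>v. frechet_derivative f (at (L x)) (L v))) (at x)"
    if "x \<in> V" for x
    using has_derivative_compose[OF bounded_linear_imp_has_derivative[OF assms(2)]
        cont_diff_on_has_derivative[OF Suc.prems assms(3)[OF that]]] .
  then show ?case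
    by (rule cont_diff_on_SucI[OF \<open>open V\<close>]) (use Suc in auto)
qed

lemma cont_diff_on_bilinear:
  assumes "open W" "bounded_bilinear p" "cont_diff_on n W f" "cont_diff_on n W g"
  shows "cont_diff_on n W (\<lambda>x. p (f x) (g x))"
  using assms(3,4)
proof (induction n arbitrary: f g)
  case 0
  then show ?case by (auto intro: bounded_bilinear.continuous_on[OF assms(2)])
next
  case (Suc n)
  show ?case
  proof (rule cont_diff_on_SucI[OF \<open>open W\<close> bounded_bilinear.FDERIV[OF assms(2)]])
    show "cont_diff_on n W (\<lambda>x. p (f x) (frechet_derivative g (at x) v) +
        p (frechet_derivative f (at x) v) (g x))" for v
      by (rule cont_diff_on_add[OF \<open>open W\<close>])
        (use Suc.prems in \<open>auto intro!: Suc.IH intro: cont_diff_on_SucD[OF Suc.prems(1)]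
          cont_diff_on_SucD[OF Suc.prems(2)]\<close>)
  qed (use Suc.prems in \<open>auto intro: cont_diff_on_has_derivative\<close>)
qed

text \<open>The derivative \<open>- f' / f^2\<close> is built from \<open>1 / f\<close> itself,
  which the induction hypothesis covers at the lower order.\<close>

lemma cont_diff_on_inverse:
  fixes f :: "'a::real_normed_vector \<Rightarrow> real"
  assumes "open W" "\<And>x. x \<in> W \<Longrightarrow> f x \<noteq> 0" "cont_diff_on n W f"
  shows "cont_diff_on n W (\<lambda>x. inverse (f x))"
  using assms(3)
proof (induction n)
  case 0
  then show ?case using assms(2) by (simp add: continuous_on_inverse)
next
  case (Suc n)
  note i = Suc.IH[OF cont_diff_on_SucD[OF Suc.prems]]
  note m = cont_diff_on_bilinear[OF \<open>open W\<close> bounded_bilinear_mult]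
  show ?case
  proof (rule cont_diff_on_SucI[OF \<open>open W\<close> Deriv.has_derivative_inverse])
    show "cont_diff_on n W (\<lambda>x. - (inverse (f x) * frechet_derivative f (at x) v * inverse (f x)))"
      for v
      by (rule cont_diff_on_linear[OF \<open>open W\<close> bounded_linear_minus[OF bounded_linear_ident]],
          rule m[OF m[OF i] i]) (use Suc.prems in auto)
  qed (use Suc.prems assms(2) in \<open>auto intro: cont_diff_on_has_derivative\<close>)
qed

text \<open>For an outer function of one real variable the derivative is multiplication by the
  single scalar function \<open>g'\<close>, so the induction can be applied to \<open>g'\<close> in
  place of \<open>g\<close>. Cut-offs are composites of this kind.\<close>

lemma cont_diff_on_real_compose:
  fixes f :: "'a::real_normed_vector \<Rightarrow> real" and g :: "real \<Rightarrow> real"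
  assumes "open W" "cont_diff_on n W f" "cont_diff_on n UNIV g"
  shows "cont_diff_on n W (\<lambda>x. g (f x))"
  using assms(2,3)
proof (induction n arbitrary: g)
  case 0
  then show ?case by (auto intro!: continuous_on_compose2[of UNIV g W f])
next
  case (Suc n)
  have eq: "frechet_derivative g (at t) s = s *\<^sub>R frechet_derivative g (at t) 1" for s t
    using linear_frechet_derivative[of g "at t"] Suc.prems(2) linear_scale
    by (metis UNIV_I cont_diff_on.simps(2) mult.right_neutral real_scaleR_def)
  have "((\<lambda>x. g (f x)) has_derivative
      (\<lambda>v. frechet_derivative f (at x) v *\<^sub>R frechet_derivative g (at (f x)) 1)) (at x)"
    if "x \<in> W" for x
    using has_derivative_compose[OF cont_diff_on_has_derivative[OF Suc.prems(1) that]
        cont_diff_on_has_derivative[OF Suc.prems(2) UNIV_I]]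
    by (subst eq[symmetric])
  moreover have "cont_diff_on n W
      (\<lambda>x. frechet_derivative f (at x) v *\<^sub>R frechet_derivative g (at (f x)) 1)" for v
    by (rule cont_diff_on_bilinear[OF \<open>open W\<close> bounded_bilinear_scaleR])
      (use Suc in \<open>auto intro!: Suc.IH[of "\<lambda>t. frechet_derivative g (at t) 1"]
        intro: cont_diff_on_SucD[OF Suc.prems(1)]\<close>)
  ultimately show ?case
    by (rule cont_diff_on_SucI[OF \<open>open W\<close>])
qed

lemma smooth_on_cong:
  assumes "open W" "\<And>x. x \<in> W \<Longrightarrow> f x = g x" "smooth_on W f"
  shows "smooth_on W g"
  using assms(3) cont_diff_on_cong[OF assms(1,2)] by (auto simp: smooth_on_def)

lemma smooth_on_local:
  assumes "\<And>x. x \<in> W \<Longrightarrow> \<exists>V. open V \<and> x \<in> V \<and> smooth_on V f"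
  shows "smooth_on W f"
  unfolding smooth_on_def
  by (intro allI cont_diff_on_local) (use assms in \<open>unfold smooth_on_def, blast\<close>)

lemma smooth_on_subset: "smooth_on W f \<Longrightarrow> V \<subseteq> W \<Longrightarrow> smooth_on V f"
  unfolding smooth_on_def using cont_diff_on_subset[of _ W f V] by simp

lemma smooth_on_const: "open W \<Longrightarrow> smooth_on W (\<lambda>x. c)"
  by (simp add: smooth_on_def cont_diff_on_const)

lemma smooth_on_add:
  assumes "open W" "smooth_on W f" "smooth_on W g"
  shows "smooth_on W (\<lambda>x. f x + g x)"
  using assms(2,3) cont_diff_on_add[OF assms(1), of _ f g] by (auto simp: smooth_on_def)

lemma smooth_on_linear:
  assumes "open W" "bounded_linear L" "smooth_on W f"
  shows "smooth_on W (\<lambda>x. L (f x))"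
  using assms(3) cont_diff_on_linear[OF assms(1,2), of _ f] by (auto simp: smooth_on_def)

lemma smooth_on_precompose_linear:
  assumes "open V" "bounded_linear L" "\<And>x. x \<in> V \<Longrightarrow> L x \<in> W" "smooth_on W f"
  shows "smooth_on V (\<lambda>x. f (L x))"
  using assms(4) cont_diff_on_precompose_linear[OF assms(1,2,3), of _ f]
  by (auto simp: smooth_on_def)

lemma smooth_on_bilinear:
  assumes "open W" "bounded_bilinear p" "smooth_on W f" "smooth_on W g"
  shows "smooth_on W (\<lambda>x. p (f x) (g x))"
  using assms(3,4) cont_diff_on_bilinear[OF assms(1,2), of _ f g] by (auto simp: smooth_on_def)

lemma smooth_on_inverse:
  fixes f :: "'a::real_normed_vector \<Rightarrow> real"
  shows "open W \<Longrightarrow> (\<And>x. x \<in> W \<Longrightarrow> f x \<noteq> 0) \<Longrightarrow> smooth_on W f \<Longrightarrow> smooth_on W (\<lambda>x. inverse (f x))"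
  by (simp add: smooth_on_def cont_diff_on_inverse)

lemma smooth_on_real_compose:
  fixes f :: "'a::real_normed_vector \<Rightarrow> real" and g :: "real \<Rightarrow> real"
  shows "open W \<Longrightarrow> smooth_on W f \<Longrightarrow> smooth_on UNIV g \<Longrightarrow> smooth_on W (\<lambda>x. g (f x))"
  by (simp add: smooth_on_def cont_diff_on_real_compose)

lemma smooth_on_Pair:
  assumes "open W" "smooth_on W f" "smooth_on W g"
  shows "smooth_on W (\<lambda>x. (f x, g x))"
proof -
  have "smooth_on W (\<lambda>x. (f x, 0) + (0, g x))"
    by (intro smooth_on_add smooth_on_linear[OF _ bounded_linear_Pair] assms
        bounded_linear_ident bounded_linear_zero)
  then show ?thesis by simp
qed

section \<open>A smooth step function from exp(-1/t)\<close>

definition flat :: "nat \<Rightarrow> real \<Rightarrow> real" where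
  "flat k t = (if t > 0 then inverse t ^ k * exp (- inverse t) else 0)"

lemma flat_tendsto_0: "(flat k \<longlongrightarrow> 0) (at 0)"
proof -
  have "((\<lambda>t. inverse t ^ k / exp (inverse t)) \<longlongrightarrow> 0) (at_right (0::real))"
    using filterlim_compose[OF tendsto_power_div_exp_0 filterlim_inverse_at_top_right] .
  then have "(flat k \<longlongrightarrow> 0) (at_right 0)"
    by (rule Lim_transform_eventually)
      (auto simp: flat_def exp_minus field_simps eventually_at_right_less
        intro!: eventually_mono[OF eventually_at_right_less])
  moreover have "(flat k \<longlongrightarrow> 0) (at_left 0)"
    by (rule Lim_transform_eventually[OF tendsto_const])
      (auto simp: flat_def eventually_at_filter)
  ultimately show ?thesis by (simp add: filterlim_split_at)
qed

text \<open>Unlike exp(-1/t) alone, the family over all \<open>k\<close> is closed under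
  differentiation up to linear combinations, so an induction on the order that keeps
  \<open>k\<close> general gives smoothness.\<close>

lemma flat_has_derivative:
  "(flat k has_real_derivative flat (k + 2) t - real k * flat (k + 1) t) (at t)"
proof (cases t "0::real" rule: linorder_cases)
  case less
  have "((\<lambda>t. 0) has_real_derivative 0) (at t)" by simp
  then have "(flat k has_real_derivative 0) (at t)"
    by (rule has_field_derivative_transform_within_open[where S="{..<0}"])
      (use less in \<open>auto simp: flat_def\<close>)
  then show ?thesis using less by (simp add: flat_def)
next
  case equal
  \<comment> \<open>The difference quotient at 0 is again a member of the family, so the limit
    already known gives the derivative.\<close>
  have "(\<lambda>h. flat k h / h) = flat (k + 1)"
    by (rule ext) (simp add: flat_def divide_inverse)
  then have "((\<lambda>h. flat k h / h) \<longlongrightarrow> 0) (at 0)"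
    using flat_tendsto_0[of "k + 1"] by simp
  moreover have "flat k 0 = 0" by (simp add: flat_def)
  ultimately have "(flat k has_real_derivative 0) (at 0)" by (simp add: DERIV_def)
  then show ?thesis using equal by (simp add: flat_def)
next
  case greater
  \<comment> \<open>\<open>DERIV_power\<close> leaves the exponent \<open>k - Suc 0\<close>; for
    \<open>k = 0\<close> the truncated subtraction is harmless because of the factor
    \<open>real k\<close>.\<close>
  have eq: "real k * (- (inverse t ^ 2) * inverse t ^ (k - Suc 0)) = - (real k * inverse t ^ (k + 1))"
    by (cases k) (simp_all add: power2_eq_square)
  have i: "(inverse has_real_derivative - (inverse t ^ 2)) (at t)"
    using DERIV_inverse[of t] greater by (simp add: power2_eq_square)
  note DERIV_mult[OF DERIV_power[OF i, of k] DERIV_chain2[OF DERIV_exp DERIV_minus[OF i]]]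
  also have "real k * (- (inverse t ^ 2) * inverse t ^ (k - Suc 0)) * exp (- inverse t) +
      exp (- inverse t) * - (- (inverse t ^ 2)) * inverse t ^ k =
      flat (k + 2) t - real k * flat (k + 1) t"
    unfolding eq using greater by (simp add: flat_def power_add power2_eq_square mult_ac)
  finally have "((\<lambda>t. inverse t ^ k * exp (- inverse t)) has_real_derivative
      flat (k + 2) t - real k * flat (k + 1) t) (at t)" .
  moreover have "inverse x ^ k * exp (- inverse x) = flat k x" if "x \<in> {0<..}" for x
    using that by (simp add: flat_def)
  ultimately show ?thesis
    using has_field_derivative_transform_within_open[OF _ open_greaterThan, of _ _ t 0 "flat k"] greater
    by blast
qed

lemma smooth_on_flat: "smooth_on UNIV (flat k)"
proof -
  have "cont_diff_on n UNIV (flat k)" for n k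
  proof (induction n arbitrary: k)
    case 0
    show ?case
      using DERIV_isCont[OF flat_has_derivative] by (simp add: continuous_at_imp_continuous_on)
  next
    case (Suc n)
    show ?case
    proof (rule cont_diff_on_SucI[OF open_UNIV])
      show "(flat k has_derivative (\<lambda>v. (flat (k + 2) t + (- real k) * flat (k + 1) t) * v)) (at t)" for t
        using flat_has_derivative[of k t] by (simp add: has_field_derivative_def)
      show "cont_diff_on n UNIV (\<lambda>t. (flat (k + 2) t + (- real k) * flat (k + 1) t) * v)" for v
        by (intro cont_diff_on_bilinear[OF open_UNIV bounded_bilinear_mult] cont_diff_on_add
            cont_diff_on_const Suc.IH open_UNIV)
    qed
  qed
  then show ?thesis by (simp add: smooth_on_def)
qed

lemma smooth_step_exists:
  obtains H :: "real \<Rightarrow> real"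
  where "smooth_on UNIV H" "\<And>t. t \<le> 0 \<Longrightarrow> H t = 0" "\<And>t. t \<ge> 1 \<Longrightarrow> H t = 1"
proof
  \<comment> \<open>The quotient \<open>flat 0 t / (flat 0 t + flat 0 (1 - t))\<close>: its
    denominator is positive since \<open>t\<close> or \<open>1 - t\<close> is. The spelling with
    sums and products fits the closure rules.\<close>
  let ?H = "\<lambda>t. flat 0 t * inverse (flat 0 t + flat 0 (1 + (- 1) * t))"
  have pos: "flat 0 t + flat 0 (1 + (- 1) * t) \<noteq> 0" for t
  proof -
    have "flat 0 s \<ge> 0" "s > 0 \<Longrightarrow> flat 0 s > 0" for s
      by (simp_all add: flat_def)
    then show ?thesis
      by (smt (verit) mult_minus1)
  qed
  have id: "smooth_on UNIV (\<lambda>t::real. t)"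
    unfolding smooth_on_def
  proof
    show "cont_diff_on n UNIV (\<lambda>t::real. t)" for n
    proof (cases n)
      case (Suc m)
      show ?thesis unfolding Suc
        by (rule cont_diff_on_SucI[where f'="\<lambda>x v. v"]) (auto intro: cont_diff_on_const)
    qed simp
  qed
  have "smooth_on UNIV (\<lambda>t::real. 1 + (- 1) * t)"
    by (intro smooth_on_add smooth_on_bilinear[OF _ bounded_bilinear_mult] smooth_on_const id open_UNIV)
  from smooth_on_real_compose[OF open_UNIV this smooth_on_flat[of 0]]
  have "smooth_on UNIV (\<lambda>t. inverse (flat 0 t + flat 0 (1 + (- 1) * t)))"
    by (intro smooth_on_inverse smooth_on_add smooth_on_flat open_UNIV pos)
  then show "smooth_on UNIV ?H"
    by (intro smooth_on_bilinear[OF _ bounded_bilinear_mult] smooth_on_flat open_UNIV)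
  show "?H t = 0" if "t \<le> 0" for t using that by (simp add: flat_def)
  show "?H t = 1" if "t \<ge> 1" for t
  proof -
    have "flat 0 (1 + (- 1) * t) = 0" using that by (simp add: flat_def)
    then show ?thesis using pos[of t] by simp
  qed
qed

section \<open>Smooth functions on manifolds\<close>

lemma finite_dimensional_orthogonal_basis:
  assumes "finite_dimensional TYPE('e::real_inner)"
  obtains C :: "'e::real_inner set" where "finite C" "\<And>x. (\<Sum>c\<in>C. (inner x c / inner c c) *\<^sub>R c) = x"
proof -
  obtain B :: "'e set" where "finite B" "span B = UNIV"
    using assms by (auto simp: finite_dimensional_def)
  then obtain C where C: "finite C" "span C = (UNIV :: 'e set)" "pairwise orthogonal C"
    using basis_orthogonal[of B] by metis
  have "(\<Sum>c\<in>C. (inner x c / inner c c) *\<^sub>R c) = x" for x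
  proof -
    have "x \<in> span C" using C by simp
    then show ?thesis
    proof (induction rule: span_induct)
      case base
      have "(\<Sum>c\<in>C. (a * inner x c / inner c c) *\<^sub>R c) =
          a *\<^sub>R (\<Sum>c\<in>C. (inner x c / inner c c) *\<^sub>R c)" for a x
        by (simp add: scaleR_sum_right)
      then show ?case
        by (simp add: subspace_def inner_add_left add_divide_distrib scaleR_add_left sum.distrib)
    next
      case (step x)
      \<comment> \<open>This also covers a zero vector in \<open>C\<close>: its term is a multiple
        of 0.\<close>
      have "(inner x c / inner c c) *\<^sub>R c = (if c = x then x else 0)" if "c \<in> C" for c
        using C(3) step that by (auto simp: pairwise_def orthogonal_def)
      then have "(\<Sum>c\<in>C. (inner x c / inner c c) *\<^sub>R c) = (\<Sum>c\<in>C. if c = x then x else 0)"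
        by (intro sum.cong) auto
      then show ?case using C(1) step by simp
    qed
  qed
  then show ?thesis using that C(1) by blast
qed

text \<open>Each further vector adds a compact segment, and the sum of two compact sets is
  compact.\<close>

lemma compact_bounded_combinations:
  fixes C :: "'e::real_normed_vector set"
  assumes "finite C"
  shows "\<exists>K. compact K \<and> (\<forall>f. (\<forall>c\<in>C. \<bar>f c\<bar> \<le> \<rho> c) \<longrightarrow> (\<Sum>c\<in>C. f c *\<^sub>R c) \<in> K)"
  using assms
proof (induction C)
  case empty
  show ?case by (rule exI[of _ "{0}"]) simp
next
  case (insert d C)
  then obtain K where K: "compact K" "\<And>f. (\<forall>c\<in>C. \<bar>f c\<bar> \<le> \<rho> c) \<Longrightarrow> (\<Sum>c\<in>C. f c *\<^sub>R c) \<in> K"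
    by blast
  have I: "compact ((\<lambda>t. t *\<^sub>R d) ` {- \<rho> d..\<rho> d})"
    by (intro compact_continuous_image continuous_intros) simp
  have "(\<Sum>c\<in>insert d C. f c *\<^sub>R c) \<in> {x + y |x y. x \<in> (\<lambda>t. t *\<^sub>R d) ` {- \<rho> d..\<rho> d} \<and> y \<in> K}"
    if f: "\<forall>c\<in>insert d C. \<bar>f c\<bar> \<le> \<rho> c" for f
  proof -
    have "f d *\<^sub>R d \<in> (\<lambda>t. t *\<^sub>R d) ` {- \<rho> d..\<rho> d}"
      using f by (auto simp: abs_le_iff intro!: imageI)
    then show ?thesis
      using insert.hyps K(2)[of f] f by auto
  qed
  then show ?case
    using compact_sums[OF I K(1)] by blast
qed

text \<open>By Cauchy-Schwarz the coefficients of a vector of the centred ball are bounded by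
  \<open>r / norm c\<close>. So that ball is a closed subset of a compact set, and translation does
  the rest.\<close>

lemma finite_dimensional_compact_cball:
  assumes "finite_dimensional TYPE('e::real_inner)"
  shows "compact (cball (a::'e::real_inner) r)"
proof -
  obtain C :: "'e set" where C: "finite C" "\<And>x. (\<Sum>c\<in>C. (inner x c / inner c c) *\<^sub>R c) = x"
    using finite_dimensional_orthogonal_basis[OF assms] by blast
  obtain K where K: "compact K"
    "\<And>f. (\<forall>c\<in>C. \<bar>f c\<bar> \<le> r / norm c) \<Longrightarrow> (\<Sum>c\<in>C. f c *\<^sub>R c) \<in> K"
    using compact_bounded_combinations[OF C(1), of "\<lambda>c. r / norm c"] by blast
  have "cball 0 r \<subseteq> K"
  proof
    fix x :: 'e assume x: "x \<in> cball 0 r"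
    have "\<bar>inner x c / inner c c\<bar> \<le> r / norm c" for c
    proof (cases "c = 0")
      case False
      have "\<bar>inner x c\<bar> \<le> r * norm c"
        using Cauchy_Schwarz_ineq2[of x c] mult_right_mono[of "norm x" r "norm c"] x by simp
      then show ?thesis
        using False by (simp add: abs_divide divide_simps dot_square_norm power2_eq_square)
    qed simp
    then show "x \<in> K" using K(2)[of "\<lambda>c. inner x c / inner c c"] C(2)[of x] by simp
  qed
  then have "cball 0 r = K \<inter> cball 0 r" by blast
  then have "compact (cball (0::'e) r)" using compact_Int_closed[OF K(1) closed_cball] by metis
  then have "compact ((+) a ` cball 0 r)"
    by (intro compact_continuous_image continuous_intros)
  then show ?thesis by simp
qed

section \<open>Charts and smooth maps on open subsets\<close>

lemma chart_open_image:
  assumes "is_chart X (U, \<phi>)" "openin X A"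
  shows "open (\<phi> ` (U \<inter> A))"
proof -
  have "openin (subtopology X U) (U \<inter> A)"
    using assms(2) by (auto simp: openin_subtopology)
  then have "openin (top_of_set (\<phi> ` U)) (\<phi> ` (U \<inter> A))"
    using homeomorphic_imp_open_map assms(1) by (auto simp: is_chart_def open_map_def)
  then show ?thesis
    using assms(1) openin_open_trans by (auto simp: is_chart_def)
qed

lemma chart_preimage_open:
  assumes "is_chart X (U, \<phi>)" "open B"
  shows "openin X {y \<in> U. \<phi> y \<in> B}"
proof -
  have U: "openin X U" "topspace (subtopology X U) = U"
    using assms(1) openin_subset by (auto simp: is_chart_def)
  have "continuous_map (subtopology X U) euclidean \<phi>"
    using assms(1) homeomorphic_imp_continuous_map
    by (fastforce simp: is_chart_def continuous_map_in_subtopology)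
  then have "openin (subtopology X U) {y \<in> U. \<phi> y \<in> B}"
    using openin_continuous_map_preimage[of "subtopology X U" euclidean \<phi> B] assms(2)
    unfolding U(2) by simp
  then show ?thesis using U(1) openin_trans_full by blast
qed

lemma chart_inj: "is_chart X (U, \<phi>) \<Longrightarrow> inj_on \<phi> U"
  using homeomorphic_imp_injective_map[of "subtopology X U" "top_of_set (\<phi> ` U)" \<phi>] openin_subset[of X U]
  by (auto simp: is_chart_def inf.absorb2)

lemma manifold_chart:
  assumes "smooth_manifold M" "x \<in> points M"
  obtains U \<phi> where "(U, \<phi>) \<in> atlas M" "x \<in> U"
  using assms unfolding smooth_manifold_def by (metis UN_E prod.collapse)

lemma atlas_chart: "smooth_manifold M \<Longrightarrow> (U, \<phi>) \<in> atlas M \<Longrightarrow> is_chart (mtop M) (U, \<phi>)"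
  by (auto simp: smooth_manifold_def)

lemma smooth_map_onD:
  "smooth_map_on M A f \<Longrightarrow> (U, \<phi>) \<in> atlas M \<Longrightarrow> smooth_on (\<phi> ` (U \<inter> A)) (\<lambda>z. f (inv_into U \<phi> z))"
  by (auto simp: smooth_map_on_def comp_def)

lemma smooth_map_onI:
  "(\<And>U \<phi>. (U, \<phi>) \<in> atlas M \<Longrightarrow> smooth_on (\<phi> ` (U \<inter> A)) (\<lambda>z. f (inv_into U \<phi> z))) \<Longrightarrow> smooth_map_on M A f"
  by (auto simp: smooth_map_on_def comp_def)

lemma smooth_map_on_subset: "smooth_map_on M A f \<Longrightarrow> B \<subseteq> A \<Longrightarrow> smooth_map_on M B f"
  by (rule smooth_map_onI, rule smooth_on_subset, rule smooth_map_onD) auto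

lemma smooth_map_on_cong:
  assumes "smooth_manifold M" "openin (mtop M) A" "\<And>x. x \<in> A \<Longrightarrow> f x = g x" "smooth_map_on M A f"
  shows "smooth_map_on M A g"
proof (rule smooth_map_onI)
  fix U \<phi> assume c: "(U, \<phi>) \<in> atlas M"
  note ch = atlas_chart[OF assms(1) c]
  show "smooth_on (\<phi> ` (U \<inter> A)) (\<lambda>z. g (inv_into U \<phi> z))"
    by (rule smooth_on_cong[OF chart_open_image[OF ch assms(2)] _ smooth_map_onD[OF assms(4) c]])
      (use chart_inj[OF ch] in \<open>auto intro!: assms(3)\<close>)
qed

lemma smooth_map_on_local:
  assumes "smooth_manifold M"
    "\<And>x. x \<in> A \<Longrightarrow> \<exists>B. openin (mtop M) B \<and> x \<in> B \<and> smooth_map_on M B f"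
  shows "smooth_map_on M A f"
proof (rule smooth_map_onI, rule smooth_on_local)
  fix U \<phi> z assume c: "(U, \<phi>) \<in> atlas M" and "z \<in> \<phi> ` (U \<inter> A)"
  then obtain x where x: "x \<in> U" "x \<in> A" "z = \<phi> x" by blast
  obtain B where B: "openin (mtop M) B" "x \<in> B" "smooth_map_on M B f"
    using assms(2)[OF x(2)] by blast
  show "\<exists>V. open V \<and> z \<in> V \<and> smooth_on V (\<lambda>z. f (inv_into U \<phi> z))"
    using chart_open_image[OF atlas_chart[OF assms(1) c] B(1)] smooth_map_onD[OF B(3) c] x B(2)
    by blast
qed

context
  fixes M :: "('m, 'e::real_inner) manifold" and A :: "'m set"
  assumes M: "smooth_manifold M" and A: "openin (mtop M) A"
begin

lemma smooth_map_on_const: "smooth_map_on M A (\<lambda>x. c)"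
  by (rule smooth_map_onI)
    (auto intro!: smooth_on_const chart_open_image[OF atlas_chart[OF M] A])

lemma smooth_map_on_add:
  assumes "smooth_map_on M A f" "smooth_map_on M A g"
  shows "smooth_map_on M A (\<lambda>x. f x + g x)"
  by (rule smooth_map_onI, rule smooth_on_add)
    (auto intro!: chart_open_image[OF atlas_chart[OF M] A] smooth_map_onD assms)

lemma smooth_map_on_linear:
  assumes "bounded_linear L" "smooth_map_on M A f"
  shows "smooth_map_on M A (\<lambda>x. L (f x))"
  by (rule smooth_map_onI, rule smooth_on_linear[OF _ assms(1)])
    (auto intro!: chart_open_image[OF atlas_chart[OF M] A] smooth_map_onD assms)

lemma smooth_map_on_bilinear:
  assumes "bounded_bilinear p" "smooth_map_on M A f" "smooth_map_on M A g"
  shows "smooth_map_on M A (\<lambda>x. p (f x) (g x))"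
  by (rule smooth_map_onI, rule smooth_on_bilinear[OF _ assms(1)])
    (auto intro!: chart_open_image[OF atlas_chart[OF M] A] smooth_map_onD assms)

lemma smooth_map_on_inverse:
  fixes f :: "'m \<Rightarrow> real"
  assumes "smooth_map_on M A f" "\<And>x. x \<in> A \<Longrightarrow> f x \<noteq> 0"
  shows "smooth_map_on M A (\<lambda>x. inverse (f x))"
proof (rule smooth_map_onI, rule smooth_on_inverse)
  fix U \<phi> z assume c: "(U, \<phi>) \<in> atlas M" and "z \<in> \<phi> ` (U \<inter> A)"
  then show "f (inv_into U \<phi> z) \<noteq> 0"
    using chart_inj[OF atlas_chart[OF M c]] assms(2) by auto
qed (auto intro!: chart_open_image[OF atlas_chart[OF M] A] smooth_map_onD assms)

end

section \<open>Bump functions, cut-offs and local inverses\<close>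

lemma plateau_exists:
  assumes M: "smooth_manifold M" and W: "openin (mtop M) W" and x: "x \<in> W"
  obtains \<beta> N C where "\<beta> \<in> smooth_functions M" "openin (mtop M) N" "closedin (mtop M) C"
    "x \<in> N" "N \<subseteq> C" "C \<subseteq> W" "\<And>y. y \<in> N \<Longrightarrow> \<beta> y = 1" "\<And>y. y \<notin> C \<Longrightarrow> \<beta> y = 0"
proof -
  obtain U \<phi> where c: "(U, \<phi>) \<in> atlas M" and xU: "x \<in> U"
    using manifold_chart[OF M] openin_subset[OF W] x by blast
  note ch = atlas_chart[OF M c]
  have Uop: "openin (mtop M) U" using ch by (simp add: is_chart_def)
  obtain r where r: "r > 0" "cball (\<phi> x) r \<subseteq> \<phi> ` (U \<inter> W)"
    using chart_open_image[OF ch W] xU x open_contains_cball by (metis IntI imageI)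
  define C where "C = {y \<in> U. \<phi> y \<in> cball (\<phi> x) r}"
  define N where "N = {y \<in> U. \<phi> y \<in> ball (\<phi> x) (r / 2)}"
  obtain H :: "real \<Rightarrow> real" where H: "smooth_on UNIV H" "\<And>t. t \<le> 0 \<Longrightarrow> H t = 0" "\<And>t. t \<ge> 1 \<Longrightarrow> H t = 1"
    using smooth_step_exists by blast
  \<comment> \<open>In terms of \<open>d = dist (\<phi> x) (\<phi> y)\<close> this is
    \<open>2 - 2 * (d / r)^2\<close>, which is at least 1 for \<open>d \<le> r / 2\<close> and at
    most 0 for \<open>d \<ge> r\<close>. The squared norm is written as an inner product because
    that is smooth everywhere.\<close>
  define q where "q y = 2 + (- 2 / r\<^sup>2) * inner (\<phi> y + - \<phi> x) (\<phi> y + - \<phi> x)" for y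
  define \<beta> where "\<beta> y = (if y \<in> U then H (q y) else 0)" for y
  have q: "q y = 2 - 2 * (dist (\<phi> x) (\<phi> y) / r)\<^sup>2" for y
    by (simp add: q_def dist_norm norm_minus_commute dot_square_norm power_divide)
  have CW: "C \<subseteq> W"
    using r(2) chart_inj[OF ch] by (auto simp: C_def dest: inj_onD)
  have "\<phi> ` C = cball (\<phi> x) r" using r(2) by (auto simp: C_def)
  then have "compactin (top_of_set (\<phi> ` U)) (\<phi> ` C)"
    using finite_dimensional_compact_cball[of "\<phi> x" r] M r(2)
    by (auto simp: smooth_manifold_def compactin_subtopology)
  moreover have "C \<subseteq> topspace (subtopology (mtop M) U)"
    using openin_subset[OF Uop] by (auto simp: C_def)
  ultimately have "compactin (subtopology (mtop M) U) C"
    using ch homeomorphic_map_compactness_eq by (fastforce simp: is_chart_def)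
  \<comment> \<open>The Hausdorff property enters here: \<open>C\<close> is compact, being a closed
    ball seen through the chart, hence closed in the whole manifold and not merely in
    \<open>U\<close>. Only then is the complement of \<open>C\<close> open and the extension by zero
    smooth.\<close>
  then have Cclosed: "closedin (mtop M) C"
    using M compactin_imp_closedin by (auto simp: smooth_manifold_def compactin_subtopology)
  have Nopen: "openin (mtop M) N"
    unfolding N_def by (rule chart_preimage_open[OF ch]) simp
  have "\<beta> y = 1" if "y \<in> N" for y
  proof -
    have "dist (\<phi> x) (\<phi> y) / r \<le> 1 / 2" using that r(1) by (simp add: N_def divide_simps)
    then have "(dist (\<phi> x) (\<phi> y) / r)\<^sup>2 \<le> (1 / 2)\<^sup>2" using r(1) by (intro power_mono) auto
    also have "\<dots> \<le> 1 / 2" by (simp add: power2_eq_square)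
    finally have "q y \<ge> 1" by (simp only: q)
    then show ?thesis using that H(3) by (simp add: \<beta>_def N_def)
  qed
  moreover have \<beta>0: "\<beta> y = 0" if "y \<notin> C" for y
  proof (cases "y \<in> U")
    case True
    then have "dist (\<phi> x) (\<phi> y) / r \<ge> 1" using that r(1) by (simp add: C_def divide_simps)
    then have "(dist (\<phi> x) (\<phi> y) / r)\<^sup>2 \<ge> 1" by simp
    then show ?thesis using True H(2) by (simp add: \<beta>_def q)
  qed (simp add: \<beta>_def)
  moreover have "\<beta> \<in> smooth_functions M"
  proof -
    have "smooth_map_on M U \<beta>"
    proof (rule smooth_map_onI)
      fix V \<eta> assume d: "(V, \<eta>) \<in> atlas M"
      note dh = atlas_chart[OF M d]
      have op: "open (\<eta> ` (V \<inter> U))" by (rule chart_open_image[OF dh Uop])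
      have "compatible (U, \<phi>) (V, \<eta>)" using M c d by (auto simp: smooth_manifold_def)
      then have "smooth_on (\<eta> ` (V \<inter> U)) (\<lambda>z. \<phi> (inv_into V \<eta> z))"
        by (simp add: compatible_def comp_def Int_commute)
      then have "smooth_on (\<eta> ` (V \<inter> U)) (\<lambda>z. q (inv_into V \<eta> z))"
        unfolding q_def
        by (intro smooth_on_add op smooth_on_const smooth_on_bilinear[OF _ bounded_bilinear_mult]
            smooth_on_bilinear[OF _ bounded_bilinear_inner])
      from smooth_on_real_compose[OF op this H(1)]
      show "smooth_on (\<eta> ` (V \<inter> U)) (\<lambda>z. \<beta> (inv_into V \<eta> z))"
        by (rule smooth_on_cong[OF op, rotated]) (use chart_inj[OF dh] in \<open>auto simp: \<beta>_def\<close>)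
    qed
    moreover have "smooth_map_on M (points M - C) \<beta>"
      by (rule smooth_map_on_cong[OF M _ _ smooth_map_on_const[OF M, where c = 0]])
        (use Cclosed \<beta>0 in auto)
    ultimately have "smooth_map_on M (points M) \<beta>"
      using Cclosed Uop by (intro smooth_map_on_local[OF M]) (auto simp: C_def)
    then show ?thesis by (simp add: smooth_functions_def)
  qed
  moreover have "x \<in> N" "N \<subseteq> C" using xU r(1) by (auto simp: N_def C_def)
  ultimately show ?thesis using that Nopen Cclosed CW by blast
qed

text \<open>The product is smooth on \<open>W \<inter> A\<close> and zero off the closed set
  \<open>C\<close>, and these two regions cover \<open>A\<close>. The values of \<open>g\<close> off
  \<open>W\<close> are arbitrary.\<close>

lemma smooth_map_on_cutoff:
  assumes M: "smooth_manifold M" and "openin (mtop M) W" "closedin (mtop M) C" "C \<subseteq> W"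
    "\<beta> \<in> smooth_functions M" "\<And>y. y \<notin> C \<Longrightarrow> \<beta> y = 0" "smooth_map_on M (W \<inter> A) g" "openin (mtop M) A"
  shows "smooth_map_on M A (\<lambda>y. \<beta> y *\<^sub>R g y)"
proof (rule smooth_map_on_local[OF M])
  fix x assume x: "x \<in> A"
  show "\<exists>B. openin (mtop M) B \<and> x \<in> B \<and> smooth_map_on M B (\<lambda>y. \<beta> y *\<^sub>R g y)"
  proof (cases "x \<in> C")
    case True
    have op: "openin (mtop M) (W \<inter> A)" using assms by (simp add: openin_Int)
    have "smooth_map_on M (W \<inter> A) \<beta>"
      using smooth_map_on_subset[of M "points M" \<beta>] openin_subset[OF op] assms(5)
      by (simp add: smooth_functions_def)
    from smooth_map_on_bilinear[OF M op bounded_bilinear_scaleR this assms(7)]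
    show ?thesis using True x assms(4) op by blast
  next
    case False
    have "smooth_map_on M (points M - C) (\<lambda>y. \<beta> y *\<^sub>R g y)"
      by (rule smooth_map_on_cong[OF M _ _ smooth_map_on_const[OF M, where c = 0]])
        (use assms(3,6) in auto)
    then show ?thesis using False x openin_subset[OF assms(8)] assms(3) by blast
  qed
qed

lemma smooth_functions_const: "smooth_manifold M \<Longrightarrow> (\<lambda>x. c) \<in> smooth_functions M"
  by (simp add: smooth_functions_def smooth_map_on_const)

lemma smooth_functions_add:
  "smooth_manifold M \<Longrightarrow> f \<in> smooth_functions M \<Longrightarrow> g \<in> smooth_functions M \<Longrightarrow>
    (\<lambda>x. f x + g x) \<in> smooth_functions M"
  by (simp add: smooth_functions_def smooth_map_on_add)

lemma smooth_functions_mult: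
  "smooth_manifold M \<Longrightarrow> f \<in> smooth_functions M \<Longrightarrow> g \<in> smooth_functions M \<Longrightarrow>
    (\<lambda>x. f x * g x) \<in> smooth_functions M"
  by (simp add: smooth_functions_def smooth_map_on_bilinear[OF _ _ bounded_bilinear_mult])

text \<open>Sections can only be multiplied by global functions, so \<open>1 / g\<close> is cut off
  inside the open set on which \<open>g\<close> is nonzero.\<close>

lemma smooth_functions_local_inverse:
  assumes M: "smooth_manifold M" and g: "g \<in> smooth_functions M" and x: "x \<in> points M" "g x \<noteq> 0"
  obtains h N where "h \<in> smooth_functions M" "openin (mtop M) N" "x \<in> N" "\<And>y. y \<in> N \<Longrightarrow> h y * g y = 1"
proof -
  obtain U \<phi> where c: "(U, \<phi>) \<in> atlas M" and xU: "x \<in> U"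
    using manifold_chart[OF M x(1)] .
  note ch = atlas_chart[OF M c]
  have Uop: "openin (mtop M) U" using ch by (simp add: is_chart_def)
  have g': "smooth_map_on M (points M) g" using g by (simp add: smooth_functions_def)
  have op: "open (\<phi> ` U)" using ch by (simp add: is_chart_def)
  have "U \<inter> points M = U" using openin_subset[OF Uop] by blast
  then have "cont_diff_on 0 (\<phi> ` U) (\<lambda>z. g (inv_into U \<phi> z))"
    using smooth_map_onD[OF g' c] unfolding smooth_on_def by metis
  then have "open {z \<in> \<phi> ` U. g (inv_into U \<phi> z) \<in> - {0}}"
    using continuous_open_preimage[OF _ op, of "\<lambda>z. g (inv_into U \<phi> z)" "- {0}"]
    by (simp add: vimage_def Int_def open_Compl)
  from chart_preimage_open[OF ch this]
  have "openin (mtop M) {y \<in> U. g (inv_into U \<phi> (\<phi> y)) \<noteq> 0}"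
    by (rule back_subst[where P = "openin (mtop M)"]) auto
  also have "{y \<in> U. g (inv_into U \<phi> (\<phi> y)) \<noteq> 0} = {y \<in> U. g y \<noteq> 0}"
    using chart_inj[OF ch] by (intro Collect_cong conj_cong) (simp_all add: inv_into_f_f)
  finally have W: "openin (mtop M) {y \<in> U. g y \<noteq> 0}" .
  obtain \<beta> N C where \<beta>: "\<beta> \<in> smooth_functions M" "openin (mtop M) N" "closedin (mtop M) C"
    "x \<in> N" "N \<subseteq> C" "C \<subseteq> {y \<in> U. g y \<noteq> 0}" "\<And>y. y \<in> N \<Longrightarrow> \<beta> y = 1" "\<And>y. y \<notin> C \<Longrightarrow> \<beta> y = 0"
    using plateau_exists[OF M W] x xU by blast
  have "smooth_map_on M {y \<in> U. g y \<noteq> 0} (\<lambda>y. inverse (g y))"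
    by (rule smooth_map_on_inverse[OF M W smooth_map_on_subset[OF g']])
      (use openin_subset[OF Uop] in auto)
  then have "smooth_map_on M (points M) (\<lambda>y. \<beta> y *\<^sub>R inverse (g y))"
    using openin_subset[OF W]
    by (intro smooth_map_on_cutoff[OF M W \<beta>(3) \<beta>(6,1,8)]) (auto simp: inf.absorb1)
  moreover have "\<beta> y *\<^sub>R inverse (g y) * g y = 1" if "y \<in> N" for y
    using that \<beta>(5-7) by auto
  ultimately show ?thesis
    using that[of "\<lambda>y. \<beta> y *\<^sub>R inverse (g y)" N] \<beta>(2,4) by (simp add: smooth_functions_def)
qed

section \<open>Sections of vector bundles\<close>

lemma linear_inv_into:
  assumes "subspace F" "linear_iso_on F A"
  shows "linear (inv_into F A)"
proof
  have b: "bij_betw A F UNIV" and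
    l: "\<And>u v a b. u \<in> F \<Longrightarrow> v \<in> F \<Longrightarrow> A (a *\<^sub>R u + b *\<^sub>R v) = a *\<^sub>R A u + b *\<^sub>R A v"
    using assms(2) by (auto simp: linear_iso_on_def)
  have i: "inv_into F A w \<in> F" "A (inv_into F A w) = w" for w
    using inv_into_into[of w A F] f_inv_into_f[of w A F] b by (simp_all add: bij_betw_def)
  have eq: "inv_into F A w = u" if "u \<in> F" "A u = w" for u w
    using inv_into_f_f[of A F u] b that by (simp add: bij_betw_def)
  show "inv_into F A (w + w') = inv_into F A w + inv_into F A w'" for w w'
    using l[of "inv_into F A w" "inv_into F A w'" 1 1] i
    by (intro eq) (auto intro: subspace_add[OF assms(1)])
  show "inv_into F A (r *\<^sub>R w) = r *\<^sub>R inv_into F A w" for r w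
    using l[of "inv_into F A w" "inv_into F A w" r 0] i
    by (intro eq) (auto intro: subspace_scale[OF assms(1)])
qed

text \<open>Linearity over smooth functions, evaluated at the single point \<open>x\<close>. In this
  form each slot of torsion and curvature can be tested by itself; \<open>tensorial_at_eq\<close>
  then says that the functional sees only the value of the section at \<open>x\<close>.\<close>

definition tensorial_at ::
  "('m, 'e::real_inner, 'v::real_vector, 'f::real_inner) anchored_bundle \<Rightarrow> 'm \<Rightarrow> (('m \<Rightarrow> 'v) \<Rightarrow> real) \<Rightarrow> bool" where
  "tensorial_at E x F \<longleftrightarrow>
     (\<forall>\<psi>\<in>sections E. \<forall>\<phi>\<in>sections E. F (\<lambda>y. \<psi> y + \<phi> y) = F \<psi> + F \<phi>) \<and>
     (\<forall>f\<in>smooth_functions (base E). \<forall>\<psi>\<in>sections E. F (\<lambda>y. f y *\<^sub>R \<psi> y) = f x * F \<psi>)"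

lemma tensorial_at_add:
  "tensorial_at E x F \<Longrightarrow> \<psi> \<in> sections E \<Longrightarrow> \<phi> \<in> sections E \<Longrightarrow> F (\<lambda>y. \<psi> y + \<phi> y) = F \<psi> + F \<phi>"
  by (simp add: tensorial_at_def)

lemma tensorial_at_scale:
  "tensorial_at E x F \<Longrightarrow> f \<in> smooth_functions (base E) \<Longrightarrow> \<psi> \<in> sections E \<Longrightarrow>
    F (\<lambda>y. f y *\<^sub>R \<psi> y) = f x * F \<psi>"
  by (simp add: tensorial_at_def)

lemma section_in_fibre: "\<psi> \<in> sections E \<Longrightarrow> x \<in> bpoints E \<Longrightarrow> \<psi> x \<in> fibre E x"
  by (simp add: sections_def smooth_section_on_def)

lemma section_outside: "\<psi> \<in> sections E \<Longrightarrow> x \<notin> bpoints E \<Longrightarrow> \<psi> x = 0"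
  by (simp add: sections_def)

section \<open>Local trivializations and the construction of global sections\<close>

context
  fixes E :: "('m, 'e::real_inner, 'v::real_vector, 'f::real_inner) anchored_bundle"
  assumes E: "vector_bundle E"
begin

lemma smooth_base: "smooth_manifold (base E)"
  and subspace_fibre: "x \<in> bpoints E \<Longrightarrow> subspace (fibre E x)"
  using E by (simp_all add: vector_bundle_def)

lemma triv_open: "(U, \<Phi>) \<in> trivs E \<Longrightarrow> openin (mtop (base E)) U"
  and triv_iso: "(U, \<Phi>) \<in> trivs E \<Longrightarrow> x \<in> U \<Longrightarrow> linear_iso_on (fibre E x) (\<Phi> x)"
proof -
  have "\<forall>t\<in>trivs E. openin (mtop (base E)) (fst t) \<and> (\<forall>x\<in>fst t. linear_iso_on (fibre E x) (snd t x))"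
    using E by (simp add: vector_bundle_def case_prod_beta')
  from bspec[OF this, of "(U, \<Phi>)"]
  show "(U, \<Phi>) \<in> trivs E \<Longrightarrow> openin (mtop (base E)) U"
    "(U, \<Phi>) \<in> trivs E \<Longrightarrow> x \<in> U \<Longrightarrow> linear_iso_on (fibre E x) (\<Phi> x)"
    by simp_all
qed

lemma triv_points: "(U, \<Phi>) \<in> trivs E \<Longrightarrow> x \<in> U \<Longrightarrow> x \<in> bpoints E"
  using openin_subset[OF triv_open] by blast

lemma triv_at:
  assumes "x \<in> bpoints E"
  obtains U \<Phi> where "(U, \<Phi>) \<in> trivs E" "x \<in> U"
proof -
  have "x \<in> (\<Union>t\<in>trivs E. fst t)" using assms E by (simp add: vector_bundle_def)
  then show ?thesis using that by force
qed

lemma triv_add: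
  assumes "(U, \<Phi>) \<in> trivs E" "x \<in> U" "u \<in> fibre E x" "v \<in> fibre E x"
  shows "\<Phi> x (u + v) = \<Phi> x u + \<Phi> x v"
proof -
  have "\<Phi> x (1 *\<^sub>R u + 1 *\<^sub>R v) = 1 *\<^sub>R \<Phi> x u + 1 *\<^sub>R \<Phi> x v"
    using triv_iso[OF assms(1,2)] assms(3,4) unfolding linear_iso_on_def by blast
  then show ?thesis by simp
qed

lemma triv_scale:
  assumes "(U, \<Phi>) \<in> trivs E" "x \<in> U" "u \<in> fibre E x"
  shows "\<Phi> x (a *\<^sub>R u) = a *\<^sub>R \<Phi> x u"
proof -
  have "\<Phi> x (a *\<^sub>R u + 0 *\<^sub>R u) = a *\<^sub>R \<Phi> x u + 0 *\<^sub>R \<Phi> x u"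
    using triv_iso[OF assms(1,2)] assms(3) unfolding linear_iso_on_def by blast
  then show ?thesis by simp
qed

lemma triv_zero: "(U, \<Phi>) \<in> trivs E \<Longrightarrow> x \<in> U \<Longrightarrow> \<Phi> x 0 = 0"
  using triv_scale[of U \<Phi> x 0 0] subspace_0[OF subspace_fibre[OF triv_points]] by simp

lemma smooth_section_onI:
  assumes "\<And>x. x \<in> A \<Longrightarrow> \<psi> x \<in> fibre E x"
    "\<And>U \<Phi>. (U, \<Phi>) \<in> trivs E \<Longrightarrow> smooth_map_on (base E) (A \<inter> U) (\<lambda>x. \<Phi> x (\<psi> x))"
  shows "smooth_section_on E A \<psi>"
  using assms by (auto simp: smooth_section_on_def)

lemma smooth_section_on_fibre: "smooth_section_on E A \<psi> \<Longrightarrow> x \<in> A \<Longrightarrow> \<psi> x \<in> fibre E x"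
  by (simp add: smooth_section_on_def)

lemma sections_smooth: "\<psi> \<in> sections E \<Longrightarrow> smooth_section_on E (bpoints E) \<psi>"
  by (simp add: sections_def)

lemma sectionsI:
  "smooth_section_on E (bpoints E) \<psi> \<Longrightarrow> (\<And>x. x \<notin> bpoints E \<Longrightarrow> \<psi> x = 0) \<Longrightarrow> \<psi> \<in> sections E"
  by (simp add: sections_def)

lemma smooth_section_onD:
  "smooth_section_on E A \<psi> \<Longrightarrow> (U, \<Phi>) \<in> trivs E \<Longrightarrow> smooth_map_on (base E) (A \<inter> U) (\<lambda>x. \<Phi> x (\<psi> x))"
  by (auto simp: smooth_section_on_def)

lemma smooth_section_on_cong:
  assumes "openin (mtop (base E)) A" "\<And>x. x \<in> A \<Longrightarrow> \<psi> x = \<phi> x" "smooth_section_on E A \<psi>"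
  shows "smooth_section_on E A \<phi>"
proof (rule smooth_section_onI)
  show "\<phi> x \<in> fibre E x" if "x \<in> A" for x
    using smooth_section_on_fibre[OF assms(3) that] assms(2)[OF that] by simp
  show "smooth_map_on (base E) (A \<inter> U) (\<lambda>x. \<Phi> x (\<phi> x))" if t: "(U, \<Phi>) \<in> trivs E" for U \<Phi>
  proof (rule smooth_map_on_cong[OF smooth_base _ _ smooth_section_onD[OF assms(3) t]])
    show "openin (mtop (base E)) (A \<inter> U)" using assms(1) triv_open[OF t] by (rule openin_Int)
  qed (simp add: assms(2))
qed

lemma smooth_section_on_local:
  assumes "\<And>x. x \<in> A \<Longrightarrow> \<exists>B. openin (mtop (base E)) B \<and> x \<in> B \<and> smooth_section_on E B \<psi>"
  shows "smooth_section_on E A \<psi>"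
proof (rule smooth_section_onI)
  show "\<psi> x \<in> fibre E x" if "x \<in> A" for x
    using assms[OF that] smooth_section_on_fibre by blast
  show "smooth_map_on (base E) (A \<inter> U) (\<lambda>x. \<Phi> x (\<psi> x))" if t: "(U, \<Phi>) \<in> trivs E" for U \<Phi>
  proof (rule smooth_map_on_local[OF smooth_base])
    fix x assume x: "x \<in> A \<inter> U"
    then obtain B where B: "openin (mtop (base E)) B" "x \<in> B" "smooth_section_on E B \<psi>"
      using assms[of x] by auto
    show "\<exists>B. openin (mtop (base E)) B \<and> x \<in> B \<and> smooth_map_on (base E) B (\<lambda>x. \<Phi> x (\<psi> x))"
      by (rule exI[of _ "B \<inter> U"])
        (use x B(2) openin_Int[OF B(1) triv_open[OF t]] smooth_section_onD[OF B(3) t] in simp)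
  qed
qed

lemma smooth_section_on_subset:
  assumes "smooth_section_on E A \<psi>" "B \<subseteq> A"
  shows "smooth_section_on E B \<psi>"
proof (rule smooth_section_onI)
  show "\<psi> x \<in> fibre E x" if "x \<in> B" for x
    using assms that smooth_section_on_fibre by blast
  show "smooth_map_on (base E) (B \<inter> U) (\<lambda>x. \<Phi> x (\<psi> x))" if t: "(U, \<Phi>) \<in> trivs E" for U \<Phi>
    by (rule smooth_map_on_subset[OF smooth_section_onD[OF assms(1) t]]) (use assms(2) in blast)
qed

lemma sections_local:
  assumes "\<And>x. x \<in> bpoints E \<Longrightarrow>
      \<exists>N. openin (mtop (base E)) N \<and> x \<in> N \<and> (\<exists>\<phi>\<in>sections E. \<forall>y\<in>N. \<phi> y = \<psi> y)"
    "\<And>x. x \<notin> bpoints E \<Longrightarrow> \<psi> x = 0"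
  shows "\<psi> \<in> sections E"
proof -
  have "smooth_section_on E (bpoints E) \<psi>"
  proof (rule smooth_section_on_local)
    fix x assume "x \<in> bpoints E"
    then obtain N \<phi> where N: "openin (mtop (base E)) N" "x \<in> N" "\<phi> \<in> sections E" "\<forall>y\<in>N. \<phi> y = \<psi> y"
      using assms(1) by meson
    have "smooth_section_on E N \<phi>"
      by (rule smooth_section_on_subset[OF sections_smooth[OF N(3)] openin_subset[OF N(1)]])
    from smooth_section_on_cong[OF N(1) bspec[OF N(4)] this] N(1,2)
    show "\<exists>B. openin (mtop (base E)) B \<and> x \<in> B \<and> smooth_section_on E B \<psi>"
      by (intro exI[of _ N]) simp
  qed
  then show ?thesis using assms(2) by (rule sectionsI)
qed

lemma sections_add:
  assumes "\<psi> \<in> sections E" "\<phi> \<in> sections E"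
  shows "(\<lambda>x. \<psi> x + \<phi> x) \<in> sections E"
proof (intro sectionsI smooth_section_onI)
  show "\<psi> x + \<phi> x \<in> fibre E x" if "x \<in> bpoints E" for x
    by (rule subspace_add[OF subspace_fibre[OF that] section_in_fibre[OF assms(1) that]
          section_in_fibre[OF assms(2) that]])
  show "\<psi> x + \<phi> x = 0" if "x \<notin> bpoints E" for x
    using section_outside[OF assms(1) that] section_outside[OF assms(2) that] by simp
  fix U \<Phi> assume t: "(U, \<Phi>) \<in> trivs E"
  have op: "openin (mtop (base E)) (bpoints E \<inter> U)" using triv_open[OF t] by blast
  have "smooth_map_on (base E) (bpoints E \<inter> U) (\<lambda>x. \<Phi> x (\<psi> x) + \<Phi> x (\<phi> x))"
    by (rule smooth_map_on_add[OF smooth_base op smooth_section_onD[OF sections_smooth t]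
          smooth_section_onD[OF sections_smooth t]]) (fact assms)+
  then show "smooth_map_on (base E) (bpoints E \<inter> U) (\<lambda>x. \<Phi> x (\<psi> x + \<phi> x))"
    by (rule smooth_map_on_cong[OF smooth_base op, rotated])
      (simp add: triv_add[OF t] section_in_fibre[OF assms(1)] section_in_fibre[OF assms(2)])
qed

text \<open>Off \<open>W\<close> the values of \<open>e\<close> may even leave the fibres; the
  factor 0 repairs this, since fibres contain 0 and trivializations send 0 to 0.\<close>

lemma sections_cutoff:
  assumes e: "smooth_section_on E W e" and W: "openin (mtop (base E)) W"
    and C: "closedin (mtop (base E)) C" "C \<subseteq> W"
    and \<beta>: "\<beta> \<in> smooth_functions (base E)" "\<And>y. y \<notin> C \<Longrightarrow> \<beta> y = 0"
  shows "(\<lambda>y. \<beta> y *\<^sub>R e y) \<in> sections E"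
proof (intro sectionsI smooth_section_onI)
  show "\<beta> y *\<^sub>R e y \<in> fibre E y" if "y \<in> bpoints E" for y
  proof (cases "y \<in> W")
    case True
    then show ?thesis
      using subspace_scale[OF subspace_fibre[OF that] smooth_section_on_fibre[OF e]] by simp
  next
    case False
    then have "\<beta> y = 0" using C \<beta>(2) by blast
    then show ?thesis using subspace_0[OF subspace_fibre[OF that]] by simp
  qed
  show "\<beta> y *\<^sub>R e y = 0" if "y \<notin> bpoints E" for y
  proof -
    have "y \<notin> C" using that C openin_subset[OF W] by blast
    then show ?thesis using \<beta>(2) by simp
  qed
  fix U \<Phi> assume t: "(U, \<Phi>) \<in> trivs E"
  have op: "openin (mtop (base E)) (bpoints E \<inter> U)" using triv_open[OF t] by blast
  have "W \<inter> (bpoints E \<inter> U) = W \<inter> U" using openin_subset[OF W] by blast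
  then have g: "smooth_map_on (base E) (W \<inter> (bpoints E \<inter> U)) (\<lambda>x. \<Phi> x (e x))"
    using smooth_section_onD[OF e t] by simp
  have eq: "\<beta> x *\<^sub>R \<Phi> x (e x) = \<Phi> x (\<beta> x *\<^sub>R e x)" if "x \<in> bpoints E \<inter> U" for x
  proof (cases "x \<in> W")
    case True
    then show ?thesis using triv_scale[OF t _ smooth_section_on_fibre[OF e]] that by simp
  next
    case False
    then have "\<beta> x = 0" using C \<beta>(2) by blast
    then show ?thesis using triv_zero[OF t] that by simp
  qed
  show "smooth_map_on (base E) (bpoints E \<inter> U) (\<lambda>x. \<Phi> x (\<beta> x *\<^sub>R e x))"
    by (rule smooth_map_on_cong[OF smooth_base op eq
          smooth_map_on_cutoff[OF smooth_base W C \<beta> g op]])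
qed

lemma sections_scale:
  assumes "f \<in> smooth_functions (base E)" "\<psi> \<in> sections E"
  shows "(\<lambda>x. f x *\<^sub>R \<psi> x) \<in> sections E"
proof -
  \<comment> \<open>Smooth functions are unconstrained off the base. Once \<open>f\<close> is set to
    zero there, \<open>sections_cutoff\<close> applies with the whole base as both the open and the
    closed set.\<close>
  let ?g = "\<lambda>x. if x \<in> bpoints E then f x else 0"
  have "?g \<in> smooth_functions (base E)"
    using assms(1) smooth_map_on_cong[OF smooth_base openin_topspace, of f ?g]
    by (simp add: smooth_functions_def)
  then have "(\<lambda>x. ?g x *\<^sub>R \<psi> x) \<in> sections E"
    using assms(2) by (intro sections_cutoff[of "bpoints E" \<psi> "bpoints E"]) (auto simp: sections_def)
  moreover have "(\<lambda>x. ?g x *\<^sub>R \<psi> x) = (\<lambda>x. f x *\<^sub>R \<psi> x)"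
    using section_outside[OF assms(2)] by auto
  ultimately show ?thesis by simp
qed

lemma sections_scale_const: "\<psi> \<in> sections E \<Longrightarrow> (\<lambda>x. a *\<^sub>R \<psi> x) \<in> sections E"
  by (rule sections_scale[OF smooth_functions_const[OF smooth_base]])

lemma sections_diff:
  assumes "\<psi> \<in> sections E" "\<phi> \<in> sections E"
  shows "(\<lambda>x. \<psi> x - \<phi> x) \<in> sections E"
  using sections_add[OF assms(1) sections_scale_const[OF assms(2), of "- 1"]] by simp

lemma local_frame_smooth:
  assumes "(U, \<Phi>) \<in> trivs E"
  shows "smooth_section_on E U (\<lambda>y. inv_into (fibre E y) (\<Phi> y) w)"
proof -
  have "inv_into (fibre E y) (\<Phi> y) w \<in> fibre E y" if "y \<in> U" for y
    using triv_iso[OF assms that] by (auto simp: linear_iso_on_def bij_betw_def intro: inv_into_into)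
  moreover have "smooth_map_on (base E) (U \<inter> V) (\<lambda>x. \<Psi> x (inv_into (fibre E x) (\<Phi> x) w))"
    if "(V, \<Psi>) \<in> trivs E" for V \<Psi>
  proof -
    have "\<forall>t\<in>trivs E. \<forall>t'\<in>trivs E. \<forall>w. smooth_map_on (base E) (fst t \<inter> fst t')
        (\<lambda>x. snd t' x (inv_into (fibre E x) (snd t x) w))"
      using E by (simp add: vector_bundle_def case_prod_beta')
    from bspec[OF bspec[OF this assms] that] show ?thesis by simp
  qed
  ultimately show ?thesis by (auto simp: smooth_section_on_def)
qed

text \<open>Take the section that is constant in a trivialization and multiply it by a bump function
  equal to 1 at \<open>x\<close>.\<close>

lemma section_through:
  assumes x: "x \<in> bpoints E" and u: "u \<in> fibre E x"
  obtains \<psi> where "\<psi> \<in> sections E" "\<psi> x = u"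
proof -
  obtain U \<Phi> where t: "(U, \<Phi>) \<in> trivs E" "x \<in> U" using triv_at[OF x] .
  obtain \<beta> N C where \<beta>: "\<beta> \<in> smooth_functions (base E)" "openin (mtop (base E)) N"
    "closedin (mtop (base E)) C" "x \<in> N" "N \<subseteq> C" "C \<subseteq> U" "\<And>y. y \<in> N \<Longrightarrow> \<beta> y = 1" "\<And>y. y \<notin> C \<Longrightarrow> \<beta> y = 0"
    using plateau_exists[OF smooth_base triv_open[OF t(1)] t(2)] by blast
  have "inv_into (fibre E x) (\<Phi> x) (\<Phi> x u) = u"
    using triv_iso[OF t] u by (auto simp: linear_iso_on_def bij_betw_def)
  then show ?thesis
    using that[OF sections_cutoff[OF local_frame_smooth[OF t(1), of "\<Phi> x u"] triv_open[OF t(1)] \<beta>(3,6,1,8)]]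
      \<beta>(4,7) by simp
qed

lemma zero_section: "(\<lambda>x. 0) \<in> sections E"
proof (intro sectionsI smooth_section_onI)
  fix U \<Phi> assume t: "(U, \<Phi>) \<in> trivs E"
  show "smooth_map_on (base E) (bpoints E \<inter> U) (\<lambda>x. \<Phi> x 0)"
    by (rule smooth_map_on_cong[OF smooth_base _ _ smooth_map_on_const[OF smooth_base, where c = 0]])
      (use openin_Int[OF openin_topspace triv_open[OF t]] triv_zero[OF t] in simp_all)
qed (use subspace_0[OF subspace_fibre] in simp_all)

lemma sections_sum:
  assumes "finite I" "\<And>i. i \<in> I \<Longrightarrow> \<psi> i \<in> sections E"
  shows "(\<lambda>x. \<Sum>i\<in>I. \<psi> i x) \<in> sections E"
  using assms by (induction I) (simp_all add: zero_section sections_add)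

section \<open>Functionals that depend only on the value of a section at a point\<close>

lemma tensorial_at_scale_const:
  "tensorial_at E x F \<Longrightarrow> \<psi> \<in> sections E \<Longrightarrow> F (\<lambda>y. a *\<^sub>R \<psi> y) = a * F \<psi>"
  using smooth_functions_const[OF smooth_base, of a] by (auto simp: tensorial_at_def)

lemma tensorial_at_sum:
  assumes "tensorial_at E x F" "finite I" "\<And>i. i \<in> I \<Longrightarrow> \<psi> i \<in> sections E"
  shows "F (\<lambda>y. \<Sum>i\<in>I. \<psi> i y) = (\<Sum>i\<in>I. F (\<psi> i))"
  using assms(2,3)
proof (induction I)
  case empty
  show ?case using tensorial_at_scale_const[OF assms(1) zero_section, of 0] by simp
next
  case (insert i I)
  have "F (\<lambda>y. \<psi> i y + (\<Sum>i\<in>I. \<psi> i y)) = F (\<psi> i) + F (\<lambda>y. \<Sum>i\<in>I. \<psi> i y)"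
    using assms(1) insert.prems sections_sum[OF insert.hyps(1), of \<psi>] by (simp add: tensorial_at_def)
  then show ?case using insert by simp
qed

text \<open>Near \<open>x\<close> the section is a combination of a frame with smooth coefficients
  that vanish at \<open>x\<close>, and a tensorial functional pulls these coefficients out as
  numbers at \<open>x\<close>.\<close>

lemma tensorial_at_vanish:
  assumes F: "tensorial_at E x F" and x: "x \<in> bpoints E" and \<psi>: "\<psi> \<in> sections E" "\<psi> x = 0"
  shows "F \<psi> = 0"
proof -
  obtain U \<Phi> where t: "(U, \<Phi>) \<in> trivs E" "x \<in> U" using triv_at[OF x] .
  note op = triv_open[OF t(1)]
  obtain \<beta> N C where \<beta>: "\<beta> \<in> smooth_functions (base E)" "openin (mtop (base E)) N"
    "closedin (mtop (base E)) C" "x \<in> N" "N \<subseteq> C" "C \<subseteq> U" "\<And>y. y \<in> N \<Longrightarrow> \<beta> y = 1" "\<And>y. y \<notin> C \<Longrightarrow> \<beta> y = 0"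
    using plateau_exists[OF smooth_base op t(2)] by blast
  have \<beta>x: "\<beta> x = 1" using \<beta>(4,7) by blast
  have "finite_dimensional TYPE('f)" using E by (simp add: vector_bundle_def)
  then obtain B :: "'f set" where B: "finite B" "\<And>w. (\<Sum>c\<in>B. (inner w c / inner c c) *\<^sub>R c) = w"
    using finite_dimensional_orthogonal_basis by blast
  \<comment> \<open>Frame and coefficients exist only on \<open>U\<close>, and each needs one factor
    \<open>\<beta>\<close> to become global. Hence the factor \<open>\<beta> y * \<beta> y\<close>
    below, which is 1 at \<open>x\<close>.\<close>
  define e where "e c y = \<beta> y *\<^sub>R inv_into (fibre E y) (\<Phi> y) c" for c y
  define g where "g c y = \<beta> y *\<^sub>R (inner (\<Phi> y (\<psi> y)) c / inner c c)" for c y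
  have e: "e c \<in> sections E" for c
    unfolding e_def by (rule sections_cutoff[OF local_frame_smooth[OF t(1)] op \<beta>(3,6,1,8)])
  have g: "g c \<in> smooth_functions (base E)" for c
  proof -
    have "smooth_map_on (base E) (bpoints E \<inter> U) (\<lambda>y. \<Phi> y (\<psi> y))"
      using \<psi>(1) by (intro smooth_section_onD[OF _ t(1)]) (simp add: sections_def)
    moreover have "bounded_linear (\<lambda>w. inner w c / inner c c)"
      by (rule bounded_linear_compose[OF bounded_linear_divide bounded_linear_inner_left])
    ultimately have "smooth_map_on (base E) (U \<inter> bpoints E) (\<lambda>y. inner (\<Phi> y (\<psi> y)) c / inner c c)"
      using smooth_map_on_linear[OF smooth_base openin_Int[OF op openin_topspace]]
      by (simp add: Int_commute)
    then show ?thesis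
      unfolding g_def smooth_functions_def
      using smooth_map_on_cutoff[OF smooth_base op \<beta>(3,6,1,8) _ openin_topspace] by blast
  qed
  have eq: "(\<Sum>c\<in>B. g c y *\<^sub>R e c y) = (\<beta> y * \<beta> y) *\<^sub>R \<psi> y" for y
  proof (cases "y \<in> U")
    case True
    note p = triv_points[OF t(1) True]
    interpret l: linear "inv_into (fibre E y) (\<Phi> y)"
      by (rule linear_inv_into[OF subspace_fibre[OF p] triv_iso[OF t(1) True]])
    have "\<psi> y = inv_into (fibre E y) (\<Phi> y) (\<Phi> y (\<psi> y))"
      using triv_iso[OF t(1) True] section_in_fibre[OF \<psi>(1) p]
      by (auto simp: linear_iso_on_def bij_betw_def)
    also have "\<Phi> y (\<psi> y) = (\<Sum>c\<in>B. (inner (\<Phi> y (\<psi> y)) c / inner c c) *\<^sub>R c)" by (simp add: B(2))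
    finally have "\<psi> y = (\<Sum>c\<in>B. (inner (\<Phi> y (\<psi> y)) c / inner c c) *\<^sub>R inv_into (fibre E y) (\<Phi> y) c)"
      by (simp add: l.sum l.scale)
    then have "(\<beta> y * \<beta> y) *\<^sub>R \<psi> y =
        (\<beta> y * \<beta> y) *\<^sub>R (\<Sum>c\<in>B. (inner (\<Phi> y (\<psi> y)) c / inner c c) *\<^sub>R inv_into (fibre E y) (\<Phi> y) c)"
      by simp
    then show ?thesis by (simp add: e_def g_def scaleR_sum_right mult_ac)
  next
    case False
    then have "\<beta> y = 0" using \<beta>(6,8) by blast
    then show ?thesis by (simp add: e_def)
  qed
  have g0: "g c x = 0" for c using \<psi>(2) triv_zero[OF t] by (simp add: g_def)
  have "F \<psi> = F (\<lambda>y. (\<beta> y * \<beta> y) *\<^sub>R \<psi> y)"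
    using F smooth_functions_mult[OF smooth_base \<beta>(1) \<beta>(1)] \<psi>(1) \<beta>x
    by (simp add: tensorial_at_def)
  also have "\<dots> = F (\<lambda>y. \<Sum>c\<in>B. g c y *\<^sub>R e c y)" by (simp add: eq)
  also have "\<dots> = (\<Sum>c\<in>B. F (\<lambda>y. g c y *\<^sub>R e c y))"
    by (rule tensorial_at_sum[OF F B(1) sections_scale[OF g e]])
  also have "\<dots> = 0" using F g e g0 by (simp add: tensorial_at_def)
  finally show ?thesis .
qed

lemma tensorial_at_eq:
  assumes F: "tensorial_at E x F" and x: "x \<in> bpoints E"
    and "\<psi> \<in> sections E" "\<phi> \<in> sections E" "\<psi> x = \<phi> x"
  shows "F \<psi> = F \<phi>"
proof -
  have "F (\<lambda>y. \<phi> y + (\<psi> y - \<phi> y)) = F \<phi> + F (\<lambda>y. \<psi> y - \<phi> y)"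
    by (rule tensorial_at_add[OF F assms(4) sections_diff[OF assms(3,4)]])
  then show ?thesis
    using tensorial_at_vanish[OF F x sections_diff[OF assms(3,4)]] assms(5) by simp
qed

end

section \<open>Duality by the fibre-wise metric\<close>

text \<open>Orthogonal vectors of nonzero square are independent for an indefinite form too, and
  \<open>p + q\<close> is the size of a signature basis, so no further independent vector fits. As
  the signature is the same at all points, this count makes a frame orthogonal near a point into a
  basis of the nearby fibres.\<close>

lemma orthogonal_family_spans:
  fixes g :: "'v::real_vector \<Rightarrow> 'v \<Rightarrow> real"
  assumes F: "subspace F"
    and lin: "\<And>u v w a b. u \<in> F \<Longrightarrow> v \<in> F \<Longrightarrow> w \<in> F \<Longrightarrow> g (a *\<^sub>R u + b *\<^sub>R v) w = a * g u w + b * g v w"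
    and sig: "has_signature g F p q"
    and A: "finite A" "A \<subseteq> F" "card A = p + q"
    and orth: "\<And>a b. a \<in> A \<Longrightarrow> b \<in> A \<Longrightarrow> a \<noteq> b \<Longrightarrow> g a b = 0"
    and norm: "\<And>a. a \<in> A \<Longrightarrow> g a a \<noteq> 0"
  shows "span A = F"
proof -
  have g0: "g 0 w = 0" if "w \<in> F" for w
    using lin[of 0 0 w 0 0] subspace_0[OF F] that by simp
  have sum: "g (\<Sum>a\<in>B. c a *\<^sub>R a) w = (\<Sum>a\<in>B. c a * g a w)"
    if "B \<subseteq> A" "w \<in> F" for B c w
    using finite_subset[OF that(1) A(1)] that
  proof (induction B)
    case (insert b B)
    have B: "B \<subseteq> F" "b \<in> F" using insert.prems A(2) by auto
    have "(\<Sum>a\<in>B. c a *\<^sub>R a) \<in> F"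
      by (rule subspace_sum[OF F]) (use B(1) subspace_scale[OF F] in blast)
    from lin[OF B(2) this insert.prems(2), of "c b" 1]
    have "g (c b *\<^sub>R b + 1 *\<^sub>R (\<Sum>a\<in>B. c a *\<^sub>R a)) w = c b * g b w + 1 * g (\<Sum>a\<in>B. c a *\<^sub>R a) w" .
    then show ?case using insert by simp
  qed (simp add: g0)
  have ind: "independent A"
  proof
    assume "dependent A"
    then have "\<exists>c. (\<exists>a\<in>A. c a \<noteq> 0) \<and> (\<Sum>b\<in>A. c b *\<^sub>R b) = 0"
      using dependent_finite[OF A(1)] by simp
    then obtain c a where c: "a \<in> A" "c a \<noteq> 0" "(\<Sum>b\<in>A. c b *\<^sub>R b) = 0" by blast
    have aF: "a \<in> F" using c(1) A(2) by blast
    have "(\<Sum>b\<in>A. c b * g b a) = (\<Sum>b\<in>A. if b = a then c a * g a a else 0)"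
      using orth c(1) by (intro sum.cong) auto
    also have "\<dots> = c a * g a a" using A(1) c(1) by simp
    finally show False
      using sum[OF subset_refl aF, of c] c(2,3) g0[OF aF] norm[OF c(1)] by simp
  qed
  obtain P N where PN: "finite P" "finite N" "P \<inter> N = {}" "card P = p" "card N = q" "span (P \<union> N) = F"
    using sig unfolding has_signature_def by (elim exE conjE) (rule that)
  have "F \<subseteq> span A"
  proof
    fix x assume x: "x \<in> F"
    show "x \<in> span A"
    proof (rule ccontr)
      assume n: "x \<notin> span A"
      then have "independent (insert x A)" using ind by (simp add: independent_insert)
      moreover have "insert x A \<subseteq> span (P \<union> N)" using x A(2) PN(6) by simp
      ultimately have "card (insert x A) \<le> card (P \<union> N)"
        using independent_span_bound[of "P \<union> N" "insert x A"] PN(1,2) by simp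
      moreover have "x \<notin> A" using n span_base by blast
      ultimately show False using A(1,3) PN(4,5) card_Un_disjoint[OF PN(1-3)] by simp
    qed
  qed
  then show ?thesis using span_minimal[OF A(2) F] by blast
qed

text \<open>Sections and coefficients are global, the relations hold only on \<open>N\<close>. The
  frame is not normalized: \<open>h i\<close> stands for the inverse of the square of
  \<open>e i\<close>, which avoids roots and signs.\<close>

definition orthogonal_frame_on ::
  "('m, 'e::real_inner, 'v::real_vector, 'f::real_inner) anchored_bundle \<Rightarrow> 'm set \<Rightarrow> 'i set \<Rightarrow>
   ('i \<Rightarrow> 'm \<Rightarrow> 'v) \<Rightarrow> ('i \<Rightarrow> 'm \<Rightarrow> real) \<Rightarrow> bool" where
  "orthogonal_frame_on E N I e h \<longleftrightarrow>
     (\<forall>i\<in>I. e i \<in> sections E \<and> h i \<in> smooth_functions (base E)) \<and>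
     (\<forall>i\<in>I. \<forall>j\<in>I. i \<noteq> j \<longrightarrow> (\<forall>y\<in>N. pairing E (e i) (e j) y = 0)) \<and>
     (\<forall>i\<in>I. \<forall>y\<in>N. h i y * pairing E (e i) (e i) y = 1)"

lemma orthogonal_frame_onD:
  assumes "orthogonal_frame_on E N I e h"
  shows "i \<in> I \<Longrightarrow> e i \<in> sections E" "i \<in> I \<Longrightarrow> h i \<in> smooth_functions (base E)"
    "y \<in> N \<Longrightarrow> i \<in> I \<Longrightarrow> j \<in> I \<Longrightarrow> i \<noteq> j \<Longrightarrow> pairing E (e i) (e j) y = 0"
    "y \<in> N \<Longrightarrow> i \<in> I \<Longrightarrow> h i y * pairing E (e i) (e i) y = 1"
  using assms by (simp_all add: orthogonal_frame_on_def)

section \<open>Orthogonal frames near a point and metric duals of functionals\<close>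

context
  fixes E :: "('m, 'e::real_inner, 'v::real_vector, 'f::real_inner) anchored_bundle"
  assumes E: "vector_bundle E" and g: "is_metric E"
begin

lemma metric_sym: "x \<in> bpoints E \<Longrightarrow> u \<in> fibre E x \<Longrightarrow> v \<in> fibre E x \<Longrightarrow> metric E x u v = metric E x v u"
  using g[unfolded is_metric_def, THEN conjunct1] by blast

lemma metric_lin: "x \<in> bpoints E \<Longrightarrow> u \<in> fibre E x \<Longrightarrow> v \<in> fibre E x \<Longrightarrow> w \<in> fibre E x \<Longrightarrow>
    metric E x (a *\<^sub>R u + b *\<^sub>R v) w = a * metric E x u w + b * metric E x v w"
  using g[unfolded is_metric_def, THEN conjunct2, THEN conjunct1] by blast

lemma metric_nondegenerate:
  "x \<in> bpoints E \<Longrightarrow> u \<in> fibre E x \<Longrightarrow> (\<And>v. v \<in> fibre E x \<Longrightarrow> metric E x u v = 0) \<Longrightarrow> u = 0"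
  using g[unfolded is_metric_def, THEN conjunct2, THEN conjunct2, THEN conjunct1] by blast

lemma metric_signature: "\<exists>p q. \<forall>x\<in>bpoints E. has_signature (metric E x) (fibre E x) p q"
  using g[unfolded is_metric_def, THEN conjunct2, THEN conjunct2, THEN conjunct2, THEN conjunct1] .

lemma pairing_smooth: "\<psi> \<in> sections E \<Longrightarrow> \<phi> \<in> sections E \<Longrightarrow> pairing E \<psi> \<phi> \<in> smooth_functions (base E)"
  using g[unfolded is_metric_def, THEN conjunct2, THEN conjunct2, THEN conjunct2, THEN conjunct2] by blast

lemma pairing_sym:
  "x \<in> bpoints E \<Longrightarrow> \<psi> \<in> sections E \<Longrightarrow> \<phi> \<in> sections E \<Longrightarrow> pairing E \<psi> \<phi> x = pairing E \<phi> \<psi> x"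
  unfolding pairing_def by (intro metric_sym section_in_fibre)

lemma pairing_add_left:
  assumes "x \<in> bpoints E" "\<psi> \<in> sections E" "\<psi>' \<in> sections E" "\<phi> \<in> sections E"
  shows "pairing E (\<lambda>y. \<psi> y + \<psi>' y) \<phi> x = pairing E \<psi> \<phi> x + pairing E \<psi>' \<phi> x"
  using metric_lin[of x "\<psi> x" "\<psi>' x" "\<phi> x" 1 1] assms by (simp add: section_in_fibre pairing_def)

lemma pairing_scale_left:
  assumes "x \<in> bpoints E" "\<psi> \<in> sections E" "\<phi> \<in> sections E"
  shows "pairing E (\<lambda>y. f y *\<^sub>R \<psi> y) \<phi> x = f x * pairing E \<psi> \<phi> x"
  using metric_lin[of x "\<psi> x" "\<psi> x" "\<phi> x" "f x" 0] assms by (simp add: section_in_fibre pairing_def)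

lemma pairing_diff_left:
  assumes "x \<in> bpoints E" "\<psi> \<in> sections E" "\<psi>' \<in> sections E" "\<phi> \<in> sections E"
  shows "pairing E (\<lambda>y. \<psi> y - \<psi>' y) \<phi> x = pairing E \<psi> \<phi> x - pairing E \<psi>' \<phi> x"
  using metric_lin[of x "\<psi> x" "\<psi>' x" "\<phi> x" 1 "- 1"] assms by (simp add: section_in_fibre pairing_def)

lemma pairing_tensorial_left:
  assumes "x \<in> bpoints E" "\<phi> \<in> sections E"
  shows "tensorial_at E x (\<lambda>\<psi>. pairing E \<psi> \<phi> x)"
  using assms by (simp add: tensorial_at_def pairing_add_left pairing_scale_left)

lemma pairing_tensorial_right:
  assumes "x \<in> bpoints E" "\<psi> \<in> sections E"
  shows "tensorial_at E x (\<lambda>\<phi>. pairing E \<psi> \<phi> x)"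
  using assms
  by (simp add: tensorial_at_def pairing_sym[of x \<psi>] sections_add[OF E] sections_scale[OF E]
      pairing_add_left pairing_scale_left)

lemma section_eq_at:
  assumes x: "x \<in> bpoints E" and \<psi>: "\<psi> \<in> sections E" "\<phi> \<in> sections E"
    and eq: "\<And>\<eta>. \<eta> \<in> sections E \<Longrightarrow> pairing E \<psi> \<eta> x = pairing E \<phi> \<eta> x"
  shows "\<psi> x = \<phi> x"
proof -
  have "metric E x (\<psi> x - \<phi> x) v = 0" if v: "v \<in> fibre E x" for v
  proof -
    obtain \<eta> where "\<eta> \<in> sections E" "\<eta> x = v" using section_through[OF E x v] .
    then show ?thesis
      using eq[of \<eta>] pairing_diff_left[OF x \<psi>, of \<eta>] by (simp add: pairing_def)
  qed
  then have "\<psi> x - \<phi> x = 0"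
    using metric_nondegenerate[OF x section_in_fibre[OF sections_diff[OF E \<psi>] x]] by blast
  then show ?thesis by simp
qed

text \<open>
  Gram-Schmidt with smooth coefficients: the divisors \<open>\<langle>e, e\<rangle>\<close> do not vanish near \<open>x\<close>, where \<open>h\<close> is
  their inverse. This avoids inverting the Gram matrix of a local frame.
\<close>

lemma orthogonal_frame_near:
  assumes x: "x \<in> bpoints E" and "finite P" "P \<subseteq> fibre E x"
    "\<And>u v. u \<in> P \<Longrightarrow> v \<in> P \<Longrightarrow> u \<noteq> v \<Longrightarrow> metric E x u v = 0" "\<And>u. u \<in> P \<Longrightarrow> metric E x u u \<noteq> 0"
  shows "\<exists>e h N. openin (mtop (base E)) N \<and> x \<in> N \<and> orthogonal_frame_on E N P e h \<and> (\<forall>v\<in>P. e v x = v)"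
  using assms(2-)
proof (induction P)
  case empty
  show ?case by (rule exI, rule exI, rule exI[of _ "bpoints E"]) (simp add: x orthogonal_frame_on_def)
next
  case (insert w P)
  have "\<exists>e h N. openin (mtop (base E)) N \<and> x \<in> N \<and> orthogonal_frame_on E N P e h \<and> (\<forall>v\<in>P. e v x = v)"
    by (rule insert.IH) (use insert.prems in auto)
  then obtain e h N where N: "openin (mtop (base E)) N" "x \<in> N" and fr: "orthogonal_frame_on E N P e h"
    and ex: "\<forall>v\<in>P. e v x = v"
    by (elim exE conjE) (rule that)
  note eh = orthogonal_frame_onD(1,2)[OF fr]
  note orth = orthogonal_frame_onD(3,4)[OF fr]
  have NM: "y \<in> bpoints E" if "y \<in> N" for y using openin_subset[OF N(1)] that by blast
  note M = smooth_base[OF E]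
  obtain e0 where e0: "e0 \<in> sections E" "e0 x = w" using section_through[OF E x, of w] insert.prems(1) by blast
  \<comment> \<open>Minus the Gram-Schmidt coefficient of \<open>e0\<close> along
    \<open>e u\<close>, with \<open>h u\<close> in place of the division.\<close>
  define c where "c u y = (- 1) * (pairing E e0 (e u) y * h u y)" for u y
  define e1 where "e1 y = e0 y + (\<Sum>u\<in>P. c u y *\<^sub>R e u y)" for y
  have c: "c u \<in> smooth_functions (base E)" if "u \<in> P" for u
    unfolding c_def
    by (intro smooth_functions_mult[OF M] smooth_functions_const[OF M] pairing_smooth e0(1) eh that)
  have s: "(\<lambda>y. c u y *\<^sub>R e u y) \<in> sections E" if "u \<in> P" for u
    by (rule sections_scale[OF E c[OF that] eh(1)[OF that]])
  note ss = sections_sum[OF E insert.hyps(1), of "\<lambda>u y. c u y *\<^sub>R e u y", OF s]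
  have e1: "e1 \<in> sections E"
    using sections_add[OF E e0(1) ss] by (simp add: e1_def[abs_def])
  \<comment> \<open>At \<open>x\<close> the vector \<open>w\<close> is already orthogonal to
    \<open>P\<close>, so the correction does not move the value there. This keeps the square of
    \<open>e1\<close> nonzero at \<open>x\<close>, and thus invertible near it.\<close>
  have "c u x = 0" if "u \<in> P" for u
    using insert.prems(2)[of w u] insert.hyps(2) that e0(2) ex by (auto simp: c_def pairing_def)
  then have e1x: "e1 x = w" by (simp add: e1_def e0(2))
  have e1_orth: "pairing E e1 (e v) y = 0" if y: "y \<in> N" and v: "v \<in> P" for y v
  proof -
    note t = pairing_tensorial_left[OF NM[OF y] eh(1)[OF v]]
    have "pairing E e1 (e v) y = pairing E e0 (e v) y + (\<Sum>u\<in>P. pairing E (\<lambda>y. c u y *\<^sub>R e u y) (e v) y)"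
      using tensorial_at_add[OF t e0(1) ss] tensorial_at_sum[OF E t insert.hyps(1), of "\<lambda>u y. c u y *\<^sub>R e u y", OF s]
      by (simp add: e1_def[abs_def])
    also have "(\<Sum>u\<in>P. pairing E (\<lambda>y. c u y *\<^sub>R e u y) (e v) y) =
        (\<Sum>u\<in>P. if u = v then - pairing E e0 (e v) y else 0)"
    proof (rule sum.cong[OF refl])
      fix u assume u: "u \<in> P"
      show "pairing E (\<lambda>y. c u y *\<^sub>R e u y) (e v) y = (if u = v then - pairing E e0 (e v) y else 0)"
        using tensorial_at_scale[OF t c[OF u] eh(1)[OF u]] orth(1)[OF y u v] orth(2)[OF y v]
        by (auto simp: c_def mult.assoc)
    qed
    also have "\<dots> = - pairing E e0 (e v) y" using insert.hyps(1) v by simp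
    finally show ?thesis by simp
  qed
  have "pairing E e1 e1 x \<noteq> 0" using insert.prems(3)[of w] by (simp add: pairing_def e1x)
  then obtain h1 N1 where h1: "h1 \<in> smooth_functions (base E)" "openin (mtop (base E)) N1" "x \<in> N1"
    "\<And>y. y \<in> N1 \<Longrightarrow> h1 y * pairing E e1 e1 y = 1"
    using smooth_functions_local_inverse[OF M pairing_smooth[OF e1 e1] x] by blast
  let ?e = "e(w := e1)" and ?h = "h(w := h1)"
  have "orthogonal_frame_on E (N \<inter> N1) (insert w P) ?e ?h"
    unfolding orthogonal_frame_on_def
  proof (intro conjI ballI impI)
    fix y u v assume y: "y \<in> N \<inter> N1" and uv: "u \<in> insert w P" "v \<in> insert w P" "u \<noteq> v"
    have "pairing E (e u) e1 y = 0" if "u \<in> P" for u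
      using e1_orth[of y u] y that pairing_sym[OF NM eh(1)[OF that] e1, of y] by simp
    then show "pairing E (?e u) (?e v) y = 0"
      using uv y e1_orth[of y] orth(1)[of y] by (cases "u = w"; cases "v = w") auto
  next
    fix y u assume "y \<in> N \<inter> N1" "u \<in> insert w P"
    then show "?h u y * pairing E (?e u) (?e u) y = 1"
      using h1(4)[of y] orth(2)[of y] by (cases "u = w") auto
  qed (use e1 h1(1) eh in auto)
  moreover have "openin (mtop (base E)) (N \<inter> N1)" "x \<in> N \<inter> N1" using N h1(2,3) by auto
  moreover have "\<forall>v\<in>insert w P. ?e v x = v" using e1x ex by auto
  ultimately show ?case by blast
qed

text \<open>A Riesz representation near \<open>x\<close>: \<kappa> is the orthogonal expansion with
  coefficients \<open>\<alpha> (e u) * h u\<close>. It represents \<alpha> on the frame by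
  construction, and on all sections because the frame spans the nearby fibres.\<close>

lemma dual_section_near:
  assumes x: "x \<in> bpoints E"
    and \<alpha>: "\<And>\<phi>. \<phi> \<in> sections E \<Longrightarrow> \<alpha> \<phi> \<in> smooth_functions (base E)"
    "\<And>y. y \<in> bpoints E \<Longrightarrow> tensorial_at E y (\<lambda>\<phi>. \<alpha> \<phi> y)"
  shows "\<exists>\<kappa>\<in>sections E. \<exists>N. openin (mtop (base E)) N \<and> x \<in> N \<and>
    (\<forall>y\<in>N. \<forall>\<phi>\<in>sections E. pairing E \<kappa> \<phi> y = \<alpha> \<phi> y)"
proof -
  obtain p q where sig: "\<forall>y\<in>bpoints E. has_signature (metric E y) (fibre E y) p q"
    using metric_signature by blast
  obtain P0 N0 where PN: "finite P0" "finite N0" "P0 \<inter> N0 = {}" "card P0 = p" "card N0 = q"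
    "span (P0 \<union> N0) = fibre E x"
    "\<forall>u\<in>P0 \<union> N0. \<forall>v\<in>P0 \<union> N0. metric E x u v = (if u \<noteq> v then 0 else if u \<in> P0 then 1 else -1)"
    using bspec[OF sig x] unfolding has_signature_def by (elim exE conjE) (rule that)
  define P where "P = P0 \<union> N0"
  have P: "finite P" "P \<subseteq> fibre E x" "card P = p + q"
    using PN by (auto simp: P_def card_Un_disjoint span_base)
  have PN7: "metric E x u v = (if u \<noteq> v then 0 else if u \<in> P0 then 1 else -1)" if "u \<in> P" "v \<in> P" for u v
    using PN(7) that unfolding P_def by blast
  have "\<exists>e h N. openin (mtop (base E)) N \<and> x \<in> N \<and> orthogonal_frame_on E N P e h \<and> (\<forall>v\<in>P. e v x = v)"
    by (rule orthogonal_frame_near[OF x P(1,2)]) (simp_all add: PN7)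
  then obtain e h N where N: "openin (mtop (base E)) N" "x \<in> N" and fr: "orthogonal_frame_on E N P e h"
    by (elim exE conjE) (rule that)
  note eh = orthogonal_frame_onD(1,2)[OF fr]
  note orth = orthogonal_frame_onD(3,4)[OF fr]
  define c where "c u y = \<alpha> (e u) y * h u y" for u y
  have c: "c u \<in> smooth_functions (base E)" if "u \<in> P" for u
    unfolding c_def by (intro smooth_functions_mult[OF smooth_base[OF E]] \<alpha>(1) eh that)
  define \<kappa> where "\<kappa> = (\<lambda>y. \<Sum>u\<in>P. c u y *\<^sub>R e u y)"
  have s: "(\<lambda>y. c u y *\<^sub>R e u y) \<in> sections E" if "u \<in> P" for u
    by (rule sections_scale[OF E c[OF that] eh(1)[OF that]])
  have \<kappa>: "\<kappa> \<in> sections E"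
    unfolding \<kappa>_def by (rule sections_sum[OF E P(1) s])
  have "pairing E \<kappa> \<phi> y = \<alpha> \<phi> y" if y: "y \<in> N" and \<phi>: "\<phi> \<in> sections E" for y \<phi>
  proof -
    have yM: "y \<in> bpoints E" using openin_subset[OF N(1)] y by blast
    have on_frame: "pairing E \<kappa> (e v) y = \<alpha> (e v) y" if v: "v \<in> P" for v
    proof -
      note t = pairing_tensorial_left[OF yM eh(1)[OF v]]
      have "pairing E \<kappa> (e v) y = (\<Sum>u\<in>P. pairing E (\<lambda>y. c u y *\<^sub>R e u y) (e v) y)"
        unfolding \<kappa>_def by (rule tensorial_at_sum[OF E t P(1) s])
      also have "\<dots> = (\<Sum>u\<in>P. if u = v then \<alpha> (e v) y else 0)"
      proof (rule sum.cong[OF refl])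
        fix u assume u: "u \<in> P"
        show "pairing E (\<lambda>y. c u y *\<^sub>R e u y) (e v) y = (if u = v then \<alpha> (e v) y else 0)"
          using tensorial_at_scale[OF t c[OF u] eh(1)[OF u]] orth(1)[OF y u v] orth(2)[OF y v]
          by (auto simp: c_def mult.assoc)
      qed
      also have "\<dots> = \<alpha> (e v) y" using P(1) v by simp
      finally show ?thesis .
    qed
    have inj: "inj_on (\<lambda>v. e v y) P"
    proof (rule inj_onI, rule ccontr)
      fix u v assume uv: "u \<in> P" "v \<in> P" "e u y = e v y" "u \<noteq> v"
      then have "pairing E (e u) (e u) y = pairing E (e u) (e v) y" by (simp add: pairing_def)
      then show False using orth(1)[OF y uv(1,2,4)] orth(2)[OF y uv(1)] by simp
    qed
    let ?A = "(\<lambda>v. e v y) ` P"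
    \<comment> \<open>At \<open>x\<close> the values span by the choice of \<open>P\<close>. At
      \<open>y\<close> this is recovered by counting: they are \<open>p + q\<close> orthogonal
      vectors of nonzero square.\<close>
    have "span ?A = fibre E y"
    proof (rule orthogonal_family_spans[OF subspace_fibre[OF E yM] metric_lin[OF yM] bspec[OF sig yM]])
      show "?A \<subseteq> fibre E y" using section_in_fibre[OF eh(1) yM] by blast
      show "card ?A = p + q" by (simp add: card_image[OF inj] P(3))
      show "metric E y a b = 0" if "a \<in> ?A" "b \<in> ?A" "a \<noteq> b" for a b
        using that orth(1)[OF y] by (auto simp: pairing_def)
      show "metric E y a a \<noteq> 0" if "a \<in> ?A" for a
        using that orth(2)[OF y] unfolding pairing_def by force
    qed (use P(1) in auto)
    then have "\<phi> y \<in> span ?A" using section_in_fibre[OF \<phi> yM] by simp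
    then obtain d where "\<phi> y = (\<Sum>a\<in>?A. d a *\<^sub>R a)"
      using span_finite[of ?A] P(1) by auto
    then have d: "\<phi> y = (\<Sum>v\<in>P. d (e v y) *\<^sub>R e v y)"
      by (simp add: sum.reindex[OF inj])
    \<comment> \<open>The coefficients are frozen at \<open>y\<close>, so \<phi>' is a constant
      combination of global frame sections that agrees with \<phi> at \<open>y\<close>. Any
      functional tensorial at \<open>y\<close> is thereby determined by its values on the
      frame.\<close>
    define \<phi>' where "\<phi>' = (\<lambda>z. \<Sum>v\<in>P. d (e v y) *\<^sub>R e v z)"
    have s': "(\<lambda>z. d (e v y) *\<^sub>R e v z) \<in> sections E" if "v \<in> P" for v
      by (rule sections_scale_const[OF E eh(1)[OF that]])
    have \<phi>': "\<phi>' \<in> sections E" "\<phi> y = \<phi>' y"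
      unfolding \<phi>'_def using sections_sum[OF E P(1) s'] d by simp_all
    have val: "F \<phi> = (\<Sum>v\<in>P. d (e v y) * F (e v))" if F: "tensorial_at E y F" for F
    proof -
      have "F \<phi> = F \<phi>'" by (rule tensorial_at_eq[OF E F yM \<phi> \<phi>'])
      also have "\<dots> = (\<Sum>v\<in>P. F (\<lambda>z. d (e v y) *\<^sub>R e v z))"
        unfolding \<phi>'_def by (rule tensorial_at_sum[OF E F P(1) s'])
      also have "\<dots> = (\<Sum>v\<in>P. d (e v y) * F (e v))"
        by (rule sum.cong[OF refl tensorial_at_scale_const[OF E F eh(1)]])
      finally show ?thesis .
    qed
    show ?thesis
      using val[OF pairing_tensorial_right[OF yM \<kappa>]] val[OF \<alpha>(2)[OF yM]] on_frame by simp
  qed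
  then show ?thesis using \<kappa> N by blast
qed

text \<open>By non-degeneracy two local representatives agree wherever both are valid. Hence the
  diagonal choice \<open>K y y\<close> coincides near each point with one of the local sections, and
  is smooth. Unique existence is what the definite descriptions \<open>grad\<close> and
  \<open>K_section\<close> ask for.\<close>

lemma dual_section_exists:
  assumes \<alpha>: "\<And>\<phi>. \<phi> \<in> sections E \<Longrightarrow> \<alpha> \<phi> \<in> smooth_functions (base E)"
    "\<And>y. y \<in> bpoints E \<Longrightarrow> tensorial_at E y (\<lambda>\<phi>. \<alpha> \<phi> y)"
  shows "\<exists>!\<kappa>. \<kappa> \<in> sections E \<and> (\<forall>\<phi>\<in>sections E. \<forall>x\<in>bpoints E. pairing E \<kappa> \<phi> x = \<alpha> \<phi> x)"
proof -
  have "\<forall>x\<in>bpoints E. \<exists>\<kappa>. \<exists>N. \<kappa> \<in> sections E \<and> openin (mtop (base E)) N \<and> x \<in> N \<and>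
      (\<forall>y\<in>N. \<forall>\<phi>\<in>sections E. pairing E \<kappa> \<phi> y = \<alpha> \<phi> y)"
    using dual_section_near[OF _ \<alpha>] by meson
  then obtain K where K: "\<forall>x\<in>bpoints E. \<exists>N. K x \<in> sections E \<and> openin (mtop (base E)) N \<and> x \<in> N \<and>
      (\<forall>y\<in>N. \<forall>\<phi>\<in>sections E. pairing E (K x) \<phi> y = \<alpha> \<phi> y)"
    unfolding bchoice_iff by blast
  define \<kappa> where "\<kappa> y = (if y \<in> bpoints E then K y y else 0)" for y
  have val: "pairing E (K y) \<phi> y = \<alpha> \<phi> y" if "y \<in> bpoints E" "\<phi> \<in> sections E" for y \<phi>
    using K that by blast
  have "\<kappa> \<in> sections E"
  proof (rule sections_local[OF E])
    fix x assume x: "x \<in> bpoints E"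
    then obtain N where N: "K x \<in> sections E" "openin (mtop (base E)) N" "x \<in> N"
      "\<And>y \<phi>. y \<in> N \<Longrightarrow> \<phi> \<in> sections E \<Longrightarrow> pairing E (K x) \<phi> y = \<alpha> \<phi> y"
      using K by meson
    have "K x y = \<kappa> y" if y: "y \<in> N" for y
    proof -
      have yM: "y \<in> bpoints E" using openin_subset[OF N(2)] y by blast
      have "K y \<in> sections E" using K yM by blast
      then have "K x y = K y y"
        by (intro section_eq_at[OF yM N(1)]) (simp_all add: N(4)[OF y] val[OF yM])
      then show ?thesis using yM by (simp add: \<kappa>_def)
    qed
    then show "\<exists>N. openin (mtop (base E)) N \<and> x \<in> N \<and> (\<exists>\<phi>\<in>sections E. \<forall>y\<in>N. \<phi> y = \<kappa> y)"
      using N(1-3) by blast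
  qed (simp add: \<kappa>_def)
  moreover have "pairing E \<kappa> \<phi> x = \<alpha> \<phi> x" if "x \<in> bpoints E" "\<phi> \<in> sections E" for x \<phi>
    using val[OF that] that(1) by (simp add: pairing_def \<kappa>_def)
  moreover have "\<kappa>1 = \<kappa>2" if "\<kappa>1 \<in> sections E" "\<kappa>2 \<in> sections E"
    "\<forall>\<phi>\<in>sections E. \<forall>x\<in>bpoints E. pairing E \<kappa>1 \<phi> x = \<alpha> \<phi> x"
    "\<forall>\<phi>\<in>sections E. \<forall>x\<in>bpoints E. pairing E \<kappa>2 \<phi> x = \<alpha> \<phi> x" for \<kappa>1 \<kappa>2
  proof
    fix x
    show "\<kappa>1 x = \<kappa>2 x"
    proof (cases "x \<in> bpoints E")
      case True
      show ?thesis by (rule section_eq_at[OF True that(1,2)]) (use that(3,4) True in simp)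
    next
      case False
      then show ?thesis using section_outside that(1,2) by metis
    qed
  qed
  ultimately show ?thesis by blast
qed

end

section \<open>Tensoriality of torsion and curvature\<close>

text \<open>Used three times: for each of the two factors and for the product of the first with the
  opposite of the second.\<close>

locale courant_with_connection =
  fixes E :: "('m, 'e::real_inner, 'v::real_vector, 'f::real_inner) anchored_bundle"
    and br nab :: "('m, 'v) section_op"
  assumes courant: "courant_algebroid E br" and connection: "courant_connection E nab"
begin

lemmas courant_axioms = courant[unfolded courant_algebroid_def]
lemmas connection_axioms = connection[unfolded courant_connection_def]

lemma vb: "vector_bundle E" and anc: "is_anchor E" and met: "is_metric E"
  by (rule courant_axioms[THEN conjunct1]
      courant_axioms[THEN conjunct2, THEN conjunct1]
      courant_axioms[THEN conjunct2, THEN conjunct2, THEN conjunct1])+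

lemma bilinear_br: "bilinear_on_sections E br"
  by (rule courant_axioms[THEN conjunct2, THEN conjunct2, THEN conjunct2, THEN conjunct1])

lemma bilinear_nab: "bilinear_on_sections E nab"
  by (rule connection_axioms[THEN conjunct1])

lemmas br_scale_right =
  courant_axioms[THEN conjunct2, THEN conjunct2, THEN conjunct2, THEN conjunct2, THEN conjunct1,
    THEN bspec, THEN bspec, THEN bspec]

lemmas br_jacobi =
  courant_axioms[THEN conjunct2, THEN conjunct2, THEN conjunct2, THEN conjunct2, THEN conjunct2,
    THEN conjunct1, THEN bspec, THEN bspec, THEN bspec]

lemmas br_self =
  courant_axioms[THEN conjunct2, THEN conjunct2, THEN conjunct2, THEN conjunct2, THEN conjunct2,
    THEN conjunct2, THEN conjunct2, THEN bspec, THEN bspec, THEN bspec]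

lemmas nab_scale_left =
  connection_axioms[THEN conjunct2, THEN conjunct1, THEN bspec, THEN bspec, THEN bspec]

lemmas nab_scale_right =
  connection_axioms[THEN conjunct2, THEN conjunct2, THEN conjunct1, THEN bspec, THEN bspec, THEN bspec]

lemma bilinear_closed: "bilinear_on_sections E B \<Longrightarrow> \<psi> \<in> sections E \<Longrightarrow> \<phi> \<in> sections E \<Longrightarrow> B \<psi> \<phi> \<in> sections E"
  by (simp add: bilinear_on_sections_def)

lemma bilinear_add:
  assumes "bilinear_on_sections E B" "\<psi> \<in> sections E" "\<psi>' \<in> sections E" "\<eta> \<in> sections E"
  shows "B (\<lambda>x. \<psi> x + \<psi>' x) \<eta> = (\<lambda>x. B \<psi> \<eta> x + B \<psi>' \<eta> x)"
    "B \<eta> (\<lambda>x. \<psi> x + \<psi>' x) = (\<lambda>x. B \<eta> \<psi> x + B \<eta> \<psi>' x)"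
proof -
  have "B (\<lambda>x. a *\<^sub>R \<psi> x + b *\<^sub>R \<psi>' x) \<eta> = (\<lambda>x. a *\<^sub>R B \<psi> \<eta> x + b *\<^sub>R B \<psi>' \<eta> x) \<and>
      B \<eta> (\<lambda>x. a *\<^sub>R \<psi> x + b *\<^sub>R \<psi>' x) = (\<lambda>x. a *\<^sub>R B \<eta> \<psi> x + b *\<^sub>R B \<eta> \<psi>' x)" for a b
    using assms(1)[unfolded bilinear_on_sections_def, THEN conjunct2, THEN bspec, THEN bspec, THEN bspec,
        OF assms(2-4)] by blast
  from this[of 1 1]
  show "B (\<lambda>x. \<psi> x + \<psi>' x) \<eta> = (\<lambda>x. B \<psi> \<eta> x + B \<psi>' \<eta> x)"
    "B \<eta> (\<lambda>x. \<psi> x + \<psi>' x) = (\<lambda>x. B \<eta> \<psi> x + B \<eta> \<psi>' x)"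
    by simp_all
qed

lemmas br_closed = bilinear_closed[OF bilinear_br]
lemmas nab_closed = bilinear_closed[OF bilinear_nab]
lemmas br_add = bilinear_add[OF bilinear_br]
lemmas nab_add = bilinear_add[OF bilinear_nab]
lemmas smooth_mult = smooth_functions_mult[OF smooth_base[OF vb]]
lemmas smooth_add = smooth_functions_add[OF smooth_base[OF vb]]
lemmas smooth_const = smooth_functions_const[OF smooth_base[OF vb]]
lemmas sec_add = sections_add[OF vb]
lemmas sec_scale = sections_scale[OF vb]
lemmas pair_smooth = pairing_smooth[OF vb met]
lemmas pair_sym = pairing_sym[OF vb met]
lemmas pair_add = pairing_add_left[OF vb met]
lemmas pair_scale = pairing_scale_left[OF vb met]
lemmas pair_diff = pairing_diff_left[OF vb met]

section \<open>Derivatives along the anchor, gradients and the left Leibniz rule\<close>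

lemma lie_smooth: "\<psi> \<in> sections E \<Longrightarrow> f \<in> smooth_functions (base E) \<Longrightarrow> lie E \<psi> f \<in> smooth_functions (base E)"
  by (rule anc[unfolded is_anchor_def, THEN conjunct2, THEN conjunct2, THEN bspec, THEN bspec])

lemma lie_tangent: "\<psi> \<in> sections E \<Longrightarrow> x \<in> bpoints E \<Longrightarrow> tangent_vector (base E) x (anchor E x (\<psi> x))"
  by (rule anc[unfolded is_anchor_def, THEN conjunct1, THEN bspec, THEN bspec, OF _ section_in_fibre])

lemma lie_lincomb:
  assumes "\<psi> \<in> sections E" "x \<in> bpoints E" "f \<in> smooth_functions (base E)" "h \<in> smooth_functions (base E)"
  shows "lie E \<psi> (\<lambda>y. a * f y + b * h y) x = a * lie E \<psi> f x + b * lie E \<psi> h x"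
  unfolding lie_def
  using lie_tangent[OF assms(1,2), unfolded tangent_vector_def, THEN conjunct1, THEN bspec, THEN bspec, OF assms(3,4)]
  by blast

lemma lie_mult:
  assumes "\<psi> \<in> sections E" "x \<in> bpoints E" "f \<in> smooth_functions (base E)" "h \<in> smooth_functions (base E)"
  shows "lie E \<psi> (\<lambda>y. f y * h y) x = lie E \<psi> f x * h x + f x * lie E \<psi> h x"
  unfolding lie_def
  using lie_tangent[OF assms(1,2), unfolded tangent_vector_def, THEN conjunct2, THEN bspec, THEN bspec, OF assms(3,4)]
  by blast

text \<open>
  The values of \<open>f\<close> and \<open>h\<close> off the base do not matter: apply the derivation to the product of \<open>f - h\<close>
  with the indicator function of the base.
\<close>

lemma lie_cong:
  assumes \<psi>: "\<psi> \<in> sections E" "x \<in> bpoints E" and f: "f \<in> smooth_functions (base E)" "h \<in> smooth_functions (base E)"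
    and eq: "\<And>y. y \<in> bpoints E \<Longrightarrow> f y = h y"
  shows "lie E \<psi> f x = lie E \<psi> h x"
proof -
  define d where "d = (\<lambda>y. 1 * f y + (- 1) * h y)"
  define k :: "'m \<Rightarrow> real" where "k y = (if y \<in> bpoints E then 1 else 0)" for y
  have d: "d \<in> smooth_functions (base E)"
    unfolding d_def by (intro smooth_add smooth_mult smooth_const f)
  have k: "k \<in> smooth_functions (base E)"
    unfolding smooth_functions_def mem_Collect_eq
    by (rule smooth_map_on_cong[OF smooth_base[OF vb] openin_topspace _
          smooth_map_on_const[OF smooth_base[OF vb] openin_topspace, where c = 1]]) (simp add: k_def)
  have "(\<lambda>y. d y * k y) = (\<lambda>y. 0 * d y + 0 * d y)" by (auto simp: d_def k_def eq)
  then have "lie E \<psi> d x * k x + d x * lie E \<psi> k x = 0"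
    using lie_mult[OF \<psi> d k] lie_lincomb[OF \<psi> d d, of 0 0] by simp
  then have "lie E \<psi> d x = 0" using eq[OF \<psi>(2)] \<psi>(2) by (simp add: d_def k_def)
  then show ?thesis using lie_lincomb[OF \<psi> f, of 1 "- 1"] by (simp add: d_def)
qed

lemma lie_tensorial:
  assumes "x \<in> bpoints E" "f \<in> smooth_functions (base E)"
  shows "tensorial_at E x (\<lambda>\<psi>. lie E \<psi> f x)"
proof -
  have lin: "anchor E x (a *\<^sub>R u + b *\<^sub>R v) f = a * anchor E x u f + b * anchor E x v f"
    if "u \<in> fibre E x" "v \<in> fibre E x" for u v a b
    using anc[unfolded is_anchor_def, THEN conjunct2, THEN conjunct1, THEN bspec, THEN bspec, THEN bspec,
        OF assms(1) that] assms(2) by blast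
  show ?thesis
    unfolding tensorial_at_def lie_def
  proof (intro conjI ballI)
    fix \<psi> \<phi> assume "\<psi> \<in> sections E" "\<phi> \<in> sections E"
    then show "anchor E x (\<psi> x + \<phi> x) f = anchor E x (\<psi> x) f + anchor E x (\<phi> x) f"
      using lin[of "\<psi> x" "\<phi> x" 1 1] section_in_fibre assms(1) by fastforce
  next
    fix h \<psi> assume "\<psi> \<in> sections E"
    then show "anchor E x (h x *\<^sub>R \<psi> x) f = h x * anchor E x (\<psi> x) f"
      using lin[of "\<psi> x" "\<psi> x" "h x" 0] section_in_fibre assms(1) by fastforce
  qed
qed

text \<open>The metric dual of the differential pulled back along the anchor. It measures the
  failure of skew-symmetry: \<open>br \<psi> \<psi>' + br \<psi>' \<psi>\<close> is the gradient of
  \<open>pairing E \<psi> \<psi>'\<close>.\<close>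

definition grad :: "('m \<Rightarrow> real) \<Rightarrow> 'm \<Rightarrow> 'v" where
  "grad f = (THE \<kappa>. \<kappa> \<in> sections E \<and> (\<forall>\<phi>\<in>sections E. \<forall>x\<in>bpoints E. pairing E \<kappa> \<phi> x = lie E \<phi> f x))"

lemma grad:
  assumes "f \<in> smooth_functions (base E)"
  shows "grad f \<in> sections E"
    "\<phi> \<in> sections E \<Longrightarrow> x \<in> bpoints E \<Longrightarrow> pairing E (grad f) \<phi> x = lie E \<phi> f x"
  using theI'[OF dual_section_exists[OF vb met, of "\<lambda>\<phi>. lie E \<phi> f"]] lie_smooth[OF _ assms]
    lie_tensorial[OF _ assms] unfolding grad_def[symmetric] by blast+

lemma nab_tensorial:
  assumes "x \<in> bpoints E" "\<phi> \<in> sections E" "\<eta> \<in> sections E"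
  shows "tensorial_at E x (\<lambda>\<psi>. pairing E (nab \<psi> \<phi>) \<eta> x)"
  using assms by (simp add: tensorial_at_def nab_add nab_scale_left pair_add pair_scale nab_closed)

lemma K_section:
  assumes "\<psi> \<in> sections E" "\<psi>' \<in> sections E"
  shows "K_section E nab \<psi> \<psi>' \<in> sections E"
    "\<phi> \<in> sections E \<Longrightarrow> x \<in> bpoints E \<Longrightarrow> pairing E (K_section E nab \<psi> \<psi>') \<phi> x = pairing E (nab \<phi> \<psi>) \<psi>' x"
  using theI'[OF dual_section_exists[OF vb met, of "\<lambda>\<phi>. pairing E (nab \<phi> \<psi>) \<psi>'"]]
    pair_smooth[OF nab_closed[OF _ assms(1)] assms(2)] nab_tensorial[OF _ assms]
  unfolding K_section_def[symmetric] by blast+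

text \<open>Polarization of C4, applied to the sum of the two sections. It allows the arguments of a
  bracket to be exchanged.\<close>

lemma br_symmetric_part:
  assumes \<psi>: "\<psi> \<in> sections E" and \<psi>': "\<psi>' \<in> sections E" and \<eta>: "\<eta> \<in> sections E" and x: "x \<in> bpoints E"
  shows "pairing E (br \<psi> \<psi>') \<eta> x + pairing E (br \<psi>' \<psi>) \<eta> x = lie E \<eta> (pairing E \<psi> \<psi>') x"
proof -
  let ?s = "\<lambda>y. \<psi> y + \<psi>' y"
  note s = sec_add[OF \<psi> \<psi>']
  \<comment> \<open>The coefficients 1 are spelled out so that \<open>lie_lincomb\<close> matches.
    The expansion holds on the base only, which is why \<open>lie_cong\<close> is called
    below.\<close>
  let ?q = "\<lambda>y. 1 * pairing E \<psi> \<psi> y + 1 * pairing E \<psi>' \<psi>' y"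
  let ?f = "\<lambda>y. 1 * ?q y + 2 * pairing E \<psi> \<psi>' y"
  have q: "?q \<in> smooth_functions (base E)"
    by (intro smooth_add smooth_mult smooth_const pair_smooth \<psi> \<psi>')
  have f: "?f \<in> smooth_functions (base E)"
    by (intro smooth_add[of ?q, simplified] smooth_add smooth_mult smooth_const pair_smooth \<psi> \<psi>')
  have eq: "pairing E ?s ?s y = ?f y" if y: "y \<in> bpoints E" for y
    using pair_add[OF y \<psi> \<psi>' s] pair_add[OF y \<psi> \<psi>' \<psi>] pair_add[OF y \<psi> \<psi>' \<psi>']
      pair_sym[OF y \<psi> s] pair_sym[OF y \<psi>' s] pair_sym[OF y \<psi> \<psi>'] by simp
  have "pairing E (br ?s ?s) \<eta> x = 1 / 2 * lie E \<eta> (pairing E ?s ?s) x"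
    by (rule br_self[OF s \<eta> x])
  also have "lie E \<eta> (pairing E ?s ?s) x = lie E \<eta> ?f x"
    by (rule lie_cong[OF \<eta> x pair_smooth[OF s s] f eq])
  also have "\<dots> = lie E \<eta> (pairing E \<psi> \<psi>) x + lie E \<eta> (pairing E \<psi>' \<psi>') x + 2 * lie E \<eta> (pairing E \<psi> \<psi>') x"
    using lie_lincomb[OF \<eta> x q pair_smooth[OF \<psi> \<psi>'], of 1 2]
      lie_lincomb[OF \<eta> x pair_smooth[OF \<psi> \<psi>] pair_smooth[OF \<psi>' \<psi>'], of 1 1] by simp
  also have "pairing E (br ?s ?s) \<eta> x = pairing E (br \<psi> \<psi>) \<eta> x + pairing E (br \<psi> \<psi>') \<eta> x +
      (pairing E (br \<psi>' \<psi>) \<eta> x + pairing E (br \<psi>' \<psi>') \<eta> x)"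
    by (simp add: br_add \<psi> \<psi>' s \<eta> x pair_add br_closed sec_add)
  finally show ?thesis
    using br_self[OF \<psi> \<eta> x] br_self[OF \<psi>' \<eta> x] by simp
qed

text \<open>C1 treats the right argument only. Exchange the arguments, apply C1, and exchange back:
  the new term with \<open>lie E \<eta> f\<close> comes from differentiating \<open>f\<close> times
  the pairing of \<psi> and \<psi>'.\<close>

lemma br_scale_left_pairing:
  assumes \<psi>: "\<psi> \<in> sections E" and \<psi>': "\<psi>' \<in> sections E" and \<eta>: "\<eta> \<in> sections E" and x: "x \<in> bpoints E"
    and f: "f \<in> smooth_functions (base E)"
  shows "pairing E (br (\<lambda>y. f y *\<^sub>R \<psi> y) \<psi>') \<eta> x =
    f x * pairing E (br \<psi> \<psi>') \<eta> x + pairing E \<psi> \<psi>' x * lie E \<eta> f x - lie E \<psi>' f x * pairing E \<psi> \<eta> x"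
proof -
  let ?s = "\<lambda>y. f y *\<^sub>R \<psi> y"
  note s = sec_scale[OF f \<psi>]
  have "lie E \<eta> (pairing E ?s \<psi>') x = lie E \<eta> (\<lambda>y. f y * pairing E \<psi> \<psi>' y) x"
    by (rule lie_cong[OF \<eta> x pair_smooth[OF s \<psi>'] smooth_mult[OF f pair_smooth[OF \<psi> \<psi>']] pair_scale[OF _ \<psi> \<psi>']])
  moreover have "pairing E (br \<psi>' ?s) \<eta> x = f x * pairing E (br \<psi>' \<psi>) \<eta> x + lie E \<psi>' f x * pairing E \<psi> \<eta> x"
    unfolding br_scale_right[OF \<psi>' \<psi> f]
    using pair_add[OF x sec_scale[OF f br_closed[OF \<psi>' \<psi>]] sec_scale[OF lie_smooth[OF \<psi>' f] \<psi>] \<eta>]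
      pair_scale[OF x br_closed[OF \<psi>' \<psi>] \<eta>, of f] pair_scale[OF x \<psi> \<eta>, of "lie E \<psi>' f"] by simp
  moreover have "f x * lie E \<eta> (pairing E \<psi> \<psi>') x = f x * pairing E (br \<psi> \<psi>') \<eta> x + f x * pairing E (br \<psi>' \<psi>) \<eta> x"
    by (simp add: br_symmetric_part[OF \<psi> \<psi>' \<eta> x, symmetric] distrib_left)
  ultimately show ?thesis
    using br_symmetric_part[OF s \<psi>' \<eta> x] lie_mult[OF \<eta> x f pair_smooth[OF \<psi> \<psi>']]
    by (simp add: mult.commute)
qed

text \<open>The same rule as an identity of sections, obtained by non-degeneracy. This form can be
  substituted into the direction slot of the connection.\<close>

lemma br_scale_left:
  assumes \<psi>: "\<psi> \<in> sections E" and \<psi>': "\<psi>' \<in> sections E" and f: "f \<in> smooth_functions (base E)"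
  shows "br (\<lambda>y. f y *\<^sub>R \<psi> y) \<psi>' =
    (\<lambda>y. (f y *\<^sub>R br \<psi> \<psi>' y + pairing E \<psi> \<psi>' y *\<^sub>R grad f y) + (- 1 * lie E \<psi>' f y) *\<^sub>R \<psi> y)"
    (is "?l = (\<lambda>y. ?a y + ?b y + ?c y)")
proof
  fix x
  have l: "?l \<in> sections E" by (rule br_closed[OF sec_scale[OF f \<psi>] \<psi>'])
  note lf = smooth_mult[OF smooth_const[of "- 1"] lie_smooth[OF \<psi>' f]]
  have abc: "?a \<in> sections E" "?b \<in> sections E" "?c \<in> sections E"
    by (intro sec_scale f br_closed \<psi> \<psi>' pair_smooth grad lf)+
  note ab = sec_add[OF abc(1,2)]
  note r = sec_add[OF ab abc(3)]
  show "?l x = ?a x + ?b x + ?c x"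
  proof (cases "x \<in> bpoints E")
    case True
    show ?thesis
    proof (rule section_eq_at[OF vb met True l r])
      fix \<eta> assume \<eta>: "\<eta> \<in> sections E"
      show "pairing E ?l \<eta> x = pairing E (\<lambda>y. ?a y + ?b y + ?c y) \<eta> x"
        using br_scale_left_pairing[OF \<psi> \<psi>' \<eta> True f] pair_add[OF True ab abc(3) \<eta>] pair_add[OF True abc(1,2) \<eta>]
          pair_scale[OF True br_closed[OF \<psi> \<psi>'] \<eta>, of f] pair_scale[OF True grad(1)[OF f] \<eta>, of "pairing E \<psi> \<psi>'"]
          pair_scale[OF True \<psi> \<eta>, of "\<lambda>y. - 1 * lie E \<psi>' f y"] grad(2)[OF f \<eta> True]
        by simp
    qed
  next
    case False
    then show ?thesis using section_outside[OF l] section_outside[OF r] by simp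
  qed
qed

text \<open>The anchor is a homomorphism of brackets, up to the factor \<open>\<phi>\<close>, which takes care of zero fibres.\<close>

lemma lie_br:
  assumes \<psi>: "\<psi> \<in> sections E" and \<psi>': "\<psi>' \<in> sections E" and \<phi>: "\<phi> \<in> sections E"
    and f: "f \<in> smooth_functions (base E)"
  shows "(lie E \<psi> (lie E \<psi>' f) x - lie E \<psi>' (lie E \<psi> f) x - lie E (br \<psi> \<psi>') f x) *\<^sub>R \<phi> x = 0"
proof -
  \<comment> \<open>Jacobi for \<open>f \<phi>\<close> is compared with \<open>f\<close> times
    Jacobi for \<phi>. The mixed first-order terms cancel, and what remains is the commutator defect
    times \<phi>.\<close>
  have two: "br \<psi> (br \<psi>' (\<lambda>y. f y *\<^sub>R \<phi> y)) = (\<lambda>y. (f y *\<^sub>R br \<psi> (br \<psi>' \<phi>) y + lie E \<psi> f y *\<^sub>R br \<psi>' \<phi> y) +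
      (lie E \<psi>' f y *\<^sub>R br \<psi> \<phi> y + lie E \<psi> (lie E \<psi>' f) y *\<^sub>R \<phi> y))"
    if \<psi>: "\<psi> \<in> sections E" and \<psi>': "\<psi>' \<in> sections E" for \<psi> \<psi>'
    unfolding br_scale_right[OF \<psi>' \<phi> f]
      br_add(2)[OF sec_scale[OF f br_closed[OF \<psi>' \<phi>]] sec_scale[OF lie_smooth[OF \<psi>' f] \<phi>] \<psi>]
      br_scale_right[OF \<psi> br_closed[OF \<psi>' \<phi>] f] br_scale_right[OF \<psi> \<phi> lie_smooth[OF \<psi>' f]] ..
  note j = fun_cong[OF br_jacobi[OF \<psi> \<psi>' sec_scale[OF f \<phi>]], of x]
  note j0 = fun_cong[OF br_jacobi[OF \<psi> \<psi>' \<phi>], of x]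
  show ?thesis
    using j unfolding two[OF \<psi> \<psi>'] two[OF \<psi>' \<psi>] br_scale_right[OF br_closed[OF \<psi> \<psi>'] \<phi> f] j0
    by (simp add: algebra_simps)
qed

end

section \<open>Tensoriality of the generalized Riemann tensor\<close>

context courant_with_connection
begin

lemmas nab_scale_pair = nab_tensorial[THEN tensorial_at_scale]
lemmas nab_add_pair = nab_tensorial[THEN tensorial_at_add]

lemma riemann0_expand:
  assumes "x \<in> bpoints E" "\<phi>' \<in> sections E" "\<phi> \<in> sections E" "\<psi> \<in> sections E" "\<psi>' \<in> sections E"
  shows "riemann0 E br nab \<phi>' \<phi> \<psi> \<psi>' x = pairing E (nab \<psi> (nab \<psi>' \<phi>)) \<phi>' x -
    pairing E (nab \<psi>' (nab \<psi> \<phi>)) \<phi>' x - pairing E (nab (br \<psi> \<psi>') \<phi>) \<phi>' x"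
  using assms by (simp add: riemann0_def pair_diff sections_diff[OF vb] nab_closed br_closed)

lemma nab_nab_scale_right:
  assumes "\<psi> \<in> sections E" "\<psi>' \<in> sections E" "\<phi> \<in> sections E" and f: "f \<in> smooth_functions (base E)"
    and x: "x \<in> bpoints E" and \<eta>: "\<eta> \<in> sections E"
  shows "pairing E (nab \<psi> (nab \<psi>' (\<lambda>y. f y *\<^sub>R \<phi> y))) \<eta> x =
    f x * pairing E (nab \<psi> (nab \<psi>' \<phi>)) \<eta> x + lie E \<psi> f x * pairing E (nab \<psi>' \<phi>) \<eta> x +
    (lie E \<psi>' f x * pairing E (nab \<psi> \<phi>) \<eta> x + lie E \<psi> (lie E \<psi>' f) x * pairing E \<phi> \<eta> x)"
proof -
  note l = lie_smooth[OF assms(2) f]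
  note c = nab_closed[OF assms(2,3)]
  show ?thesis
    unfolding nab_scale_right[OF assms(2,3) f] nab_add(2)[OF sec_scale[OF f c] sec_scale[OF l assms(3)] assms(1)]
      nab_scale_right[OF assms(1) c f] nab_scale_right[OF assms(1,3) l]
    using assms l lie_smooth[OF assms(1) l] lie_smooth[OF assms(1) f] c
    by (simp add: pair_add pair_scale sec_add sec_scale nab_closed)
qed

lemma nab_scale_right_pair:
  assumes "\<psi> \<in> sections E" "\<phi> \<in> sections E" and f: "f \<in> smooth_functions (base E)"
    and x: "x \<in> bpoints E" and \<eta>: "\<eta> \<in> sections E"
  shows "pairing E (nab \<psi> (\<lambda>y. f y *\<^sub>R \<phi> y)) \<eta> x = f x * pairing E (nab \<psi> \<phi>) \<eta> x + lie E \<psi> f x * pairing E \<phi> \<eta> x"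
  unfolding nab_scale_right[OF assms(1-3)]
  using assms lie_smooth[OF assms(1) f] by (simp add: pair_add pair_scale sec_scale nab_closed)

lemma riemann0_tensorial_1:
  assumes "x \<in> bpoints E" "\<phi> \<in> sections E" "\<psi> \<in> sections E" "\<psi>' \<in> sections E"
  shows "tensorial_at E x (\<lambda>\<phi>'. riemann0 E br nab \<phi>' \<phi> \<psi> \<psi>' x)"
  unfolding riemann0_def
  by (intro pairing_tensorial_right[OF vb met] sections_diff[OF vb] nab_closed br_closed assms)

text \<open>The mixed first-order terms are symmetric under exchange of \<psi> and \<psi>' and
  cancel. The second-order terms form the defect in \<open>lie_br\<close>, multiplied by the pairing
  of \<phi> and \<phi>'.\<close>

lemma riemann0_tensorial_2:
  assumes x: "x \<in> bpoints E" and \<phi>': "\<phi>' \<in> sections E" and \<psi>: "\<psi> \<in> sections E" and \<psi>': "\<psi>' \<in> sections E"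
  shows "tensorial_at E x (\<lambda>\<phi>. riemann0 E br nab \<phi>' \<phi> \<psi> \<psi>' x)"
  unfolding tensorial_at_def
proof (intro conjI ballI)
  fix \<phi> \<eta> assume h: "\<phi> \<in> sections E" "\<eta> \<in> sections E"
  show "riemann0 E br nab \<phi>' (\<lambda>y. \<phi> y + \<eta> y) \<psi> \<psi>' x = riemann0 E br nab \<phi>' \<phi> \<psi> \<psi>' x + riemann0 E br nab \<phi>' \<eta> \<psi> \<psi>' x"
    using assms h by (simp add: riemann0_expand sec_add nab_add pair_add nab_closed br_closed)
next
  fix f \<phi> assume f: "f \<in> smooth_functions (base E)" and \<phi>: "\<phi> \<in> sections E"
  have "(lie E \<psi> (lie E \<psi>' f) x - lie E \<psi>' (lie E \<psi> f) x - lie E (br \<psi> \<psi>') f x) * pairing E \<phi> \<phi>' x = 0"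
  proof -
    \<comment> \<open>\<open>lie_br\<close> leaves two cases: the scalar vanishes, or \<phi>
      vanishes at \<open>x\<close>. This fact settles the second.\<close>
    have "pairing E (\<lambda>y. 0 *\<^sub>R \<phi> y) \<phi>' x = 0" using pair_scale[OF x \<phi> \<phi>', of "\<lambda>y. 0"] by simp
    then show ?thesis using lie_br[OF \<psi> \<psi>' \<phi> f, of x] by (auto simp: pairing_def)
  qed
  then show "riemann0 E br nab \<phi>' (\<lambda>y. f y *\<^sub>R \<phi> y) \<psi> \<psi>' x = f x * riemann0 E br nab \<phi>' \<phi> \<psi> \<psi>' x"
    using x \<phi>' \<psi> \<psi>' f \<phi>
    by (simp add: riemann0_expand sec_scale nab_nab_scale_right nab_scale_right_pair br_closed algebra_simps)
qed

lemma riemann0_add_3: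
  assumes "x \<in> bpoints E" "\<phi>' \<in> sections E" "\<phi> \<in> sections E" "\<psi> \<in> sections E" "\<eta> \<in> sections E" "\<psi>' \<in> sections E"
  shows "riemann0 E br nab \<phi>' \<phi> (\<lambda>y. \<psi> y + \<eta> y) \<psi>' x = riemann0 E br nab \<phi>' \<phi> \<psi> \<psi>' x + riemann0 E br nab \<phi>' \<phi> \<eta> \<psi>' x"
  using assms by (simp add: riemann0_expand sec_add nab_add br_add pair_add nab_closed br_closed)

text \<open>The terms with \<open>lie E \<psi>' f\<close> from the connection and from the bracket
  cancel; the gradient term of \<open>br_scale_left\<close> survives as the defect that
  \<open>K\<close> has to compensate.\<close>

lemma riemann0_scale_3:
  assumes x: "x \<in> bpoints E" and \<phi>': "\<phi>' \<in> sections E" and \<phi>: "\<phi> \<in> sections E"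
    and \<psi>: "\<psi> \<in> sections E" and \<psi>': "\<psi>' \<in> sections E" and f: "f \<in> smooth_functions (base E)"
  shows "riemann0 E br nab \<phi>' \<phi> (\<lambda>y. f y *\<^sub>R \<psi> y) \<psi>' x =
    f x * riemann0 E br nab \<phi>' \<phi> \<psi> \<psi>' x - pairing E \<psi> \<psi>' x * pairing E (nab (grad f) \<phi>) \<phi>' x"
proof -
  note lf = smooth_mult[OF smooth_const[of "- 1"] lie_smooth[OF \<psi>' f]]
  have abc: "(\<lambda>y. f y *\<^sub>R br \<psi> \<psi>' y) \<in> sections E" "(\<lambda>y. pairing E \<psi> \<psi>' y *\<^sub>R grad f y) \<in> sections E"
    "(\<lambda>y. (- 1 * lie E \<psi>' f y) *\<^sub>R \<psi> y) \<in> sections E"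
    by (intro sec_scale f br_closed \<psi> \<psi>' pair_smooth grad lf)+
  have 1: "pairing E (nab (br (\<lambda>y. f y *\<^sub>R \<psi> y) \<psi>') \<phi>) \<phi>' x = f x * pairing E (nab (br \<psi> \<psi>') \<phi>) \<phi>' x +
      pairing E \<psi> \<psi>' x * pairing E (nab (grad f) \<phi>) \<phi>' x + (- 1 * lie E \<psi>' f x) * pairing E (nab \<psi> \<phi>) \<phi>' x"
    unfolding br_scale_left[OF \<psi> \<psi>' f]
    using nab_add_pair[OF x \<phi> \<phi>' sec_add[OF abc(1,2)] abc(3)] nab_add_pair[OF x \<phi> \<phi>' abc(1,2)]
      nab_scale_pair[OF x \<phi> \<phi>' f br_closed[OF \<psi> \<psi>']]
      nab_scale_pair[OF x \<phi> \<phi>' pair_smooth[OF \<psi> \<psi>'] grad(1)[OF f]]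
      nab_scale_pair[OF x \<phi> \<phi>' lf \<psi>] by simp
  have 2: "pairing E (nab (\<lambda>y. f y *\<^sub>R \<psi> y) (nab \<psi>' \<phi>)) \<phi>' x = f x * pairing E (nab \<psi> (nab \<psi>' \<phi>)) \<phi>' x"
    by (rule nab_scale_pair[OF x nab_closed[OF \<psi>' \<phi>] \<phi>' f \<psi>])
  have 3: "pairing E (nab \<psi>' (nab (\<lambda>y. f y *\<^sub>R \<psi> y) \<phi>)) \<phi>' x =
      f x * pairing E (nab \<psi>' (nab \<psi> \<phi>)) \<phi>' x + lie E \<psi>' f x * pairing E (nab \<psi> \<phi>) \<phi>' x"
    unfolding nab_scale_left[OF \<psi> \<phi> f]
    by (rule nab_scale_right_pair[OF \<psi>' nab_closed[OF \<psi> \<phi>] f x \<phi>'])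
  show ?thesis
    unfolding riemann0_expand[OF x \<phi>' \<phi> sec_scale[OF f \<psi>] \<psi>'] riemann0_expand[OF x \<phi>' \<phi> \<psi> \<psi>'] 1 2 3
    by (simp add: algebra_simps)
qed

text \<open>Unlike the third slot, this one meets only C1, whose derivative term cancels against the
  one from the connection.\<close>

lemma riemann0_tensorial_4:
  assumes x: "x \<in> bpoints E" and \<phi>': "\<phi>' \<in> sections E" and \<phi>: "\<phi> \<in> sections E" and \<psi>: "\<psi> \<in> sections E"
  shows "tensorial_at E x (\<lambda>\<psi>'. riemann0 E br nab \<phi>' \<phi> \<psi> \<psi>' x)"
  unfolding tensorial_at_def
proof (intro conjI ballI)
  fix \<psi>' \<eta> assume "\<psi>' \<in> sections E" "\<eta> \<in> sections E"
  then show "riemann0 E br nab \<phi>' \<phi> \<psi> (\<lambda>y. \<psi>' y + \<eta> y) x = riemann0 E br nab \<phi>' \<phi> \<psi> \<psi>' x + riemann0 E br nab \<phi>' \<phi> \<psi> \<eta> x"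
    using assms by (simp add: riemann0_expand sec_add nab_add br_add pair_add nab_closed br_closed)
next
  fix f \<psi>' assume f: "f \<in> smooth_functions (base E)" and \<psi>': "\<psi>' \<in> sections E"
  have b: "pairing E (nab (br \<psi> (\<lambda>y. f y *\<^sub>R \<psi>' y)) \<phi>) \<phi>' x =
      f x * pairing E (nab (br \<psi> \<psi>') \<phi>) \<phi>' x + lie E \<psi> f x * pairing E (nab \<psi>' \<phi>) \<phi>' x"
    unfolding br_scale_right[OF \<psi> \<psi>' f]
    using nab_add_pair[OF x \<phi> \<phi>' sec_scale[OF f br_closed[OF \<psi> \<psi>']] sec_scale[OF lie_smooth[OF \<psi> f] \<psi>']]
      nab_scale_pair[OF x \<phi> \<phi>' f br_closed[OF \<psi> \<psi>']] nab_scale_pair[OF x \<phi> \<phi>' lie_smooth[OF \<psi> f] \<psi>'] by simp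
  have c: "pairing E (nab \<psi> (nab (\<lambda>y. f y *\<^sub>R \<psi>' y) \<phi>)) \<phi>' x =
      f x * pairing E (nab \<psi> (nab \<psi>' \<phi>)) \<phi>' x + lie E \<psi> f x * pairing E (nab \<psi>' \<phi>) \<phi>' x"
    unfolding nab_scale_left[OF \<psi>' \<phi> f] by (rule nab_scale_right_pair[OF \<psi> nab_closed[OF \<psi>' \<phi>] f x \<phi>'])
  show "riemann0 E br nab \<phi>' \<phi> \<psi> (\<lambda>y. f y *\<^sub>R \<psi>' y) x = f x * riemann0 E br nab \<phi>' \<phi> \<psi> \<psi>' x"
    unfolding riemann0_expand[OF x \<phi>' \<phi> \<psi> sec_scale[OF f \<psi>']] riemann0_expand[OF x \<phi>' \<phi> \<psi> \<psi>'] b c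
      nab_scale_pair[OF x nab_closed[OF \<psi> \<phi>] \<phi>' f \<psi>']
    by (simp add: algebra_simps)
qed

text \<open>Moving one \<open>K\<close> into the direction slot makes the dependence on \<psi> and
  \<psi>' explicit, so that the rules for the connection apply to the third term.\<close>

lemma riemann_K:
  assumes "x \<in> bpoints E" "\<phi>' \<in> sections E" "\<phi> \<in> sections E" "\<psi> \<in> sections E" "\<psi>' \<in> sections E"
  shows "riemann E br nab \<phi>' \<phi> \<psi> \<psi>' x = 1 / 2 * (riemann0 E br nab \<phi>' \<phi> \<psi> \<psi>' x +
    riemann0 E br nab \<psi>' \<psi> \<phi> \<phi>' x + pairing E (nab (K_section E nab \<phi> \<phi>') \<psi>) \<psi>' x)"
  unfolding riemann_def
  using pair_sym[OF assms(1) K_section(1)[OF assms(3,2)] K_section(1)[OF assms(4,5)]]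
    K_section(2)[OF assms(4,5) K_section(1)[OF assms(3,2)] assms(1)] by simp

text \<open>Exchanges slot 1 with 4 and slot 2 with 3, so that tensoriality has to be checked in the
  last two slots only.\<close>

lemma riemann_pair_symmetry:
  assumes "x \<in> bpoints E" "\<phi>' \<in> sections E" "\<phi> \<in> sections E" "\<psi> \<in> sections E" "\<psi>' \<in> sections E"
  shows "riemann E br nab \<phi>' \<phi> \<psi> \<psi>' x = riemann E br nab \<psi>' \<psi> \<phi> \<phi>' x"
  unfolding riemann_def
  using pair_sym[OF assms(1) K_section(1)[OF assms(3,2)] K_section(1)[OF assms(4,5)]] by simp

lemma riemann_tensorial_4:
  assumes x: "x \<in> bpoints E" and \<phi>': "\<phi>' \<in> sections E" and \<phi>: "\<phi> \<in> sections E" and \<psi>: "\<psi> \<in> sections E"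
  shows "tensorial_at E x (\<lambda>\<psi>'. riemann E br nab \<phi>' \<phi> \<psi> \<psi>' x)"
proof -
  note t = riemann0_tensorial_4[OF assms] riemann0_tensorial_1[OF x \<psi> \<phi> \<phi>']
    pairing_tensorial_right[OF vb met x nab_closed[OF K_section(1)[OF \<phi> \<phi>'] \<psi>]]
  show ?thesis
    unfolding tensorial_at_def
  proof (intro conjI ballI)
    fix \<psi>' \<eta> assume h: "\<psi>' \<in> sections E" "\<eta> \<in> sections E"
    show "riemann E br nab \<phi>' \<phi> \<psi> (\<lambda>y. \<psi>' y + \<eta> y) x = riemann E br nab \<phi>' \<phi> \<psi> \<psi>' x + riemann E br nab \<phi>' \<phi> \<psi> \<eta> x"
      using t[THEN tensorial_at_add, OF h] sec_add[OF h] h assms by (simp add: riemann_K add_divide_distrib)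
  next
    fix f \<psi>' assume h: "f \<in> smooth_functions (base E)" "\<psi>' \<in> sections E"
    show "riemann E br nab \<phi>' \<phi> \<psi> (\<lambda>y. f y *\<^sub>R \<psi>' y) x = f x * riemann E br nab \<phi>' \<phi> \<psi> \<psi>' x"
      using t[THEN tensorial_at_scale, OF h] sec_scale[OF h] h assms by (simp add: riemann_K algebra_simps add_divide_distrib)
  qed
qed

text \<open>
  The term of the Leibniz rule for \<open>[f \<psi>, \<psi>']\<close> involving the gradient of \<open>f\<close> is cancelled by the
  one that \<open>K (f \<psi>) \<psi>'\<close> contributes.
\<close>

lemma riemann_tensorial_3:
  assumes x: "x \<in> bpoints E" and \<phi>': "\<phi>' \<in> sections E" and \<phi>: "\<phi> \<in> sections E" and \<psi>': "\<psi>' \<in> sections E"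
  shows "tensorial_at E x (\<lambda>\<psi>. riemann E br nab \<phi>' \<phi> \<psi> \<psi>' x)"
  unfolding tensorial_at_def
proof (intro conjI ballI)
  note K = K_section(1)[OF \<phi> \<phi>']
  note t = riemann0_tensorial_2[OF x \<psi>' \<phi> \<phi>']
  {
    fix \<psi> \<eta> assume h: "\<psi> \<in> sections E" "\<eta> \<in> sections E"
    show "riemann E br nab \<phi>' \<phi> (\<lambda>y. \<psi> y + \<eta> y) \<psi>' x = riemann E br nab \<phi>' \<phi> \<psi> \<psi>' x + riemann E br nab \<phi>' \<phi> \<eta> \<psi>' x"
      using tensorial_at_add[OF t h] riemann0_add_3[OF x \<phi>' \<phi> h \<psi>'] sec_add[OF h] h assms K
      by (simp add: riemann_K nab_add pair_add nab_closed add_divide_distrib)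
  next
    fix f \<psi> assume f: "f \<in> smooth_functions (base E)" and \<psi>: "\<psi> \<in> sections E"
    \<comment> \<open>This identifies the two defects. The gradient term becomes a derivative of
      \<open>f\<close> along \<open>K\<close>, the same one that the Leibniz rule for
      \<open>nab (K_section E nab \<phi> \<phi>')\<close> applied to \<open>f \<psi>\<close>
      contributes with opposite sign.\<close>
    have "pairing E (nab (grad f) \<phi>) \<phi>' x = lie E (K_section E nab \<phi> \<phi>') f x"
      using K_section(2)[OF \<phi> \<phi>' grad(1)[OF f] x] pair_sym[OF x K grad(1)[OF f]] grad(2)[OF f K x] by simp
    then show "riemann E br nab \<phi>' \<phi> (\<lambda>y. f y *\<^sub>R \<psi> y) \<psi>' x = f x * riemann E br nab \<phi>' \<phi> \<psi> \<psi>' x"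
      using tensorial_at_scale[OF t f \<psi>] riemann0_scale_3[OF x \<phi>' \<phi> \<psi> \<psi>' f] sec_scale[OF f \<psi>] \<psi> assms
        nab_scale_right_pair[OF K \<psi> f x \<psi>']
      by (simp add: riemann_K algebra_simps add_divide_distrib)
  }
qed

lemma riemann_eq_at:
  assumes x: "x \<in> bpoints E" and
    a: "a \<in> sections E" "b \<in> sections E" "c \<in> sections E" "d \<in> sections E" and
    a': "a' \<in> sections E" "b' \<in> sections E" "c' \<in> sections E" "d' \<in> sections E" and
    eq: "a x = a' x" "b x = b' x" "c x = c' x" "d x = d' x"
  shows "riemann E br nab a b c d x = riemann E br nab a' b' c' d' x"
proof -
  have "riemann E br nab a b c d x = riemann E br nab a b c d' x"
    by (rule tensorial_at_eq[OF vb riemann_tensorial_4[OF x a(1-3)] x a(4) a'(4) eq(4)])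
  also have "\<dots> = riemann E br nab a b c' d' x"
    by (rule tensorial_at_eq[OF vb riemann_tensorial_3[OF x a(1,2) a'(4)] x a(3) a'(3) eq(3)])
  also have "\<dots> = riemann E br nab d' c' b a x"
    by (rule riemann_pair_symmetry[OF x a(1,2) a'(3,4)])
  also have "\<dots> = riemann E br nab d' c' b a' x"
    by (rule tensorial_at_eq[OF vb riemann_tensorial_4[OF x a'(4,3) a(2)] x a(1) a'(1) eq(1)])
  also have "\<dots> = riemann E br nab d' c' b' a' x"
    by (rule tensorial_at_eq[OF vb riemann_tensorial_3[OF x a'(4,3,1)] x a(2) a'(2) eq(2)])
  also have "\<dots> = riemann E br nab a' b' c' d' x"
    by (rule riemann_pair_symmetry[OF x a'(4,3,2,1)])
  finally show ?thesis .
qed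

section \<open>Tensoriality of the torsion, and vanishing of the curvature on isotropic
  sections\<close>

lemma torsion_expand:
  assumes "x \<in> bpoints E" "\<psi> \<in> sections E" "\<psi>' \<in> sections E" "\<eta> \<in> sections E"
  shows "torsion E br nab \<psi> \<psi>' \<eta> x = pairing E (nab \<psi> \<psi>') \<eta> x - pairing E (nab \<psi>' \<psi>) \<eta> x -
    pairing E (br \<psi> \<psi>') \<eta> x + pairing E (nab \<eta> \<psi>) \<psi>' x"
  using assms by (simp add: torsion_def pair_diff sections_diff[OF vb] nab_closed br_closed)

text \<open>The last term of the torsion compensates the gradient part of the bracket:
  \<open>nab \<eta> (f \<psi>)\<close> paired with \<psi>' supplies exactly the
  \<open>lie E \<eta> f\<close> that the bracket subtracts.\<close>

lemma torsion_eq_at: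
  assumes x: "x \<in> bpoints E" and
    a: "a \<in> sections E" "b \<in> sections E" "c \<in> sections E" and
    a': "a' \<in> sections E" "b' \<in> sections E" "c' \<in> sections E" and
    eq: "a x = a' x" "b x = b' x" "c x = c' x"
  shows "torsion E br nab a b c x = torsion E br nab a' b' c' x"
proof -
  have t1: "tensorial_at E x (\<lambda>\<psi>. torsion E br nab \<psi> \<psi>' \<eta> x)" if h: "\<psi>' \<in> sections E" "\<eta> \<in> sections E" for \<psi>' \<eta>
    unfolding tensorial_at_def
  proof (intro conjI ballI)
    fix \<psi> \<phi> assume "\<psi> \<in> sections E" "\<phi> \<in> sections E"
    then show "torsion E br nab (\<lambda>y. \<psi> y + \<phi> y) \<psi>' \<eta> x = torsion E br nab \<psi> \<psi>' \<eta> x + torsion E br nab \<phi> \<psi>' \<eta> x"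
      using h x by (simp add: torsion_expand sec_add nab_add br_add pair_add nab_closed br_closed)
  next
    fix f \<psi> assume f: "f \<in> smooth_functions (base E)" and \<psi>: "\<psi> \<in> sections E"
    then show "torsion E br nab (\<lambda>y. f y *\<^sub>R \<psi> y) \<psi>' \<eta> x = f x * torsion E br nab \<psi> \<psi>' \<eta> x"
      using h x by (simp add: torsion_expand sec_scale nab_scale_pair nab_scale_right_pair
          br_scale_left_pairing algebra_simps)
  qed
  have t2: "tensorial_at E x (\<lambda>\<psi>'. torsion E br nab \<psi> \<psi>' \<eta> x)" if h: "\<psi> \<in> sections E" "\<eta> \<in> sections E" for \<psi> \<eta>
    unfolding tensorial_at_def
  proof (intro conjI ballI)
    note r = pairing_tensorial_right[OF vb met x nab_closed[OF h(2,1)]]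
    {
      fix \<psi>' \<phi> assume g: "\<psi>' \<in> sections E" "\<phi> \<in> sections E"
      then show "torsion E br nab \<psi> (\<lambda>y. \<psi>' y + \<phi> y) \<eta> x = torsion E br nab \<psi> \<psi>' \<eta> x + torsion E br nab \<psi> \<phi> \<eta> x"
        using h x tensorial_at_add[OF r g]
        by (simp add: torsion_expand sec_add nab_add br_add pair_add nab_closed br_closed)
    next
      fix f \<psi>' assume f: "f \<in> smooth_functions (base E)" and \<psi>': "\<psi>' \<in> sections E"
      have "pairing E (br \<psi> (\<lambda>y. f y *\<^sub>R \<psi>' y)) \<eta> x = f x * pairing E (br \<psi> \<psi>') \<eta> x + lie E \<psi> f x * pairing E \<psi>' \<eta> x"
        unfolding br_scale_right[OF h(1) \<psi>' f]
        using h \<psi>' f x lie_smooth[OF h(1) f] by (simp add: pair_add pair_scale sec_scale br_closed)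
      then show "torsion E br nab \<psi> (\<lambda>y. f y *\<^sub>R \<psi>' y) \<eta> x = f x * torsion E br nab \<psi> \<psi>' \<eta> x"
        using h x f \<psi>' tensorial_at_scale[OF r f \<psi>']
        by (simp add: torsion_expand sec_scale nab_scale_pair nab_scale_right_pair algebra_simps)
    }
  qed
  have t3: "tensorial_at E x (\<lambda>\<eta>. torsion E br nab \<psi> \<psi>' \<eta> x)" if h: "\<psi> \<in> sections E" "\<psi>' \<in> sections E" for \<psi> \<psi>'
  proof -
    note t = nab_tensorial[OF x h]
      pairing_tensorial_right[OF vb met x sections_diff[OF vb sections_diff[OF vb nab_closed[OF h] nab_closed[OF h(2,1)]] br_closed[OF h]]]
    show ?thesis
      using t[THEN tensorial_at_add] t[THEN tensorial_at_scale]
      by (simp add: tensorial_at_def torsion_def algebra_simps)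
  qed
  have "torsion E br nab a b c x = torsion E br nab a' b c x"
    by (rule tensorial_at_eq[OF vb t1[OF a(2,3)] x a(1) a'(1) eq(1)])
  also have "\<dots> = torsion E br nab a' b' c x"
    by (rule tensorial_at_eq[OF vb t2[OF a'(1) a(3)] x a(2) a'(2) eq(2)])
  also have "\<dots> = torsion E br nab a' b' c' x"
    by (rule tensorial_at_eq[OF vb t3[OF a'(1,2)] x a(3) a'(3) eq(3)])
  finally show ?thesis .
qed

text \<open>
  The torsion rewrites \<open>\<langle>K \<phi> \<phi>', K \<psi> \<psi>'\<rangle>\<close> as \<open>- \<langle>\<nabla>\<^sub>X \<psi>, \<psi>'\<rangle>\<close> with \<open>X = \<nabla>\<^sub>\<phi> \<phi>' - \<nabla>\<^sub>\<phi>\<^sub>' \<phi> - [\<phi>, \<phi>']\<close>, and \<open>X\<close> is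
  again a section of \<open>\<Gamma>\<close>. This is how the argument copes with \<open>K \<psi> \<psi>'\<close> lying only in the
  orthogonal complement of a possibly non-maximal isotropic subbundle.
\<close>

lemma riemann_vanishes:
  assumes x: "x \<in> bpoints E" and \<Gamma>: "\<Gamma> \<subseteq> sections E"
    and br: "\<And>\<psi> \<phi>. \<psi> \<in> \<Gamma> \<Longrightarrow> \<phi> \<in> \<Gamma> \<Longrightarrow> br \<psi> \<phi> \<in> \<Gamma>"
    and nab: "\<And>\<psi> \<phi>. \<psi> \<in> \<Gamma> \<Longrightarrow> \<phi> \<in> \<Gamma> \<Longrightarrow> nab \<psi> \<phi> \<in> \<Gamma>"
    and iso: "\<And>\<psi> \<phi>. \<psi> \<in> \<Gamma> \<Longrightarrow> \<phi> \<in> \<Gamma> \<Longrightarrow> pairing E \<psi> \<phi> x = 0"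
    and tor: "\<And>\<psi> \<phi> \<eta>. \<psi> \<in> sections E \<Longrightarrow> \<phi> \<in> sections E \<Longrightarrow> \<eta> \<in> sections E \<Longrightarrow> torsion E br nab \<psi> \<phi> \<eta> x = 0"
    and h: "\<phi>' \<in> \<Gamma>" "\<phi> \<in> \<Gamma>" "\<psi> \<in> \<Gamma>" "\<psi>' \<in> \<Gamma>"
  shows "riemann E br nab \<phi>' \<phi> \<psi> \<psi>' x = 0"
proof -
  have s: "\<eta> \<in> sections E" if "\<eta> \<in> \<Gamma>" for \<eta> using \<Gamma> that by blast
  let ?K = "K_section E nab \<psi> \<psi>'"
  note K = K_section[OF s[OF h(3)] s[OF h(4)]]
  \<comment> \<open>Pairing with \<open>?K\<close> amounts to pairing
    \<open>nab \<eta> \<psi>\<close> with \<psi>', which are both in \<Gamma>. So \<open>?K\<close>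
    is orthogonal to \<Gamma> at \<open>x\<close>.\<close>
  have z: "pairing E \<eta> ?K x = 0" if "\<eta> \<in> \<Gamma>" for \<eta>
    using K(2)[OF s[OF that] x] pair_sym[OF x K(1) s[OF that]] iso[OF nab[OF that h(3)] h(4)] by simp
  \<comment> \<open>In the torsion of \<phi>, \<phi>' and \<open>?K\<close> all other terms pair an
    element of \<Gamma> with \<open>?K\<close>, so this one has to vanish as well. By definition of
    \<open>K\<close> it is the pairing of the two \<open>K\<close> sections.\<close>
  have "pairing E (nab ?K \<phi>) \<phi>' x = 0"
    using tor[OF s[OF h(2)] s[OF h(1)] K(1)] z[OF nab[OF h(2,1)]] z[OF nab[OF h(1,2)]] z[OF br[OF h(2,1)]]
    by (simp add: torsion_expand[OF x s[OF h(2)] s[OF h(1)] K(1)])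
  then have "pairing E (K_section E nab \<phi> \<phi>') ?K x = 0"
    using K_section(2)[OF s[OF h(2)] s[OF h(1)] K(1) x] by simp
  moreover have "riemann0 E br nab a b c d x = 0" if "a \<in> \<Gamma>" "b \<in> \<Gamma>" "c \<in> \<Gamma>" "d \<in> \<Gamma>" for a b c d
    using that by (simp add: riemann0_expand x s iso nab br)
  ultimately show ?thesis using h by (simp add: riemann_def)
qed

end

section \<open>Sections of a subbundle and of a product\<close>

lemma subbundle_subspace:
  assumes "subbundle_on E S L" "s \<in> S"
  shows "subspace (L s)"
  using assms unfolding subbundle_on_def by (metis IntI subspace_span)

text \<open>Combine the local frame with constant coefficients and cut off. The result stays in
  \<open>L\<close> along all of \<open>S\<close>: inside \<open>U\<close> it is in the span of the
  frame, outside it is 0.\<close>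

lemma subbundle_section_through:
  assumes E: "vector_bundle E" and L: "subbundle_on E S L" and s: "s \<in> S" and u: "u \<in> L s"
  obtains \<psi> where "\<psi> \<in> sections_in E S L" "\<psi> s = u"
proof -
  obtain r :: nat and U e where U: "openin (mtop (base E)) U" "s \<in> U"
    and e: "\<And>i. i < r \<Longrightarrow> smooth_section_on E U (e i)"
    and frame: "\<And>x. x \<in> U \<inter> S \<Longrightarrow> inj_on (\<lambda>i. e i x) {..<r} \<and> span ((\<lambda>i. e i x) ` {..<r}) = L x"
    using L s unfolding subbundle_on_def by meson
  obtain \<beta> N C where \<beta>: "\<beta> \<in> smooth_functions (base E)" "openin (mtop (base E)) N"
    "closedin (mtop (base E)) C" "s \<in> N" "N \<subseteq> C" "C \<subseteq> U" "\<And>y. y \<in> N \<Longrightarrow> \<beta> y = 1" "\<And>y. y \<notin> C \<Longrightarrow> \<beta> y = 0"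
    using plateau_exists[OF smooth_base[OF E] U] by blast
  have fs: "inj_on (\<lambda>i. e i s) {..<r}" "span ((\<lambda>i. e i s) ` {..<r}) = L s"
    using frame[of s] U(2) s by auto
  have "u \<in> span ((\<lambda>i. e i s) ` {..<r})" using fs(2) u by simp
  then obtain d where "u = (\<Sum>a\<in>(\<lambda>i. e i s) ` {..<r}. d a *\<^sub>R a)"
    using span_finite[of "(\<lambda>i. e i s) ` {..<r}"] by auto
  then have u: "u = (\<Sum>i<r. d (e i s) *\<^sub>R e i s)" by (simp add: sum.reindex[OF fs(1)])
  define \<psi> where "\<psi> = (\<lambda>y. \<Sum>i<r. d (e i s) *\<^sub>R (\<beta> y *\<^sub>R e i y))"
  have "\<psi> \<in> sections E"
    unfolding \<psi>_def
    by (intro sections_sum[OF E] sections_scale_const[OF E] sections_cutoff[OF E e U(1) \<beta>(3,6,1,8)]) auto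
  moreover have "\<psi> y \<in> L y" if y: "y \<in> S" for y
  proof (cases "y \<in> U")
    case True
    then have "span ((\<lambda>i. e i y) ` {..<r}) = L y" using frame[of y] y by blast
    moreover have "\<psi> y \<in> span ((\<lambda>i. e i y) ` {..<r})"
      unfolding \<psi>_def by (intro span_sum span_scale span_base) auto
    ultimately show ?thesis by simp
  next
    case False
    then have "\<beta> y = 0" using \<beta>(6,8) by blast
    then show ?thesis using subspace_0[OF subbundle_subspace[OF L y]] by (simp add: \<psi>_def)
  qed
  moreover have "\<psi> s = u" using \<beta>(4,7) u by (simp add: \<psi>_def)
  ultimately show ?thesis using that[of \<psi>] by (simp add: sections_in_def)
qed

section \<open>The opposite bundle and pairs of pulled-back sections\<close>

lemma opposite_simps [simp]:
  "base (opposite E) = base E" "fibre (opposite E) = fibre E" "trivs (opposite E) = trivs E"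
  by (simp_all add: opposite_def)

lemma sections_opposite [simp]: "sections (opposite E) = sections E"
  by (simp add: sections_def smooth_section_on_def)

lemma vector_bundle_opposite [simp]: "vector_bundle (opposite E) = vector_bundle E"
  by (simp add: vector_bundle_def)

lemma bpoints_prod_bundle: "bpoints (prod_bundle E1 E2) = bpoints E1 \<times> bpoints E2"
  by (simp add: prod_bundle_def prod_manifold_def)

lemma fibre_prod_bundle: "fibre (prod_bundle E1 E2) (x, y) = fibre E1 x \<times> fibre E2 y"
  by (simp add: prod_bundle_def)

text \<open>Product charts invert componentwise, so each component is a local expression of a factor
  composed with a linear projection.\<close>

lemma smooth_map_on_prod:
  assumes M: "smooth_manifold M1" "smooth_manifold M2"
    and A: "openin (mtop M1) A1" "openin (mtop M2) A2"
    and f: "smooth_map_on M1 A1 f1" "smooth_map_on M2 A2 f2"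
  shows "smooth_map_on (prod_manifold M1 M2) (A1 \<times> A2) (\<lambda>(x, y). (f1 x, f2 y))"
proof (rule smooth_map_onI)
  fix W \<theta> assume "(W, \<theta>) \<in> atlas (prod_manifold M1 M2)"
  then obtain U \<phi> V \<eta> where W: "W = U \<times> V" "\<theta> = map_prod \<phi> \<eta>" and c: "(U, \<phi>) \<in> atlas M1" "(V, \<eta>) \<in> atlas M2"
    by (auto simp: prod_manifold_def)
  note ch = atlas_chart[OF M(1) c(1)] atlas_chart[OF M(2) c(2)]
  let ?X = "\<phi> ` (U \<inter> A1)" and ?Y = "\<eta> ` (V \<inter> A2)"
  have op: "open (?X \<times> ?Y)"
    by (intro open_Times chart_open_image[OF ch(1) A(1)] chart_open_image[OF ch(2) A(2)])
  have img: "\<theta> ` (W \<inter> A1 \<times> A2) = ?X \<times> ?Y"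
    unfolding W by (auto simp: image_iff)
  have inj: "inj_on \<theta> W" unfolding W by (intro map_prod_inj_on chart_inj[OF ch(1)] chart_inj[OF ch(2)])
  have "smooth_on (?X \<times> ?Y) (\<lambda>z. f1 (inv_into U \<phi> (fst z)))"
    by (rule smooth_on_precompose_linear[OF op bounded_linear_fst _ smooth_map_onD[OF f(1) c(1)]]) auto
  moreover have "smooth_on (?X \<times> ?Y) (\<lambda>z. f2 (inv_into V \<eta> (snd z)))"
    by (rule smooth_on_precompose_linear[OF op bounded_linear_snd _ smooth_map_onD[OF f(2) c(2)]]) auto
  ultimately have s: "smooth_on (?X \<times> ?Y) (\<lambda>z. (f1 (inv_into U \<phi> (fst z)), f2 (inv_into V \<eta> (snd z))))"
    by (rule smooth_on_Pair[OF op])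
  have "(f1 (inv_into U \<phi> (fst z)), f2 (inv_into V \<eta> (snd z))) = (\<lambda>(x, y). (f1 x, f2 y)) (inv_into W \<theta> z)"
    if z: "z \<in> ?X \<times> ?Y" for z
  proof -
    obtain x y where xy: "x \<in> U" "y \<in> V" "z = (\<phi> x, \<eta> y)" using z by blast
    have "inv_into W \<theta> (\<theta> (x, y)) = (x, y)"
      by (rule inv_into_f_f[OF inj]) (simp add: W xy)
    then have "inv_into W \<theta> z = (x, y)" by (simp add: W xy)
    then show ?thesis
      using xy inv_into_f_f[OF chart_inj[OF ch(1)] xy(1)] inv_into_f_f[OF chart_inj[OF ch(2)] xy(2)] by simp
  qed
  then show "smooth_on (\<theta> ` (W \<inter> A1 \<times> A2)) (\<lambda>z. (\<lambda>(x, y). (f1 x, f2 y)) (inv_into W \<theta> z))"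
    unfolding img by (rule smooth_on_cong[OF op _ s])
qed

lemma pair_section_in_sections:
  assumes E: "vector_bundle E1" "vector_bundle E2" "vector_bundle (prod_bundle E1 E2)"
    and \<psi>: "\<psi>1 \<in> sections E1" "\<psi>2 \<in> sections E2"
  shows "pair_section E1 E2 \<psi>1 \<psi>2 \<in> sections (prod_bundle E1 E2)"
proof (intro sectionsI[OF E(3)] smooth_section_onI[OF E(3)])
  show "pair_section E1 E2 \<psi>1 \<psi>2 z \<in> fibre (prod_bundle E1 E2) z" if "z \<in> bpoints (prod_bundle E1 E2)" for z
    using that section_in_fibre[OF \<psi>(1)] section_in_fibre[OF \<psi>(2)]
    by (cases z) (simp add: bpoints_prod_bundle fibre_prod_bundle pair_section_def)
  show "pair_section E1 E2 \<psi>1 \<psi>2 z = 0" if "z \<notin> bpoints (prod_bundle E1 E2)" for z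
    using that by (cases z) (auto simp: bpoints_prod_bundle pair_section_def)
  fix W \<Theta> assume "(W, \<Theta>) \<in> trivs (prod_bundle E1 E2)"
  then obtain U \<Phi> V \<Psi> where W: "W = U \<times> V" "\<Theta> = (\<lambda>(x, y). map_prod (\<Phi> x) (\<Psi> y))"
    and t: "(U, \<Phi>) \<in> trivs E1" "(V, \<Psi>) \<in> trivs E2"
    by (auto simp: prod_bundle_def)
  have op: "openin (mtop (base E1)) (bpoints E1 \<inter> U)" "openin (mtop (base E2)) (bpoints E2 \<inter> V)"
    using triv_open[OF E(1) t(1)] triv_open[OF E(2) t(2)] by blast+
  have set: "bpoints (prod_bundle E1 E2) \<inter> W = (bpoints E1 \<inter> U) \<times> (bpoints E2 \<inter> V)"
    by (auto simp: bpoints_prod_bundle W)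
  have b: "base (prod_bundle E1 E2) = prod_manifold (base E1) (base E2)" by (simp add: prod_bundle_def)
  have M: "smooth_manifold (prod_manifold (base E1) (base E2))"
    using smooth_base[OF E(3)] unfolding b .
  have op': "openin (mtop (prod_manifold (base E1) (base E2))) ((bpoints E1 \<inter> U) \<times> (bpoints E2 \<inter> V))"
    using op by (simp add: prod_manifold_def openin_prod_Times_iff)
  have "smooth_map_on (prod_manifold (base E1) (base E2)) ((bpoints E1 \<inter> U) \<times> (bpoints E2 \<inter> V))
      (\<lambda>(x, y). (\<Phi> x (\<psi>1 x), \<Psi> y (\<psi>2 y)))"
    by (rule smooth_map_on_prod[OF smooth_base[OF E(1)] smooth_base[OF E(2)] op
        smooth_section_onD[OF E(1) sections_smooth[OF E(1) \<psi>(1)] t(1)]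
        smooth_section_onD[OF E(2) sections_smooth[OF E(2) \<psi>(2)] t(2)]])
  then have "smooth_map_on (prod_manifold (base E1) (base E2)) ((bpoints E1 \<inter> U) \<times> (bpoints E2 \<inter> V))
      (\<lambda>z. \<Theta> z (pair_section E1 E2 \<psi>1 \<psi>2 z))"
    by (rule smooth_map_on_cong[OF M op', rotated]) (auto simp: W pair_section_def)
  then show "smooth_map_on (base (prod_bundle E1 E2)) (bpoints (prod_bundle E1 E2) \<inter> W)
      (\<lambda>z. \<Theta> z (pair_section E1 E2 \<psi>1 \<psi>2 z))"
    unfolding set unfolding b .
qed

lemma pairing_pair_section:
  assumes "x \<in> bpoints E1" "y \<in> bpoints E2"
  shows "pairing (prod_bundle E1 (opposite E2)) (pair_section E1 (opposite E2) \<psi>1 \<psi>2) (pair_section E1 (opposite E2) \<phi>1 \<phi>2) (x, y) =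
    pairing E1 \<psi>1 \<phi>1 x - pairing E2 \<psi>2 \<phi>2 y"
  using assms by (simp add: pairing_def prod_bundle_def pair_section_def opposite_def)

section \<open>Product connections\<close>

text \<open>\<open>A2\<close> concerns \<open>E2\<close> with its own metric; the sign enters only
  through \<open>opposite\<close> in the product. Since \<open>opposite\<close> keeps the sections,
  the pairs are formed from sections of \<open>E2\<close> itself.\<close>

locale product_setting =
  A1: courant_with_connection E1 br1 nab1 + A2: courant_with_connection E2 br2 nab2 +
  A: courant_with_connection "prod_bundle E1 (opposite E2)" br nab
  for E1 :: "('m1, 'e1::real_inner, 'v1::real_vector, 'f1::real_inner) anchored_bundle"
    and br1 nab1 :: "('m1, 'v1) section_op"
    and E2 :: "('m2, 'e2::real_inner, 'v2::real_vector, 'f2::real_inner) anchored_bundle"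
    and br2 nab2 :: "('m2, 'v2) section_op"
    and br nab :: "('m1 \<times> 'm2, 'v1 \<times> 'v2) section_op" +
  assumes br_pairs: "\<lbrakk>\<psi>1 \<in> sections E1; \<psi>2 \<in> sections E2; \<phi>1 \<in> sections E1; \<phi>2 \<in> sections E2\<rbrakk> \<Longrightarrow>
      br (pair_section E1 (opposite E2) \<psi>1 \<psi>2) (pair_section E1 (opposite E2) \<phi>1 \<phi>2) =
      pair_section E1 (opposite E2) (br1 \<psi>1 \<phi>1) (br2 \<psi>2 \<phi>2)"
    and nab_pairs: "\<lbrakk>\<psi>1 \<in> sections E1; \<psi>2 \<in> sections E2; \<phi>1 \<in> sections E1; \<phi>2 \<in> sections E2\<rbrakk> \<Longrightarrow>
      nab (pair_section E1 (opposite E2) \<psi>1 \<psi>2) (pair_section E1 (opposite E2) \<phi>1 \<phi>2) =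
      pair_section E1 (opposite E2) (nab1 \<psi>1 \<phi>1) (nab2 \<psi>2 \<phi>2)"
begin

abbreviation "E \<equiv> prod_bundle E1 (opposite E2)"
abbreviation "pair \<equiv> pair_section E1 (opposite E2)"

lemma pair_in: "\<psi>1 \<in> sections E1 \<Longrightarrow> \<psi>2 \<in> sections E2 \<Longrightarrow> pair \<psi>1 \<psi>2 \<in> sections E"
  using pair_section_in_sections[of E1 "opposite E2"] A1.vb A2.vb A.vb by simp

lemma point: "x \<in> bpoints E1 \<Longrightarrow> y \<in> bpoints E2 \<Longrightarrow> (x, y) \<in> bpoints E"
  by (simp add: bpoints_prod_bundle)

text \<open>The fibre of the product splits, and each component extends to a section of its factor.
  The agreement is at the single point only, which suffices for tensorial expressions.\<close>

lemma pair_through: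
  assumes "x \<in> bpoints E1" "y \<in> bpoints E2" "\<psi> \<in> sections E"
  obtains \<psi>1 \<psi>2 where "\<psi>1 \<in> sections E1" "\<psi>2 \<in> sections E2" "\<psi> (x, y) = pair \<psi>1 \<psi>2 (x, y)"
proof -
  obtain u v where uv: "\<psi> (x, y) = (u, v)" by fastforce
  have "u \<in> fibre E1 x" "v \<in> fibre E2 y"
    using section_in_fibre[OF assms(3) point[OF assms(1,2)]] by (simp_all add: uv fibre_prod_bundle)
  then obtain \<psi>1 \<psi>2 where "\<psi>1 \<in> sections E1" "\<psi>1 x = u" "\<psi>2 \<in> sections E2" "\<psi>2 y = v"
    using section_through[OF A1.vb assms(1)] section_through[OF A2.vb assms(2)] by metis
  then show ?thesis using that assms(1,2) by (simp add: uv pair_section_def)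
qed

lemma torsion_pairs:
  assumes "x \<in> bpoints E1" "y \<in> bpoints E2" "a1 \<in> sections E1" "b1 \<in> sections E1" "c1 \<in> sections E1"
    "a2 \<in> sections E2" "b2 \<in> sections E2" "c2 \<in> sections E2"
  shows "torsion E br nab (pair a1 a2) (pair b1 b2) (pair c1 c2) (x, y) =
    torsion E1 br1 nab1 a1 b1 c1 x - torsion E2 br2 nab2 a2 b2 c2 y"
  using assms
  by (simp add: A.torsion_expand A1.torsion_expand A2.torsion_expand point pair_in nab_pairs br_pairs
      pairing_pair_section)

lemma torsion_free_prod:
  assumes "torsion_free E1 br1 nab1" "torsion_free E2 br2 nab2" "x \<in> bpoints E1" "y \<in> bpoints E2"
    "a \<in> sections E" "b \<in> sections E" "c \<in> sections E"
  shows "torsion E br nab a b c (x, y) = 0"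
proof -
  obtain a1 a2 where a: "a1 \<in> sections E1" "a2 \<in> sections E2" "a (x, y) = pair a1 a2 (x, y)"
    using pair_through[OF assms(3,4,5)] .
  obtain b1 b2 where b: "b1 \<in> sections E1" "b2 \<in> sections E2" "b (x, y) = pair b1 b2 (x, y)"
    using pair_through[OF assms(3,4,6)] .
  obtain c1 c2 where c: "c1 \<in> sections E1" "c2 \<in> sections E2" "c (x, y) = pair c1 c2 (x, y)"
    using pair_through[OF assms(3,4,7)] .
  have "torsion E br nab a b c (x, y) = torsion E br nab (pair a1 a2) (pair b1 b2) (pair c1 c2) (x, y)"
    by (rule A.torsion_eq_at[OF point[OF assms(3,4)] assms(5-7) pair_in[OF a(1,2)] pair_in[OF b(1,2)]
          pair_in[OF c(1,2)] a(3) b(3) c(3)])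
  then show ?thesis
    using torsion_pairs[OF assms(3,4) a(1) b(1) c(1) a(2) b(2) c(2)] assms(1-4) a(1,2) b(1,2) c(1,2)
    by (simp add: torsion_free_def)
qed

text \<open>Both sides of the equation defining \<open>K\<close> change sign with the metric, so the
  second component is the \<open>K\<close> of \<open>E2\<close> although the product carries the
  opposite metric.\<close>

lemma K_section_pairs:
  assumes x: "x \<in> bpoints E1" and y: "y \<in> bpoints E2" and a: "a1 \<in> sections E1" "a2 \<in> sections E2"
    and b: "b1 \<in> sections E1" "b2 \<in> sections E2"
  shows "K_section E nab (pair a1 a2) (pair b1 b2) (x, y) =
    pair (K_section E1 nab1 a1 b1) (K_section E2 nab2 a2 b2) (x, y)"
proof (rule section_eq_at[OF A.vb A.met point[OF x y]])
  note K1 = A1.K_section[OF a(1) b(1)] and K2 = A2.K_section[OF a(2) b(2)]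
  note K = A.K_section[OF pair_in[OF a] pair_in[OF b]]
  show "K_section E nab (pair a1 a2) (pair b1 b2) \<in> sections E" by (rule K(1))
  show p: "pair (K_section E1 nab1 a1 b1) (K_section E2 nab2 a2 b2) \<in> sections E"
    by (rule pair_in[OF K1(1) K2(1)])
  fix \<eta> assume \<eta>: "\<eta> \<in> sections E"
  obtain c1 c2 where c: "c1 \<in> sections E1" "c2 \<in> sections E2" "\<eta> (x, y) = pair c1 c2 (x, y)"
    using pair_through[OF x y \<eta>] .
  have "pairing E (K_section E nab (pair a1 a2) (pair b1 b2)) \<eta> (x, y) =
      pairing E (nab \<eta> (pair a1 a2)) (pair b1 b2) (x, y)"
    by (rule K(2)[OF \<eta> point[OF x y]])
  \<comment> \<open>The connection is tensorial in its direction, so \<eta> may be replaced by the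
    pair with the same value, on which the product connection is given.\<close>
  also have "\<dots> = pairing E (nab (pair c1 c2) (pair a1 a2)) (pair b1 b2) (x, y)"
    by (rule tensorial_at_eq[OF A.vb A.nab_tensorial[OF point[OF x y] pair_in[OF a] pair_in[OF b]]
          point[OF x y] \<eta> pair_in[OF c(1,2)] c(3)])
  also have "\<dots> = pairing E1 (nab1 c1 a1) b1 x - pairing E2 (nab2 c2 a2) b2 y"
    by (simp add: nab_pairs a c pairing_pair_section x y)
  also have "\<dots> = pairing E (pair (K_section E1 nab1 a1 b1) (K_section E2 nab2 a2 b2)) (pair c1 c2) (x, y)"
    by (simp add: pairing_pair_section x y K1(2)[OF c(1) x] K2(2)[OF c(2) y])
  also have "\<dots> = pairing E (pair (K_section E1 nab1 a1 b1) (K_section E2 nab2 a2 b2)) \<eta> (x, y)"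
    by (simp add: pairing_def c(3))
  finally show "pairing E (K_section E nab (pair a1 a2) (pair b1 b2)) \<eta> (x, y) =
      pairing E (pair (K_section E1 nab1 a1 b1) (K_section E2 nab2 a2 b2)) \<eta> (x, y)" .
qed

lemma riemann0_pairs:
  assumes "x \<in> bpoints E1" "y \<in> bpoints E2"
    "a1 \<in> sections E1" "b1 \<in> sections E1" "c1 \<in> sections E1" "d1 \<in> sections E1"
    "a2 \<in> sections E2" "b2 \<in> sections E2" "c2 \<in> sections E2" "d2 \<in> sections E2"
  shows "riemann0 E br nab (pair a1 a2) (pair b1 b2) (pair c1 c2) (pair d1 d2) (x, y) =
    riemann0 E1 br1 nab1 a1 b1 c1 d1 x - riemann0 E2 br2 nab2 a2 b2 c2 d2 y"
  using assms
  by (simp add: A.riemann0_expand A1.riemann0_expand A2.riemann0_expand point pair_in nab_pairs br_pairs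
      A1.nab_closed A2.nab_closed A1.br_closed A2.br_closed pairing_pair_section)

lemma riemann_pairs:
  assumes x: "x \<in> bpoints E1" and y: "y \<in> bpoints E2"
    and s1: "a1 \<in> sections E1" "b1 \<in> sections E1" "c1 \<in> sections E1" "d1 \<in> sections E1"
    and s2: "a2 \<in> sections E2" "b2 \<in> sections E2" "c2 \<in> sections E2" "d2 \<in> sections E2"
  shows "riemann E br nab (pair a1 a2) (pair b1 b2) (pair c1 c2) (pair d1 d2) (x, y) =
    riemann E1 br1 nab1 a1 b1 c1 d1 x - riemann E2 br2 nab2 a2 b2 c2 d2 y"
proof -
  have K: "K_section E nab (pair b1 b2) (pair a1 a2) (x, y) =
      pair (K_section E1 nab1 b1 a1) (K_section E2 nab2 b2 a2) (x, y)"
    "K_section E nab (pair c1 c2) (pair d1 d2) (x, y) =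
      pair (K_section E1 nab1 c1 d1) (K_section E2 nab2 c2 d2) (x, y)"
    using K_section_pairs[OF x y] s1 s2 by blast+
  have "pairing E (K_section E nab (pair b1 b2) (pair a1 a2)) (K_section E nab (pair c1 c2) (pair d1 d2)) (x, y) =
      pairing E (pair (K_section E1 nab1 b1 a1) (K_section E2 nab2 b2 a2))
        (pair (K_section E1 nab1 c1 d1) (K_section E2 nab2 c2 d2)) (x, y)"
    by (simp add: pairing_def K)
  then show ?thesis
    by (simp add: riemann_def riemann0_pairs[OF x y] s1 s2 pairing_pair_section[OF x y] field_simps)
qed

end

section \<open>Comparison of the two Riemann tensors at a point of the support\<close>

lemma some_section_through:
  assumes "vector_bundle E" "x \<in> bpoints E" "u \<in> fibre E x"
  shows "(SOME \<psi>. \<psi> \<in> sections E \<and> \<psi> x = u) \<in> sections E" "(SOME \<psi>. \<psi> \<in> sections E \<and> \<psi> x = u) x = u"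
proof -
  have "\<exists>\<psi>. \<psi> \<in> sections E \<and> \<psi> x = u"
    using section_through[OF assms] by metis
  from someI_ex[OF this]
  show "(SOME \<psi>. \<psi> \<in> sections E \<and> \<psi> x = u) \<in> sections E" "(SOME \<psi>. \<psi> \<in> sections E \<and> \<psi> x = u) x = u"
    by blast+
qed

theorem proposition6p8:
  fixes E1 :: "('m1, 'e1::real_inner, 'v1::real_vector, 'f1::real_inner) anchored_bundle"
    and E2 :: "('m2, 'e2::real_inner, 'v2::real_vector, 'f2::real_inner) anchored_bundle"
    and br1 nab1 :: "('m1, 'v1) section_op"
    and br2 nab2 :: "('m2, 'v2) section_op"
    and S :: "('m1 \<times> 'm2) set"
    and R :: "'m1 \<times> 'm2 \<Rightarrow> ('v1 \<times> 'v2) set"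
  assumes "courant_algebroid E1 br1"
    and "courant_algebroid E2 br2"
    and "courant_connection E1 nab1"
    and "courant_connection E2 nab2"
    and "torsion_free E1 br1 nab1"
    and "torsion_free E2 br2 nab2"
    and "courant_relation E1 br1 E2 br2 S R"
    and "related_connections E1 E2 S R nab1 nab2"
  shows "related_tensors 4 E1 E2 S R (riemann_tensor E1 br1 nab1) (riemann_tensor E2 br2 nab2)"
proof -
  let ?E = "prod_bundle E1 (opposite E2)"
  obtain br where br: "product_bracket E1 br1 (opposite E2) br2 br" and inv: "involutive_structure ?E br S R"
    using assms(7) unfolding courant_relation_def by (elim exE conjE)
  obtain nab where nab: "product_connection E1 nab1 (opposite E2) nab2 nab"
    and nab_R: "\<forall>\<psi>\<in>sections_in ?E S R. \<forall>\<psi>'\<in>sections_in ?E S R. nab \<psi> \<psi>' \<in> sections_in ?E S R"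
    using assms(8) unfolding related_connections_def by (elim exE conjE)
  interpret product_setting E1 br1 nab1 E2 br2 nab2 br nab
  proof unfold_locales
    show "courant_algebroid ?E br" using br unfolding product_bracket_def by (rule conjunct1)
    show "courant_connection ?E nab" using nab unfolding product_connection_def by (rule conjunct1)
  qed (use br nab assms(1-4) in \<open>simp_all add: product_bracket_def product_connection_def\<close>)
  note inv' = inv[unfolded involutive_structure_def]
  have sub: "subbundle_on ?E S R" by (rule inv'[THEN conjunct2, THEN conjunct1])
  have perp: "R s \<subseteq> perp ?E R s" if "s \<in> S" for s
    using inv'[THEN conjunct2, THEN conjunct2, THEN conjunct1] that by (rule bspec)
  have br_R: "br \<psi> \<psi>' \<in> sections_in ?E S R" if "\<psi> \<in> sections_in ?E S R" "\<psi>' \<in> sections_in ?E S R" for \<psi> \<psi>'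
    by (rule inv'[THEN conjunct2, THEN conjunct2, THEN conjunct2, THEN conjunct2, THEN bspec, THEN bspec]) (fact that)+
  have SM: "S \<subseteq> bpoints ?E"
    using inv'[THEN conjunct1] unfolding embedded_submanifold_def by (rule conjunct1)
  have "tensor_at E1 (riemann_tensor E1 br1 nab1) x u1 = tensor_at E2 (riemann_tensor E2 br2 nab2) y u2"
    if s: "(x, y) \<in> S" and u: "\<And>i. i < 4 \<Longrightarrow> (u1 i, u2 i) \<in> R (x, y)" for x y and u1 :: "nat \<Rightarrow> 'v1" and u2 :: "nat \<Rightarrow> 'v2"
  proof -
    have x: "x \<in> bpoints E1" and y: "y \<in> bpoints E2" using SM s by (auto simp: bpoints_prod_bundle)
    \<comment> \<open>These are the very choices made inside \<open>tensor_at\<close>, so the final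
      unfolding matches them literally.\<close>
    define \<psi>1 where "\<psi>1 i = (SOME \<psi>. \<psi> \<in> sections E1 \<and> \<psi> x = u1 i)" for i
    define \<psi>2 where "\<psi>2 i = (SOME \<psi>. \<psi> \<in> sections E2 \<and> \<psi> y = u2 i)" for i
    \<comment> \<open>The vectors lie in the fibres because \<open>R\<close> is contained in its
      \<open>perp\<close>, which is a subset of the fibre by definition.\<close>
    have fib: "u1 i \<in> fibre E1 x" "u2 i \<in> fibre E2 y" if "i < 4" for i
      using perp[OF s] u[OF that] by (auto simp: perp_def fibre_prod_bundle)
    have \<psi>1: "\<psi>1 i \<in> sections E1" "\<psi>1 i x = u1 i" if "i < 4" for i
      unfolding \<psi>1_def by (rule some_section_through[OF A1.vb x fib(1)[OF that]])+
    have \<psi>2: "\<psi>2 i \<in> sections E2" "\<psi>2 i y = u2 i" if "i < 4" for i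
      unfolding \<psi>2_def by (rule some_section_through[OF A2.vb y fib(2)[OF that]])+
    \<comment> \<open>Sections that stay in \<open>R\<close> along \<open>S\<close> are needed for
      closure under bracket and connection, whereas the chosen pairs are only known to lie in
      \<open>R\<close> at the point itself. Both have the same values there, and
      \<open>riemann_eq_at\<close> passes from one to the other.\<close>
    have "\<forall>i. \<exists>\<psi>. i < 4 \<longrightarrow> \<psi> \<in> sections_in ?E S R \<and> \<psi> (x, y) = (u1 i, u2 i)"
      using subbundle_section_through[OF A.vb sub s u] by metis
    then obtain \<xi> where "\<forall>i<4. \<xi> i \<in> sections_in ?E S R \<and> \<xi> i (x, y) = (u1 i, u2 i)"
      by metis
    then have \<xi>: "\<xi> i \<in> sections_in ?E S R" "\<xi> i (x, y) = pair (\<psi>1 i) (\<psi>2 i) (x, y)" if "i < 4" for i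
      using that \<psi>1[OF that] \<psi>2[OF that] x y by (auto simp: pair_section_def)
    have \<xi>s: "\<xi> i \<in> sections ?E" if "i < 4" for i using \<xi>(1)[OF that] by (simp add: sections_in_def)
    have "riemann ?E br nab (\<xi> 0) (\<xi> 1) (\<xi> 2) (\<xi> 3) (x, y) = 0"
    proof (rule A.riemann_vanishes[OF point[OF x y], where \<Gamma> = "sections_in ?E S R"])
      show "pairing ?E \<psi> \<phi> (x, y) = 0" if "\<psi> \<in> sections_in ?E S R" "\<phi> \<in> sections_in ?E S R" for \<psi> \<phi>
      proof -
        have "\<psi> (x, y) \<in> perp ?E R (x, y)" "\<phi> (x, y) \<in> R (x, y)"
          using that perp[OF s] s by (auto simp: sections_in_def)
        then show ?thesis by (simp add: perp_def pairing_def)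
      qed
      show "torsion ?E br nab \<psi> \<phi> \<eta> (x, y) = 0"
        if "\<psi> \<in> sections ?E" "\<phi> \<in> sections ?E" "\<eta> \<in> sections ?E" for \<psi> \<phi> \<eta>
        by (rule torsion_free_prod[OF assms(5,6) x y that])
      show "nab \<psi> \<phi> \<in> sections_in ?E S R" if "\<psi> \<in> sections_in ?E S R" "\<phi> \<in> sections_in ?E S R" for \<psi> \<phi>
        using nab_R that by (blast intro: bspec)
    qed (use \<xi>(1) br_R in \<open>auto simp: sections_in_def\<close>)
    also have "riemann ?E br nab (\<xi> 0) (\<xi> 1) (\<xi> 2) (\<xi> 3) (x, y) =
        riemann ?E br nab (pair (\<psi>1 0) (\<psi>2 0)) (pair (\<psi>1 1) (\<psi>2 1)) (pair (\<psi>1 2) (\<psi>2 2)) (pair (\<psi>1 3) (\<psi>2 3)) (x, y)"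
      by (rule A.riemann_eq_at[OF point[OF x y]]) (simp_all add: \<xi>(2) \<xi>s pair_in \<psi>1(1) \<psi>2(1))
    also have "\<dots> = riemann E1 br1 nab1 (\<psi>1 0) (\<psi>1 1) (\<psi>1 2) (\<psi>1 3) x - riemann E2 br2 nab2 (\<psi>2 0) (\<psi>2 1) (\<psi>2 2) (\<psi>2 3) y"
      by (rule riemann_pairs[OF x y]) (simp_all add: \<psi>1(1) \<psi>2(1))
    finally show ?thesis
      unfolding tensor_at_def riemann_tensor_def \<psi>1_def \<psi>2_def by simp
  qed
  then show ?thesis unfolding related_tensors_def by blast
qed

end
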